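(* The communication problem $F^{(k)}\circ\textsc{xor}$ can be solved in the quantum simultaneous-message model with entanglement with $O(k^5\log^3N\log k)$ bits of communication, when Alice and Bob share $O(k^5\log^3N\log k)$ EPR pairs. However, any randomized (interactive) protocol of cost $\tilde o(N^{1/4})$ for $F^{(k)}\circ\textsc{xor}$ has worst-case success probability at most $\frac12+\exp(-\Omega(k))$.
   Context: Let $n\in\mathbb{N}$, $N=2^n$ sufficiently large, $k\in\mathbb{N}$ with $k=o(N^{1/50})$, $\epsilon=\frac{1}{60k^2\ln N}$; asymptotics as $N\to\infty$. $H_N$ is the $N\times N$ matrix with $H_N(a,b)=N^{-1/2}(-1)^{\sum_i a_ib_i}$ for $a,b\in\{0,1\}^n$. For $z=(x,y)$, $x,y\in\mathbb{R}^N$, $forr(z)=\frac1N\langle x,H_Ny\rangle$. $F:\{-1,1\}^{2N}\to\{-1,1\}$ is the partial function with $F(z)=-1$ if $forr(z)\ge\epsilon/2$, $F(z)=1$ if $forr(z)\le\epsilon/4$, undefined otherwise; $F^{(k)}(z_1,\dots,z_k)=\prod_{j=1}^kF(z_j)$ for $z_j\in\{-1,1\}^{2N}$. In the communication problem $F^{(k)}\circ\textsc{xor}$, Alice gets $x\in\{-1,1\}^{2kN}$, Bob gets $y\in\{-1,1\}^{2kN}$, and they must compute the partial function $F^{(k)}(x\cdot y)$, where $x\cdot y$ is the coordinatewise product. In the quantum simultaneous model with entanglement, Alice and Bob share EPR pairs and each sends one quantum message to a referee, who outputs the answer.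
   Formalization: The factor log k in the bounds on communication and EPR pairs is read as max(1, log₂ k), since for k = 1 the literal bound is 0 and no protocol without communication solves the problem; k ≥ 1 is assumed so that ε is defined. *)

theory Defs
  imports
    "HOL-Probability.Probability_Mass_Function"
    "HOL-Library.Landau_Symbols"
    "Jordan_Normal_Form.Schur_Decomposition"
begin

unbundle no inner_syntax
unbundle no vec_syntax
hide_const (open) Finite_Cartesian_Product.vec Finite_Cartesian_Product.mat

section \<open>The XOR of Forrelation functions\<close>

text \<open>
  Throughout, \<open>N = 2 ^ n\<close>, and \<open>{0,1}\<^sup>n\<close> is identified with \<open>{0..<2 ^ n}\<close> by binary expansion.
\<close>

definition hadamard :: "nat \<Rightarrow> real mat" where
  "hadamard n = mat (2 ^ n) (2 ^ n)
     (\<lambda>(a, b). (- 1) ^ (\<Sum>i<n. of_bool (bit a i) * of_bool (bit b i)) / sqrt (2 ^ n))"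

definition forr :: "nat \<Rightarrow> real vec \<Rightarrow> real" where
  "forr n z = 1 / 2 ^ n *
     (vec_first z (2 ^ n) \<bullet> (hadamard n *\<^sub>v vec_last z (2 ^ n)))"

definition sign_cube :: "nat \<Rightarrow> real vec set" where
  "sign_cube d = {z \<in> carrier_vec d. \<forall>i<d. z $ i \<in> {- 1, 1}}"

definition forr_eps :: "nat \<Rightarrow> nat \<Rightarrow> real" where
  "forr_eps n k = 1 / (60 * real k ^ 2 * ln (2 ^ n))"

text \<open>Partial functions are option-valued, with \<open>None\<close> for ``undefined''.\<close>

definition forr_fun :: "nat \<Rightarrow> nat \<Rightarrow> real vec \<Rightarrow> int option" where
  "forr_fun n k z =
     (if forr n z \<ge> forr_eps n k / 2 then Some (- 1)
      else if forr n z \<le> forr_eps n k / 4 then Some 1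
      else None)"

definition block :: "nat \<Rightarrow> real vec \<Rightarrow> nat \<Rightarrow> real vec" where
  "block d z j = vec d (\<lambda>i. z $ (j * d + i))"

definition forr_xor_fun :: "nat \<Rightarrow> nat \<Rightarrow> real vec \<Rightarrow> int option" where
  "forr_xor_fun n k z =
     (if \<forall>j<k. forr_fun n k (block (2 * 2 ^ n) z j) \<noteq> None
      then Some (\<Prod>j<k. the (forr_fun n k (block (2 * 2 ^ n) z j)))
      else None)"

definition coord_prod :: "real vec \<Rightarrow> real vec \<Rightarrow> real vec" where
  "coord_prod x y = vec (dim_vec x) (\<lambda>i. x $ i * y $ i)"

definition forr_xor_comm :: "nat \<Rightarrow> nat \<Rightarrow> real vec \<Rightarrow> real vec \<Rightarrow> int option" where
  "forr_xor_comm n k x y = forr_xor_fun n k (coord_prod x y)"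

definition comm_inputs :: "nat \<Rightarrow> nat \<Rightarrow> real vec set" where
  "comm_inputs n k = sign_cube (2 * k * 2 ^ n)"

text \<open>The promise of a partial communication problem \<open>f\<close> whose inputs range over \<open>X\<close> and \<open>Y\<close>.\<close>

definition promise :: "'x set \<Rightarrow> 'y set \<Rightarrow> ('x \<Rightarrow> 'y \<Rightarrow> 'o option) \<Rightarrow> ('x \<times> 'y) set" where
  "promise X Y f = {(x, y). x \<in> X \<and> y \<in> Y \<and> f x y \<noteq> None}"


section \<open>Randomized interactive protocols\<close>

text \<open>At an inner node the named player sends one bit, computed from that player's input alone.\<close>

datatype ('x, 'y, 'o) protocol =
    Output 'o
  | Alice "'x \<Rightarrow> bool" "('x, 'y, 'o) protocol" "('x, 'y, 'o) protocol"
  | Bob "'y \<Rightarrow> bool" "('x, 'y, 'o) protocol" "('x, 'y, 'o) protocol"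

primrec run :: "('x, 'y, 'o) protocol \<Rightarrow> 'x \<Rightarrow> 'y \<Rightarrow> 'o" where
  "run (Output r) x y = r"
| "run (Alice s p q) x y = (if s x then run p x y else run q x y)"
| "run (Bob s p q) x y = (if s y then run p x y else run q x y)"

primrec depth :: "('x, 'y, 'o) protocol \<Rightarrow> nat" where
  "depth (Output r) = 0"
| "depth (Alice s p q) = Suc (max (depth p) (depth q))"
| "depth (Bob s p q) = Suc (max (depth p) (depth q))"

text \<open>
  A randomized protocol (with public coins, which subsume private ones) is a distribution on
  deterministic protocols. Its cost is the largest depth in the support.
\<close>

definition rand_cost_le :: "('x, 'y, 'o) protocol pmf \<Rightarrow> real \<Rightarrow> bool" where
  "rand_cost_le R t \<longleftrightarrow> (\<forall>p\<in>set_pmf R. real (depth p) \<le> t)"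

definition worst_case_success ::
    "'x set \<Rightarrow> 'y set \<Rightarrow> ('x \<Rightarrow> 'y \<Rightarrow> 'o option) \<Rightarrow> ('x, 'y, 'o) protocol pmf \<Rightarrow> real" where
  "worst_case_success X Y f R =
     (INF (x, y)\<in>promise X Y f. measure_pmf.prob R {p. f x y = Some (run p x y)})"


section \<open>Quantum simultaneous-message protocols with entanglement\<close>

definition kron :: "complex mat \<Rightarrow> complex mat \<Rightarrow> complex mat" where
  "kron A B = mat (dim_row A * dim_row B) (dim_col A * dim_col B)
     (\<lambda>(i, j). A $$ (i div dim_row B, j div dim_col B) * B $$ (i mod dim_row B, j mod dim_col B))"

text \<open>
  The state of \<open>m\<close> EPR pairs, with all of Alice's qubits placed before Bob's:
  \<open>2\<^bsup>-m/2\<^esup> \<Sum>\<^sub>a |a\<rangle>|a\<rangle>\<close>, the basis vector \<open>|a\<rangle>|b\<rangle>\<close> having index \<open>a * 2 ^ m + b\<close>.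
\<close>

definition epr_state :: "nat \<Rightarrow> complex vec" where
  "epr_state m = vec (2 ^ m * 2 ^ m)
     (\<lambda>i. if i div 2 ^ m = i mod 2 ^ m then complex_of_real (1 / sqrt (2 ^ m)) else 0)"

text \<open>Kraus operators of a quantum channel from \<open>m\<close> qubits to \<open>q\<close> qubits.\<close>

definition kraus_ops :: "nat \<Rightarrow> nat \<Rightarrow> complex mat list \<Rightarrow> bool" where
  "kraus_ops m q Ks \<longleftrightarrow>
     set Ks \<subseteq> carrier_mat (2 ^ q) (2 ^ m) \<and>
     foldr (+) (map (\<lambda>K. mat_adjoint K * K) Ks) (0\<^sub>m (2 ^ m) (2 ^ m)) = 1\<^sub>m (2 ^ m)"

definition psd :: "nat \<Rightarrow> complex mat \<Rightarrow> bool" where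
  "psd d E \<longleftrightarrow> E \<in> carrier_mat d d \<and> mat_adjoint E = E \<and>
     (\<forall>v\<in>carrier_vec d. Re ((E *\<^sub>v v) \<bullet>c v) \<ge> 0)"

text \<open>
  Each player applies a channel, chosen by that player's input, to their halves of the EPR pairs
  and sends the resulting qubits. The referee applies a measurement with outcomes \<open>- 1\<close> and \<open>1\<close>
  to the two messages.
\<close>

record ('x, 'y) qsmp =
  epr_pairs :: nat
  alice_qubits :: nat
  bob_qubits :: nat
  alice_channel :: "'x \<Rightarrow> complex mat list"
  bob_channel :: "'y \<Rightarrow> complex mat list"
  referee :: "int \<Rightarrow> complex mat"

definition qsmp_valid :: "'x set \<Rightarrow> 'y set \<Rightarrow> ('x, 'y) qsmp \<Rightarrow> bool" where
  "qsmp_valid X Y P \<longleftrightarrow>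
     (\<forall>x\<in>X. kraus_ops (epr_pairs P) (alice_qubits P) (alice_channel P x)) \<and>
     (\<forall>y\<in>Y. kraus_ops (epr_pairs P) (bob_qubits P) (bob_channel P y)) \<and>
     psd (2 ^ (alice_qubits P + bob_qubits P)) (referee P (- 1)) \<and>
     psd (2 ^ (alice_qubits P + bob_qubits P)) (referee P 1) \<and>
     referee P (- 1) + referee P 1 = 1\<^sub>m (2 ^ (alice_qubits P + bob_qubits P))"

definition qsmp_cost :: "('x, 'y) qsmp \<Rightarrow> nat" where
  "qsmp_cost P = alice_qubits P + bob_qubits P"

text \<open>
  The probability that the referee outputs \<open>r\<close>: the Born rule \<open>tr (E\<^sub>r \<rho>)\<close> for the joint message
  \<open>\<rho> = \<Sum>\<^sub>A\<^sub>,\<^sub>B |\<phi>\<^sub>A\<^sub>B\<rangle>\<langle>\<phi>\<^sub>A\<^sub>B|\<close>, where \<open>\<phi>\<^sub>A\<^sub>B\<close> is \<open>A \<otimes> B\<close> applied to the EPR state.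
\<close>

definition qsmp_prob :: "('x, 'y) qsmp \<Rightarrow> 'x \<Rightarrow> 'y \<Rightarrow> int \<Rightarrow> real" where
  "qsmp_prob P x y r =
     (\<Sum>A\<leftarrow>alice_channel P x. \<Sum>B\<leftarrow>bob_channel P y.
        let \<phi> = kron A B *\<^sub>v epr_state (epr_pairs P) in Re ((referee P r *\<^sub>v \<phi>) \<bullet>c \<phi>))"

definition qsmp_solves ::
    "'x set \<Rightarrow> 'y set \<Rightarrow> ('x \<Rightarrow> 'y \<Rightarrow> int option) \<Rightarrow> ('x, 'y) qsmp \<Rightarrow> bool" where
  "qsmp_solves X Y f P \<longleftrightarrow> qsmp_valid X Y P \<and>
     (\<forall>(x, y)\<in>promise X Y f. qsmp_prob P x y (the (f x y)) \<ge> 2 / 3)"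

text \<open>
  The bound \<open>k\<^sup>5 log\<^sup>3 N log k\<close>. As usual inside \<open>O(\<cdot>)\<close>, the factor \<open>log k\<close> is understood to be at
  least \<open>1\<close>; this only matters for \<open>k = 1\<close>.
\<close>

definition qsmp_bound :: "nat \<Rightarrow> nat \<Rightarrow> real" where
  "qsmp_bound n k = real k ^ 5 * log 2 (2 ^ n) ^ 3 * max 1 (log 2 (real k))"

end

theory Submission
  imports
    Defs
    "HOL-Probability.Characteristic_Functions"
    "HOL-Real_Asymp.Real_Asymp"
begin

unbundle no inner_syntax
unbundle no vec_syntax
hide_const (open) Finite_Cartesian_Product.vec Finite_Cartesian_Product.mat

text \<open>
  Lower bound. Let \<open>X\<close> be a standard Gaussian vector and \<open>Y = H X\<close>, and draw independent signs with means
  \<open>sin (\<alpha> X\<^sub>a)\<close> and \<open>sin (\<alpha> Y\<^sub>b)\<close>, where \<open>\<alpha>\<^sup>2 = 2 \<epsilon>\<close>. By the formula for the Gaussian characteristic function, the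
  Fourier coefficient of this distribution at a set \<open>T\<close> is at most \<open>(\<alpha>\<^sup>2 |T| / \<surd>N)\<^bsup>|T|/2\<^esup>\<close>, it vanishes for \<open>|T| = 1\<close>,
  and by independence it is at most \<open>\<alpha>\<^bsup>|T|/2\<^esup>\<close>; a second-moment computation shows that \<open>forr \<ge> \<epsilon>/2\<close> with
  probability close to \<open>1\<close>, while \<open>forr \<le> \<epsilon>/4\<close> is typical for uniform signs. A protocol of cost \<open>t\<close> partitions
  the inputs into \<open>2\<^sup>t\<close> rectangles, and Bonami's inequality bounds the sum of its level-\<open>l\<close> Fourier coefficients by
  \<open>2\<^bsup>t/2p\<^esup> (2 p - 1)\<^sup>l\<close> for every \<open>p \<ge> 1\<close>. With \<open>p = t div l + 1\<close> and \<open>t \<le> N\<^bsup>1/4\<^esup>\<close> these bounds show that the protocol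
  correlates with the product over any set of blocks of the signed measures ``uniform minus Gaussian'' by at
  most \<open>1\<close>, against a total mass of \<open>2\<^sup>k\<close>. Replacing both measures by their restrictions to the promise costs a
  factor close to \<open>1\<close> per block, because fixing the inputs of a block leaves a rectangle partition.

  Upper bound. Phases applied by the two players to halves of EPR pairs give the referee copies of the state
  with amplitudes \<open>x\<^sub>i y\<^sub>i\<close>, on which the reflection exchanging the two halves through \<open>H\<close> has expectation \<open>forr\<close>.
  Measuring it on \<open>O(log k / \<epsilon>\<^sup>2)\<close> copies per block determines all block values with probability \<open>2/3\<close>.
\<close>

section \<open>Fourier analysis on the sign cube\<close>

text \<open>The exponent 1/4 comes from a balance. With \<beta> = \<alpha>^2 / sqrt N and
  \<open>p\<close> about t/l, the level-l term is at most (\<beta> (16 t^2 / l + 4 l)) to the power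
  l/2, so t^2 \<le> sqrt N makes the sum over l \<le> sqrt N geometric. The growing term 4 l is why
  a second coefficient bound, whose base has no factor |T|, takes over beyond sqrt N; there t < l,
  so p = 1, and a constant decay per level suffices. No logarithm is lost on the way.

  The obstacle is the promise: conditioning on it would destroy the Fourier bounds. All coefficients
  are therefore computed for the unrestricted measures, and the restriction is paid for in mass.
  Each of the two tails is at most 1/8 per block, so the correlation is at most (5/4)^k while the
  restricted weights have mass at least (7/4)^k.

  The choice \<alpha>^2 = 2 \<epsilon> puts the mean of \<open>forr\<close> at \<epsilon> or above,
  twice the threshold \<epsilon>/2. Its fluctuations are of order 1/sqrt N, far below \<epsilon>
  because k is at most a small power of N.\<close>

definition cube :: "'i set \<Rightarrow> ('i \<Rightarrow> real) set" where
  "cube I = (I \<rightarrow>\<^sub>E {- 1, 1})"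

definition cube_avg :: "'i set \<Rightarrow> (('i \<Rightarrow> real) \<Rightarrow> real) \<Rightarrow> real" where
  "cube_avg I f = (\<Sum>x\<in>cube I. f x) / 2 ^ card I"

text \<open>Functions are paired with characters by averages, whereas weights and measures
  (\<open>q\<close>, \<open>d\<close>, \<open>dens\<close>) are paired by plain sums; this keeps
  \<open>correlation_fourier\<close> free of powers of 2.\<close>

definition fourier :: "'i set \<Rightarrow> (('i \<Rightarrow> real) \<Rightarrow> real) \<Rightarrow> 'i set \<Rightarrow> real" where
  "fourier I f S = cube_avg I (\<lambda>x. f x * (\<Prod>i\<in>S. x i))"

lemma finite_cube [simp]: "finite I \<Longrightarrow> finite (cube I)"
  unfolding cube_def by (rule finite_PiE) auto

lemma cube_val: "x \<in> cube I \<Longrightarrow> i \<in> I \<Longrightarrow> x i = - 1 \<or> x i = 1"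
  unfolding cube_def by auto

lemma card_cube: "finite I \<Longrightarrow> card (cube I) = 2 ^ card I"
  unfolding cube_def by (simp add: card_PiE numeral_2_eq_2)

lemma cube_empty [simp]: "cube {} = {\<lambda>_. undefined}"
  unfolding cube_def by simp

lemma sum_cube_union:
  assumes "A \<inter> B = {}"
  shows "(\<Sum>z\<in>cube (A \<union> B). f z) = (\<Sum>u\<in>cube A. \<Sum>v\<in>cube B. f (\<lambda>i. if i \<in> A then u i else v i))"
proof -
  have "(\<Sum>z\<in>cube (A \<union> B). f z) =
      (\<Sum>p\<in>cube A \<times> cube B. f (\<lambda>i. if i \<in> A then fst p i else snd p i))"
    by (rule sum.reindex_bij_witness[where j = "\<lambda>z. (restrict z A, restrict z B)"
        and i = "\<lambda>p i. if i \<in> A then fst p i else snd p i"])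
      (use assms in \<open>auto simp: cube_def PiE_def extensional_def restrict_def Pi_iff fun_eq_iff
        intro!: arg_cong[where f = f]\<close>)
  then show ?thesis
    by (simp add: sum.cartesian_product case_prod_unfold)
qed

lemma sum_cube_insert:
  assumes "i \<notin> I"
  shows "(\<Sum>z\<in>cube (insert i I). f z) = (\<Sum>x\<in>cube I. f (x(i := 1)) + f (x(i := - 1)))"
proof -
  have *: "cube {i} = {(\<lambda>_. undefined)(i := 1), (\<lambda>_. undefined)(i := - 1)}"
    by (auto simp: cube_def PiE_insert_eq)
  have **: "(\<lambda>_. undefined)(i := (1::real)) \<noteq> (\<lambda>_. undefined)(i := - 1)"
    by (auto simp: fun_eq_iff)
  have ***: "(\<lambda>j. if j = i then ((\<lambda>_. undefined)(i := c)) j else v j) = v(i := c)" for c :: real and v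
    by auto
  have "(\<Sum>z\<in>cube ({i} \<union> I). f z) = (\<Sum>x\<in>cube I. f (x(i := 1)) + f (x(i := - 1)))"
    using assms ** by (subst sum_cube_union) (simp_all only: * sum.distrib sum.insert finite.intros
        *** sum.empty add_0_right singleton_iff insert_iff empty_iff simp_thms Int_insert_left if_False Int_empty_left)
  then show ?thesis by simp
qed

text \<open>Independence of the coordinates in algebraic form. The semiring is general because the
  factors are complex exponentials in the Gaussian computation and reals elsewhere.\<close>

lemma sum_cube_prod:
  fixes f :: "'i \<Rightarrow> real \<Rightarrow> 'a :: comm_semiring_1"
  assumes "finite I"
  shows "(\<Sum>x\<in>cube I. \<Prod>i\<in>I. f i (x i)) = (\<Prod>i\<in>I. f i 1 + f i (- 1))"
  unfolding cube_def using prod_sum_PiE[OF assms, of "\<lambda>_. {- 1, 1}" f]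
  by (simp add: add.commute)

section \<open>Hypercontractivity on the cube\<close>

lemma power_amgm:
  fixes a b :: real
  assumes "a \<ge> 0" "b \<ge> 0" "j \<le> p" "p > 0"
  shows "a ^ (p - j) * b ^ j \<le> (real (p - j) * a ^ p + real j * b ^ p) / real p"
proof (cases "a = 0 \<or> b = 0")
  case True
  then show ?thesis
    using assms by (cases "j = 0"; cases "j = p") (auto simp: power_0_left)
next
  case False
  then have ab: "a > 0" "b > 0" using assms by auto
  have "(a ^ p) powr (real (p - j) / p) * (b ^ p) powr (real j / p)
      \<le> real (p - j) / p * a ^ p + real j / p * b ^ p"
    by (rule Youngs_inequality_0) (use assms ab in \<open>auto simp: field_simps of_nat_diff\<close>)
  moreover have "(a ^ p) powr (real (p - j) / p) = a ^ (p - j)"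
    using ab assms by (simp add: powr_powr flip: powr_realpow)
  moreover have "(b ^ p) powr (real j / p) = b ^ j"
    using ab assms by (simp add: powr_powr flip: powr_realpow)
  ultimately show ?thesis by (simp add: add_divide_distrib)
qed

text \<open>Holder's inequality with exponents p/(p-j) and p/j, with upper bounds \<open>G\<close>
  and \<open>K\<close> in place of the norms so that no roots appear. After scaling by
  \<open>G\<close> and \<open>K\<close> it is the weighted AM-GM inequality pointwise. In the
  application \<open>c\<close> is the number of points of the cube.\<close>

lemma holder_power_sum:
  fixes u v :: "'a \<Rightarrow> real"
  assumes fin: "finite X" and u: "\<And>x. x \<in> X \<Longrightarrow> u x \<ge> 0" and v: "\<And>x. x \<in> X \<Longrightarrow> v x \<ge> 0"
    and G: "G \<ge> 0" "(\<Sum>x\<in>X. u x ^ p) \<le> c * G ^ p"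
    and K: "K \<ge> 0" "(\<Sum>x\<in>X. v x ^ p) \<le> c * K ^ p"
    and j: "j \<le> p" "p > 0"
  shows "(\<Sum>x\<in>X. u x ^ (p - j) * v x ^ j) \<le> c * G ^ (p - j) * K ^ j"
proof -
  have zero: "w x = 0" if "(\<Sum>x\<in>X. w x ^ p) \<le> 0" "x \<in> X" "\<And>x. x \<in> X \<Longrightarrow> w x \<ge> 0" for w :: "'a \<Rightarrow> real" and x
  proof -
    have "(\<Sum>x\<in>X. w x ^ p) = 0"
      using that by (intro antisym sum_nonneg) auto
    then have "w x ^ p = 0"
      using that fin by (subst (asm) sum_nonneg_eq_0_iff) auto
    then show ?thesis by simp
  qed
  \<comment> \<open>If \<open>G\<close> or \<open>K\<close> is 0, scaling is impossible, but then
    the function itself vanishes on \<open>X\<close>.\<close>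
  consider "j = 0" | "j = p" | "0 < j" "j < p" "G = 0 \<or> K = 0" | "G > 0" "K > 0" "0 < j" "j < p"
    using G K j by fastforce
  then show ?thesis
  proof cases
    case 3
    have "u x ^ (p - j) * v x ^ j = 0" if x: "x \<in> X" for x
    proof (cases "G = 0")
      case True
      then have "u x = 0" using G(2) j x u by (intro zero) (auto simp: power_0_left)
      then show ?thesis using 3 by (simp add: power_0_left)
    next
      case False
      then have "K = 0" using 3 by simp
      then have "v x = 0" using K(2) j x v by (intro zero) (auto simp: power_0_left)
      then show ?thesis using 3 by (simp add: power_0_left)
    qed
    then have "(\<Sum>x\<in>X. u x ^ (p - j) * v x ^ j) = 0" by (rule sum.neutral[OF ballI])
    moreover have "c * G ^ (p - j) * K ^ j = 0" using 3 by (auto simp: power_0_left)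
    ultimately show ?thesis by linarith
  next
    case 4
    have "(\<Sum>x\<in>X. (u x / G) ^ (p - j) * (v x / K) ^ j) \<le>
        (\<Sum>x\<in>X. (real (p - j) * (u x / G) ^ p + real j * (v x / K) ^ p) / real p)"
      by (intro sum_mono power_amgm) (use u v 4 in auto)
    also have "\<dots> = (real (p - j) * ((\<Sum>x\<in>X. u x ^ p) / G ^ p) + real j * ((\<Sum>x\<in>X. v x ^ p) / K ^ p)) / real p"
      by (simp add: sum_divide_distrib sum_distrib_left sum.distrib power_divide add_divide_distrib)
    also have "\<dots> \<le> (real (p - j) * c + real j * c) / real p"
      using G K 4 by (intro divide_right_mono add_mono mult_left_mono) (auto simp: divide_le_eq)
    also have "\<dots> = c"
      using 4 by (simp add: of_nat_diff field_simps)
    finally have "(\<Sum>x\<in>X. u x ^ (p - j) * v x ^ j) / (G ^ (p - j) * K ^ j) \<le> c"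
      by (simp add: power_divide sum_divide_distrib)
    with 4 show ?thesis by (simp add: divide_le_eq mult.assoc)
  qed (use G K in auto)
qed

text \<open>Passing from j to j + 1 multiplies the left binomial by (2p-2j)(2p-2j-1) /
  ((2j+1)(2j+2)) and the right one by (p-j)/(j+1). The quotient (2(p-j)-1)/(2j+1) is at most 2p-1,
  which is the origin of the constant in Bonami's inequality.\<close>

lemma binomial_even_le:
  assumes "j \<le> p"
  shows "real (2 * p choose (2 * j)) \<le> (2 * real p - 1) ^ j * real (p choose j)"
  using assms
proof (induction j)
  case (Suc j)
  have p1: "2 * real p - 1 \<ge> 1" using Suc.prems by linarith
  have "(2 * p choose (2 * j + 1)) * (2 * j + 1) = (2 * p choose (2 * j)) * (2 * p - 2 * j)"
    using binomial_absorb_comp[of "2 * p" "2 * j"] binomial_absorption[of "2 * j" "2 * p"]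
    by (simp add: mult.commute)
  moreover have "(2 * p choose (2 * j + 2)) * (2 * j + 2) = (2 * p choose (2 * j + 1)) * (2 * p - (2 * j + 1))"
    using binomial_absorb_comp[of "2 * p" "2 * j + 1"] binomial_absorption[of "2 * j + 1" "2 * p"]
    by (simp add: mult.commute)
  moreover have "(p choose Suc j) * (j + 1) = (p choose j) * (p - j)"
    using binomial_absorb_comp[of p j] binomial_absorption[of j p] by (simp add: mult.commute)
  ultimately have N: "real ((2 * p choose (2 * j + 1)) * (2 * j + 1)) = real ((2 * p choose (2 * j)) * (2 * p - 2 * j))"
      "real ((2 * p choose (2 * j + 2)) * (2 * j + 2)) = real ((2 * p choose (2 * j + 1)) * (2 * p - (2 * j + 1)))"
      "real ((p choose Suc j) * (j + 1)) = real ((p choose j) * (p - j))"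
    by presburger+
  have d: "real (2 * p - 2 * j) = 2 * (real p - j)" "real (2 * p - (2 * j + 1)) = 2 * (real p - j) - 1"
    "real (p - j) = real p - j"
    using Suc.prems by (simp_all add: of_nat_diff)
  define a b c where "a = real (2 * p choose (2 * j))" and "b = real (2 * p choose (2 * j + 1))"
    and "c = real (2 * p choose (2 * j + 2))"
  define e f where "e = real (p choose j)" and "f = real (p choose Suc j)"
  have e1: "b * (2 * j + 1) = a * (2 * (real p - j))"
    and e2: "c * (2 * (real j + 1)) = b * (2 * (real p - j) - 1)"
    and e3: "f * (real j + 1) = e * (real p - j)"
    using N unfolding of_nat_mult d a_def b_def c_def e_def f_def by (simp_all add: algebra_simps)
  have nn: "a \<ge> 0" "e \<ge> 0" unfolding a_def e_def by simp_all
  have ab: "a * (real p - j) = b * (2 * real j + 1) / 2"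
    using e1 by (simp add: algebra_simps)
  have "c * (2 * real j + 1) * (real j + 1) = (c * (2 * (real j + 1))) * (2 * real j + 1) / 2"
    by (simp add: mult_ac)
  also have "\<dots> = a * (real p - j) * (2 * (real p - j) - 1)"
    unfolding e2 ab by (simp only: mult_ac times_divide_eq_right)
  also have "\<dots> \<le> ((2 * real p - 1) ^ j * e) * (real p - j) * ((2 * real p - 1) * (2 * real j + 1))"
  proof (intro mult_mono)
    show "2 * (real p - j) - 1 \<le> (2 * real p - 1) * (2 * real j + 1)"
      using mult_mono[of 1 "2 * real p - 1" 0 "2 * real j"] p1 by (simp add: algebra_simps)
  qed (use Suc p1 nn in \<open>auto simp: a_def e_def\<close>)
  also have "\<dots> = (2 * real p - 1) ^ Suc j * (2 * real j + 1) * (e * (real p - j))"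
    by simp
  also have "\<dots> = ((2 * real p - 1) ^ Suc j * f) * (2 * real j + 1) * (real j + 1)"
    unfolding e3[symmetric] by simp
  finally have "c \<le> (2 * real p - 1) ^ Suc j * f"
    by (simp add: mult_le_cancel_right)
  then show ?case unfolding c_def f_def by simp
qed simp

lemma sum_even_binomial:
  fixes a b :: real
  shows "(a + b) ^ (2 * p) + (a - b) ^ (2 * p) =
    2 * (\<Sum>j\<le>p. real (2 * p choose (2 * j)) * ((a\<^sup>2) ^ (p - j) * (b\<^sup>2) ^ j))"
proof -
  have "(a + b) ^ (2 * p) + (a - b) ^ (2 * p) =
      (\<Sum>k\<le>2 * p. real (2 * p choose k) * b ^ k * a ^ (2 * p - k) + real (2 * p choose k) * (- b) ^ k * a ^ (2 * p - k))"
    using binomial_ring[of b a "2 * p"] binomial_ring[of "- b" a "2 * p"]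
    by (simp add: sum.distrib add.commute)
  also have "\<dots> = (\<Sum>k\<in>(\<lambda>j. 2 * j) ` {..p}. 2 * (real (2 * p choose k) * b ^ k * a ^ (2 * p - k)))"
  proof (rule sum.mono_neutral_cong_right)
    show "\<forall>i\<in>{..2 * p} - (*) 2 ` {..p}. real (2 * p choose i) * b ^ i * a ^ (2 * p - i) +
        real (2 * p choose i) * (- b) ^ i * a ^ (2 * p - i) = 0"
    proof
      fix i assume i: "i \<in> {..2 * p} - (*) 2 ` {..p}"
      have "odd i"
      proof
        assume "even i"
        then obtain j where "i = 2 * j" by blast
        with i show False by auto
      qed
      then show "real (2 * p choose i) * b ^ i * a ^ (2 * p - i) +
        real (2 * p choose i) * (- b) ^ i * a ^ (2 * p - i) = 0" by simp
    qed
  qed auto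
  also have "\<dots> = (\<Sum>j\<le>p. 2 * (real (2 * p choose (2 * j)) * b ^ (2 * j) * a ^ (2 * p - 2 * j)))"
    by (subst sum.reindex) (auto simp: inj_on_def)
  also have "\<dots> = 2 * (\<Sum>j\<le>p. real (2 * p choose (2 * j)) * ((a\<^sup>2) ^ (p - j) * (b\<^sup>2) ^ j))"
    by (simp add: sum_distrib_left mult_ac diff_mult_distrib flip: power_mult)
  finally show ?thesis .
qed

text \<open>The (2, 2p) hypercontractive inequality. Splitting off one coordinate gives f = g a +
  x_i g b. Averaging over x_i leaves even powers, Holder separates those of g a from those of g b,
  and the induction hypothesis bounds both norms. By \<open>binomial_even_le\<close> the result is
  dominated by the expansion of (w a + (2p-1) w b)^p.\<close>

lemma bonami:
  assumes "finite I" "p > 0"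
  shows "cube_avg I (\<lambda>x. (\<Sum>S\<in>Pow I. a S * (\<Prod>i\<in>S. x i)) ^ (2 * p))
    \<le> (\<Sum>S\<in>Pow I. (2 * real p - 1) ^ card S * (a S)\<^sup>2) ^ p"
  using assms(1)
proof (induction I arbitrary: a rule: finite_induct)
  case empty
  then show ?case by (simp add: cube_avg_def power_mult)
next
  case (insert i I)
  define g where "g c x = (\<Sum>S\<in>Pow I. c S * (\<Prod>i\<in>S. x i))" for c :: "'a set \<Rightarrow> real" and x
  define w where "w c = (\<Sum>S\<in>Pow I. (2 * real p - 1) ^ card S * (c S)\<^sup>2)" for c :: "'a set \<Rightarrow> real"
  define b where "b S = a (insert i S)" for S
  have p1: "2 * real p - 1 \<ge> 0" using assms by linarith
  have w0: "w c \<ge> 0" for c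
    unfolding w_def using p1 by (intro sum_nonneg) auto
  have split: "(\<Sum>S\<in>Pow (insert i I). f S) = (\<Sum>S\<in>Pow I. f S) + (\<Sum>S\<in>Pow I. f (insert i S))"
    for f :: "'a set \<Rightarrow> real"
  proof -
    have "inj_on (insert i) (Pow I)"
      using insert.hyps by (auto simp: inj_on_def)
    then show ?thesis
      unfolding Pow_insert using insert.hyps
      by (subst sum.union_disjoint) (auto simp: sum.reindex)
  qed
  have pow: "(\<Sum>S\<in>Pow (insert i I). a S * (\<Prod>j\<in>S. (x(i := c)) j)) = g a x + c * g b x" for x c
  proof -
    have "(\<Prod>j\<in>insert i S. (x(i := c)) j) = c * (\<Prod>j\<in>S. x j)" if "S \<in> Pow I" for S
    proof -
      have "i \<notin> S" "finite S" using that insert.hyps finite_subset by auto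
      then show ?thesis by (auto intro!: prod.cong)
    qed
    moreover have "(\<Prod>j\<in>S. (x(i := c)) j) = (\<Prod>j\<in>S. x j)" if "S \<in> Pow I" for S
      using that insert.hyps by (intro prod.cong) auto
    ultimately show ?thesis
      unfolding split g_def b_def by (simp add: sum_distrib_left mult_ac)
  qed
  have IH: "(\<Sum>x\<in>cube I. ((g c x)\<^sup>2) ^ p) \<le> 2 ^ card I * w c ^ p" for c
    using insert.IH[of c] by (simp add: cube_avg_def g_def w_def divide_le_eq mult.commute flip: power_mult)
  have "(\<Sum>x\<in>cube (insert i I). (\<Sum>S\<in>Pow (insert i I). a S * (\<Prod>i\<in>S. x i)) ^ (2 * p)) =
      (\<Sum>x\<in>cube I. (g a x + g b x) ^ (2 * p) + (g a x - g b x) ^ (2 * p))"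
    by (subst sum_cube_insert[OF insert.hyps(2)]) (simp only: pow, simp)
  also have "\<dots> = 2 * (\<Sum>j\<le>p. real (2 * p choose (2 * j)) *
      (\<Sum>x\<in>cube I. ((g a x)\<^sup>2) ^ (p - j) * ((g b x)\<^sup>2) ^ j))"
    unfolding sum_even_binomial by (simp only: sum_distrib_left) (rule sum.swap)
  also have "\<dots> \<le> 2 * (\<Sum>j\<le>p. ((2 * real p - 1) ^ j * real (p choose j)) *
      (2 ^ card I * w a ^ (p - j) * w b ^ j))"
    using assms(2) insert.hyps p1
    by (intro mult_left_mono sum_mono mult_mono binomial_even_le holder_power_sum IH w0 sum_nonneg) auto
  also have "\<dots> = 2 ^ card (insert i I) * (w a + (2 * real p - 1) * w b) ^ p"
    using insert.hyps
    unfolding add.commute[of "w a"] binomial_ring[of "(2 * real p - 1) * w b"]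
    by (simp add: sum_distrib_left power_mult_distrib mult_ac)
  also have "w a + (2 * real p - 1) * w b = (\<Sum>S\<in>Pow (insert i I). (2 * real p - 1) ^ card S * (a S)\<^sup>2)"
  proof -
    have "card (insert i S) = Suc (card S)" if "S \<in> Pow I" for S
    proof -
      have "i \<notin> S" "finite S" using that insert.hyps finite_subset by auto
      then show ?thesis by simp
    qed
    then show ?thesis
      unfolding split w_def b_def by (simp add: sum_distrib_left mult_ac)
  qed
  finally show ?case
    by (simp add: cube_avg_def divide_le_eq mult.commute)
qed

section \<open>Level inequalities for sets and for rectangle partitions\<close>

lemma cube_avg_add: "cube_avg I (\<lambda>x. f x + g x) = cube_avg I f + cube_avg I g"
  by (simp add: cube_avg_def sum.distrib add_divide_distrib)

lemma cube_avg_cmult: "cube_avg I (\<lambda>x. c * f x) = c * cube_avg I f"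
  by (simp add: cube_avg_def sum_distrib_left)

lemma cube_avg_sum: "cube_avg I (\<lambda>x. \<Sum>r\<in>R. f r x) = (\<Sum>r\<in>R. cube_avg I (f r))"
  unfolding cube_avg_def by (subst sum.swap) (simp add: sum_divide_distrib)

lemma cube_avg_const: "finite I \<Longrightarrow> cube_avg I (\<lambda>x. c) = c"
  by (simp add: cube_avg_def card_cube)

lemma cube_avg_mono: "(\<And>x. x \<in> cube I \<Longrightarrow> f x \<le> g x) \<Longrightarrow> cube_avg I f \<le> cube_avg I g"
  by (simp add: cube_avg_def sum_mono divide_right_mono)

lemma cube_avg_cong: "(\<And>x. x \<in> cube I \<Longrightarrow> f x = g x) \<Longrightarrow> cube_avg I f = cube_avg I g"
  by (simp add: cube_avg_def)

lemma cube_avg_nonneg: "(\<And>x. x \<in> cube I \<Longrightarrow> 0 \<le> f x) \<Longrightarrow> 0 \<le> cube_avg I f"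
  by (simp add: cube_avg_def sum_nonneg)

lemma jensen_even_power_sum:
  fixes g :: "'a \<Rightarrow> real"
  assumes "finite X" "p > 0"
  shows "(\<Sum>x\<in>X. g x) ^ (2 * p) \<le> real (card X) ^ (2 * p - 1) * (\<Sum>x\<in>X. g x ^ (2 * p))"
proof (cases "X = {}")
  case False
  then have c: "real (card X) > 0" using assms by (simp add: card_gt_0_iff)
  have "(\<Sum>x\<in>X. (1 / real (card X)) *\<^sub>R g x) ^ (2 * p) \<le> (\<Sum>x\<in>X. 1 / real (card X) * g x ^ (2 * p))"
    by (rule convex_on_sum[where C = UNIV and f = "\<lambda>x. x ^ (2 * p)", OF _ _ convex_power_even])
      (use assms False in auto)
  then have "(\<Sum>x\<in>X. g x) ^ (2 * p) / real (card X) ^ (2 * p) \<le> (\<Sum>x\<in>X. g x ^ (2 * p)) / real (card X)"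
    by (simp add: power_divide flip: sum_divide_distrib)
  moreover have "real (card X) ^ (2 * p) = real (card X) ^ (2 * p - 1) * real (card X)"
    using assms by (cases p) auto
  ultimately show ?thesis
    using c by (simp add: field_simps)
qed (use assms in \<open>simp add: power_0_left\<close>)

text \<open>Pair \<open>A\<close> with its own level-l part \<open>g\<close>: the squared weight W
  equals the inner product of \<open>A\<close> and \<open>g\<close>. Jensen on the support of
  \<open>A\<close> and Bonami for \<open>g\<close> give W^(2p) \<le> \<mu>^(2p-1) ((2p-1)^l W)^p,
  and W^p cancels. The parameter \<open>p\<close> stays free because its best value depends on the
  cost of the protocol as well as on \<open>l\<close>.\<close>

lemma level_inequality:
  assumes fin: "finite I" and p: "p > 0" and A: "\<And>x. x \<in> cube I \<Longrightarrow> A x \<in> {0, 1}"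
  shows "(\<Sum>S | S \<subseteq> I \<and> card S = l. (fourier I A S)\<^sup>2)
    \<le> cube_avg I A powr (2 - 1 / real p) * (2 * real p - 1) ^ l"
proof -
  define \<mu> where "\<mu> = cube_avg I A"
  define W where "W = (\<Sum>S | S \<subseteq> I \<and> card S = l. (fourier I A S)\<^sup>2)"
  \<comment> \<open>Only level \<open>l\<close> is kept, so that all weights in Bonami's inequality
    equal (2p-1)^l.\<close>
  define a where "a S = (if card S = l then fourier I A S else 0)" for S
  define g where "g x = (\<Sum>S\<in>Pow I. a S * (\<Prod>i\<in>S. x i))" for x
  define X where "X = {x \<in> cube I. A x = 1}"
  have finX: "finite X" using fin by (simp add: X_def)
  have level: "(\<Sum>S\<in>Pow I. if card S = l then f S else 0) = (\<Sum>S | S \<subseteq> I \<and> card S = l. f S)" for f :: "'a set \<Rightarrow> real"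
    using fin by (subst sum.inter_filter[symmetric]) (auto intro!: sum.cong)
  have p1: "2 * real p - 1 \<ge> 1" using p by linarith
  have W0: "W \<ge> 0" unfolding W_def by (intro sum_nonneg) auto
  have X: "(\<Sum>x\<in>cube I. A x * f x) = (\<Sum>x\<in>X. f x)" for f
  proof -
    have "(\<Sum>x\<in>cube I. A x * f x) = (\<Sum>x\<in>X. A x * f x)"
      unfolding X_def using A fin by (intro sum.mono_neutral_right) auto
    also have "\<dots> = (\<Sum>x\<in>X. f x)" by (simp add: X_def)
    finally show ?thesis .
  qed
  have \<mu>: "\<mu> = real (card X) / 2 ^ card I"
    unfolding \<mu>_def cube_avg_def using X[of "\<lambda>_. 1"] by simp
  have "W = (\<Sum>S\<in>Pow I. a S * fourier I A S)"
    unfolding W_def level[symmetric] a_def by (intro sum.cong) (auto simp: power2_eq_square)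
  also have "\<dots> = cube_avg I (\<lambda>x. A x * g x)"
    unfolding g_def fourier_def sum_distrib_left cube_avg_sum
    by (intro sum.cong refl) (simp add: cube_avg_cmult[symmetric] mult_ac)
  also have "\<dots> = (\<Sum>x\<in>X. g x) / 2 ^ card I"
    unfolding cube_avg_def X ..
  finally have W: "W = (\<Sum>x\<in>X. g x) / 2 ^ card I" .
  have "W ^ (2 * p) = (\<Sum>x\<in>X. g x) ^ (2 * p) / (2 ^ card I) ^ (2 * p)"
    unfolding W by (simp add: power_divide)
  also have "\<dots> \<le> (real (card X) ^ (2 * p - 1) * (\<Sum>x\<in>X. g x ^ (2 * p))) / (2 ^ card I) ^ (2 * p)"
    by (intro divide_right_mono jensen_even_power_sum finX p) auto
  also have "\<dots> \<le> (real (card X) ^ (2 * p - 1) * (\<Sum>x\<in>cube I. g x ^ (2 * p))) / (2 ^ card I) ^ (2 * p)"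
    using fin by (intro divide_right_mono mult_left_mono sum_mono2) (auto simp: X_def zero_le_even_power)
  also have "(real (card X) ^ (2 * p - 1) * (\<Sum>x\<in>cube I. g x ^ (2 * p))) / (2 ^ card I) ^ (2 * p)
      = \<mu> ^ (2 * p - 1) * cube_avg I (\<lambda>x. g x ^ (2 * p))"
  proof -
    have e: "(2 ^ card I) ^ (2 * p) = (2 ^ card I :: real) ^ (2 * p - 1) * 2 ^ card I"
      using p by (cases p) auto
    show ?thesis unfolding \<mu> cube_avg_def power_divide e by simp
  qed
  also have "\<dots> \<le> \<mu> ^ (2 * p - 1) * (\<Sum>S\<in>Pow I. (2 * real p - 1) ^ card S * (a S)\<^sup>2) ^ p"
    unfolding g_def by (intro mult_left_mono bonami fin p) (simp add: \<mu>)
  also have "(\<Sum>S\<in>Pow I. (2 * real p - 1) ^ card S * (a S)\<^sup>2) = (2 * real p - 1) ^ l * W"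
    unfolding W_def level[symmetric] a_def sum_distrib_left by (intro sum.cong) auto
  finally have "W ^ p * W ^ p \<le> (\<mu> ^ (2 * p - 1) * ((2 * real p - 1) ^ l) ^ p) * W ^ p"
    by (simp add: power_mult_distrib mult_ac flip: power_add mult_2)
  then have Wp: "W ^ p \<le> \<mu> ^ (2 * p - 1) * ((2 * real p - 1) ^ l) ^ p"
    using W0 p1 p by (cases "W = 0") (auto simp: \<mu> power_0_left mult_le_cancel_right)
  have "W \<le> \<mu> powr (2 - 1 / real p) * (2 * real p - 1) ^ l"
  proof (cases "\<mu> = 0")
    case True
    then have "W ^ p \<le> 0" using Wp p by (simp add: power_0_left)
    then have "W = 0" using W0 p by (meson less_eq_real_def linorder_not_le zero_less_power)
    then show ?thesis using p1 by simp
  next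
    case False
    then have \<mu>0: "\<mu> > 0" by (simp add: \<mu> zero_less_divide_iff)
    have "(\<mu> powr (2 - 1 / real p)) ^ p = \<mu> powr real (2 * p - 1)"
      using p \<mu>0 by (simp add: powr_powr flip: powr_realpow) (simp add: algebra_simps of_nat_diff)
    also have "\<dots> = \<mu> ^ (2 * p - 1)"
      using \<mu>0 by (rule powr_realpow)
    finally have "W ^ p \<le> (\<mu> powr (2 - 1 / real p) * (2 * real p - 1) ^ l) ^ p"
      using Wp by (simp add: power_mult_distrib)
    then show ?thesis
      using p1 p by (subst (asm) power_mono_iff) (use W0 in auto)
  qed
  then show ?thesis unfolding W_def \<mu>_def .
qed

text \<open>Cauchy-Schwarz over level \<open>l\<close>. The exponent of the rectangle's measure
  falls short of 1 by 1/(2p), and this deficit is the price of summing over rectangles.\<close>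

lemma level_inequality_product:
  assumes fin: "finite I" and p: "p > 0"
    and A: "\<And>x. x \<in> cube I \<Longrightarrow> A x \<in> {0, 1}" and B: "\<And>x. x \<in> cube I \<Longrightarrow> B x \<in> {0, 1}"
  shows "(\<Sum>S | S \<subseteq> I \<and> card S = l. \<bar>fourier I A S\<bar> * \<bar>fourier I B S\<bar>)
    \<le> (cube_avg I A * cube_avg I B) powr (1 - 1 / (2 * real p)) * (2 * real p - 1) ^ l"
proof -
  have p1: "2 * real p - 1 \<ge> 1" using p by linarith
  have nn: "cube_avg I A \<ge> 0" "cube_avg I B \<ge> 0"
    using A B by (force intro!: cube_avg_nonneg)+
  have sq: "(x powr (1 - 1 / (2 * real p)))\<^sup>2 = x powr (2 - 1 / real p)" if "x \<ge> 0" for x :: real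
  proof (cases "x = 0")
    case False
    with that have "x powr (1 - 1 / (2 * real p)) > 0" by simp
    then have "(x powr (1 - 1 / (2 * real p)))\<^sup>2 = (x powr (1 - 1 / (2 * real p))) powr (real 2)"
      by (simp only: powr_realpow)
    also have "\<dots> = x powr (2 - 1 / real p)"
      unfolding powr_powr by (rule arg_cong[where f = "(powr) x"]) (use p in \<open>simp add: field_simps\<close>)
    finally show ?thesis .
  qed simp
  have "(\<Sum>S | S \<subseteq> I \<and> card S = l. \<bar>fourier I A S\<bar> * \<bar>fourier I B S\<bar>)\<^sup>2 \<le>
      (\<Sum>S | S \<subseteq> I \<and> card S = l. \<bar>fourier I A S\<bar>\<^sup>2) * (\<Sum>S | S \<subseteq> I \<and> card S = l. \<bar>fourier I B S\<bar>\<^sup>2)"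
    by (rule Cauchy_Schwarz_ineq_sum)
  also have "\<dots> \<le> (cube_avg I A powr (2 - 1 / real p) * (2 * real p - 1) ^ l) *
      (cube_avg I B powr (2 - 1 / real p) * (2 * real p - 1) ^ l)"
    using p1 unfolding power2_abs
    by (intro mult_mono level_inequality fin p A B sum_nonneg mult_nonneg_nonneg) auto
  also have "\<dots> = ((cube_avg I A * cube_avg I B) powr (1 - 1 / (2 * real p)) * (2 * real p - 1) ^ l)\<^sup>2"
    using nn by (simp add: power_mult_distrib sq powr_mult) (simp add: power2_eq_square)
  finally show ?thesis
    using p1 by (subst (asm) power_mono_iff) (auto intro!: sum_nonneg)
qed

text \<open>Concavity: the uniform weights 1/M are extremal, and Young's inequality compares each
  weight with 1/M.\<close>

lemma sum_powr_le_card_powr: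
  fixes w :: "nat \<Rightarrow> real"
  assumes "\<And>r. r < M \<Longrightarrow> w r \<ge> 0" "(\<Sum>r<M. w r) = 1" "0 < \<theta>" "\<theta> < 1"
  shows "(\<Sum>r<M. w r powr (1 - \<theta>)) \<le> real M powr \<theta>"
proof -
  have M: "M > 0" using assms(2) by (cases M) auto
  have "(\<Sum>r<M. w r powr (1 - \<theta>) * (1 / real M) powr \<theta>) \<le> (\<Sum>r<M. (1 - \<theta>) * w r + \<theta> * (1 / real M))"
  proof (rule sum_mono)
    fix r assume r: "r \<in> {..<M}"
    show "w r powr (1 - \<theta>) * (1 / real M) powr \<theta> \<le> (1 - \<theta>) * w r + \<theta> * (1 / real M)"
    proof (cases "w r = 0")
      case False
      then show ?thesis using assms r M by (intro Youngs_inequality_0) (auto simp: less_le)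
    qed (use assms M in simp)
  qed
  also have "\<dots> = 1"
    using assms(2) M by (simp add: sum.distrib flip: sum_distrib_left)
  finally have "(\<Sum>r<M. w r powr (1 - \<theta>)) * (1 / real M) powr \<theta> \<le> 1"
    by (simp add: sum_distrib_right)
  then show ?thesis
    using M by (simp add: powr_divide divide_le_eq)
qed

text \<open>The measures of the rectangles sum to 1, so the deficit 1/(2p) in the exponent costs a
  factor M^(1/(2p)), which is at most 2^(t/(2p)) for a protocol of cost t.\<close>

lemma rectangle_partition_level_bound:
  assumes fin: "finite I" and p: "p > 0"
    and A: "\<And>r x. r < M \<Longrightarrow> x \<in> cube I \<Longrightarrow> A r x \<in> {0, 1}"
    and B: "\<And>r x. r < M \<Longrightarrow> x \<in> cube I \<Longrightarrow> B r x \<in> {0, 1}"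
    and part: "\<And>x y. x \<in> cube I \<Longrightarrow> y \<in> cube I \<Longrightarrow> (\<Sum>r<M. A r x * B r y) = 1"
  shows "(\<Sum>r<M. \<Sum>S | S \<subseteq> I \<and> card S = l. \<bar>fourier I (A r) S\<bar> * \<bar>fourier I (B r) S\<bar>)
    \<le> real M powr (1 / (2 * real p)) * (2 * real p - 1) ^ l"
proof -
  have p1: "2 * real p - 1 \<ge> 1" using p by linarith
  have nn: "cube_avg I (A r) \<ge> 0" "cube_avg I (B r) \<ge> 0" if "r < M" for r
    using A[OF that] B[OF that] by (force intro!: cube_avg_nonneg)+
  have "(\<Sum>r<M. cube_avg I (A r) * cube_avg I (B r)) = cube_avg I (\<lambda>x. cube_avg I (\<lambda>y. \<Sum>r<M. A r x * B r y))"
    by (simp add: cube_avg_sum cube_avg_cmult mult.commute[of _ "cube_avg I (B _)"])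
  also have "\<dots> = cube_avg I (\<lambda>x. cube_avg I (\<lambda>y. 1))"
    by (intro cube_avg_cong part)
  also have "\<dots> = 1" using fin by (simp add: cube_avg_const)
  finally have sum1: "(\<Sum>r<M. cube_avg I (A r) * cube_avg I (B r)) = 1" .
  have "(\<Sum>r<M. \<Sum>S | S \<subseteq> I \<and> card S = l. \<bar>fourier I (A r) S\<bar> * \<bar>fourier I (B r) S\<bar>)
    \<le> (\<Sum>r<M. (cube_avg I (A r) * cube_avg I (B r)) powr (1 - 1 / (2 * real p)) * (2 * real p - 1) ^ l)"
    by (intro sum_mono level_inequality_product fin p A B) auto
  also have "\<dots> = (\<Sum>r<M. (cube_avg I (A r) * cube_avg I (B r)) powr (1 - 1 / (2 * real p))) * (2 * real p - 1) ^ l"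
    by (simp add: sum_distrib_right)
  also have "\<dots> \<le> real M powr (1 / (2 * real p)) * (2 * real p - 1) ^ l"
    using p p1 nn by (intro mult_right_mono sum_powr_le_card_powr sum1) (auto simp: divide_less_eq)
  finally show ?thesis .
qed

section \<open>Correlation of a rectangle partition with a weight on the product input\<close>

definition cube_mult :: "'i set \<Rightarrow> ('i \<Rightarrow> real) \<Rightarrow> ('i \<Rightarrow> real) \<Rightarrow> ('i \<Rightarrow> real)" where
  "cube_mult I x z = (\<lambda>i\<in>I. x i * z i)"

lemma cube_mult_in: "x \<in> cube I \<Longrightarrow> z \<in> cube I \<Longrightarrow> cube_mult I x z \<in> cube I"
  unfolding cube_def cube_mult_def by (fastforce simp: PiE_def Pi_iff)

text \<open>The constraint y = x z makes the left side a convolution on the group of sign vectors,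
  so the three Fourier coefficients at one and the same set multiply.\<close>

lemma correlation_fourier:
  assumes fin: "finite I"
  shows "(\<Sum>z\<in>cube I. q z * cube_avg I (\<lambda>x. A x * B (cube_mult I x z)))
    = (\<Sum>S\<in>Pow I. (\<Sum>z\<in>cube I. q z * (\<Prod>i\<in>S. z i)) * fourier I A S * fourier I B S)"
proof -
  let ?c = "(2::real) ^ card I"
  \<comment> \<open>The sum of all characters factorises into the terms 1 + z_i x_i y_i, and some
    term vanishes unless y = x z.\<close>
  have kernel: "(\<Sum>S\<in>Pow I. \<Prod>i\<in>S. z i * x i * y i) = (if y = cube_mult I x z then ?c else 0)"
    if z: "z \<in> cube I" and x: "x \<in> cube I" and y: "y \<in> cube I" for x y z
  proof -
    have "(\<Sum>S\<in>Pow I. \<Prod>i\<in>S. z i * x i * y i) = (\<Prod>i\<in>I. z i * x i * y i + 1)"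
      using prod_add[OF fin, of "\<lambda>i. z i * x i * y i" "\<lambda>_. 1"] by simp
    also have "\<dots> = (if y = cube_mult I x z then ?c else 0)"
    proof (cases "y = cube_mult I x z")
      case True
      have "z i * x i * y i + 1 = 2" if "i \<in> I" for i
        using cube_val[OF z that] cube_val[OF x that] that by (auto simp: True cube_mult_def)
      then show ?thesis using True by simp
    next
      case False
      then obtain i where i: "i \<in> I" "y i \<noteq> x i * z i"
        using y unfolding cube_mult_def cube_def by (auto simp: fun_eq_iff PiE_def extensional_def restrict_def split: if_splits)
      then have "z i * x i * y i + 1 = 0"
        using cube_val[OF z] cube_val[OF x] cube_val[OF y] by fastforce
      then show ?thesis using False fin i by (auto intro!: prod_zero)
    qed
    finally show ?thesis .
  qed
  have "(\<Sum>S\<in>Pow I. (\<Sum>z\<in>cube I. q z * (\<Prod>i\<in>S. z i)) * fourier I A S * fourier I B S)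
      = (\<Sum>S\<in>Pow I. \<Sum>z\<in>cube I. \<Sum>x\<in>cube I. \<Sum>y\<in>cube I. q z * A x * B y / (?c * ?c) * (\<Prod>i\<in>S. z i * x i * y i))"
  proof (intro sum.cong refl)
    fix S
    have "(\<Sum>z\<in>cube I. q z * (\<Prod>i\<in>S. z i)) * fourier I A S * fourier I B S =
        (\<Sum>z\<in>cube I. q z * (\<Prod>i\<in>S. z i)) *
        ((\<Sum>x\<in>cube I. A x * (\<Prod>i\<in>S. x i)) * (\<Sum>y\<in>cube I. B y * (\<Prod>i\<in>S. y i))) / (?c * ?c)"
      by (simp add: fourier_def cube_avg_def)
    also have "\<dots> = (\<Sum>z\<in>cube I. \<Sum>x\<in>cube I. \<Sum>y\<in>cube I.
        q z * (\<Prod>i\<in>S. z i) * (A x * (\<Prod>i\<in>S. x i) * (B y * (\<Prod>i\<in>S. y i))) / (?c * ?c))"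
      unfolding sum_product unfolding sum_distrib_right unfolding sum_distrib_left sum_divide_distrib ..
    finally show "(\<Sum>z\<in>cube I. q z * (\<Prod>i\<in>S. z i)) * fourier I A S * fourier I B S =
        (\<Sum>z\<in>cube I. \<Sum>x\<in>cube I. \<Sum>y\<in>cube I. q z * A x * B y / (?c * ?c) * (\<Prod>i\<in>S. z i * x i * y i))"
      by (simp add: prod.distrib mult_ac)
  qed
  also have "\<dots> = (\<Sum>z\<in>cube I. \<Sum>x\<in>cube I. \<Sum>y\<in>cube I. q z * A x * B y / (?c * ?c) * (\<Sum>S\<in>Pow I. \<Prod>i\<in>S. z i * x i * y i))"
    by (simp add: sum_distrib_left sum.swap[of _ "cube I" "Pow I"])
  also have "\<dots> = (\<Sum>z\<in>cube I. \<Sum>x\<in>cube I. \<Sum>y\<in>cube I. if y = cube_mult I x z then q z * A x * B y / ?c else 0)"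
    by (intro sum.cong refl) (simp only: kernel, simp)
  also have "\<dots> = (\<Sum>z\<in>cube I. \<Sum>x\<in>cube I. q z * A x * B (cube_mult I x z) / ?c)"
    using fin by (intro sum.cong refl) (simp add: cube_mult_in)
  also have "\<dots> = (\<Sum>z\<in>cube I. q z * cube_avg I (\<lambda>x. A x * B (cube_mult I x z)))"
    by (simp add: cube_avg_def sum_distrib_left sum_divide_distrib mult_ac)
  finally show ?thesis by simp
qed

text \<open>The moment order \<open>p\<close> is a function of the level, so that the level bound
  can be optimised separately for each \<open>l\<close>.\<close>

lemma rectangle_partition_correlation_bound:
  assumes fin: "finite I" and p: "\<And>l. p l > 0"
    and A: "\<And>r x. r < M \<Longrightarrow> x \<in> cube I \<Longrightarrow> A r x \<in> {0, 1}"
    and B: "\<And>r x. r < M \<Longrightarrow> x \<in> cube I \<Longrightarrow> B r x \<in> {0, 1}"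
    and part: "\<And>x y. x \<in> cube I \<Longrightarrow> y \<in> cube I \<Longrightarrow> (\<Sum>r<M. A r x * B r y) = 1"
    and c: "\<And>r. r < M \<Longrightarrow> \<bar>c r\<bar> \<le> 1"
    and q0: "\<And>S. S \<subseteq> I \<Longrightarrow> card S < 2 \<Longrightarrow> (\<Sum>z\<in>cube I. q z * (\<Prod>i\<in>S. z i)) = 0"
    and qb: "\<And>S. S \<subseteq> I \<Longrightarrow> \<bar>\<Sum>z\<in>cube I. q z * (\<Prod>i\<in>S. z i)\<bar> \<le> b (card S)"
  shows "\<bar>\<Sum>z\<in>cube I. q z * cube_avg I (\<lambda>x. \<Sum>r<M. c r * (A r x * B r (cube_mult I x z)))\<bar>
    \<le> (\<Sum>l=2..card I. b l * (real M powr (1 / (2 * real (p l))) * (2 * real (p l) - 1) ^ l))"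
proof -
  define qh where "qh S = (\<Sum>z\<in>cube I. q z * (\<Prod>i\<in>S. z i))" for S
  define h where "h S = (\<Sum>r<M. \<bar>fourier I (A r) S\<bar> * \<bar>fourier I (B r) S\<bar>)" for S
  have h0: "h S \<ge> 0" for S unfolding h_def by (intro sum_nonneg) auto
  have "(\<Sum>z\<in>cube I. q z * cube_avg I (\<lambda>x. \<Sum>r<M. c r * (A r x * B r (cube_mult I x z))))
      = (\<Sum>r<M. c r * (\<Sum>z\<in>cube I. q z * cube_avg I (\<lambda>x. A r x * B r (cube_mult I x z))))"
    unfolding cube_avg_sum cube_avg_cmult sum_distrib_left
    by (subst sum.swap) (simp add: mult_ac)
  also have "\<dots> = (\<Sum>r<M. \<Sum>S\<in>Pow I. c r * (qh S * fourier I (A r) S * fourier I (B r) S))"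
    unfolding correlation_fourier[OF fin] qh_def sum_distrib_left ..
  also have "\<bar>\<dots>\<bar> \<le> (\<Sum>r<M. \<Sum>S\<in>Pow I. \<bar>c r * (qh S * fourier I (A r) S * fourier I (B r) S)\<bar>)"
    by (intro order.trans[OF sum_abs] sum_mono) auto
  also have "\<dots> \<le> (\<Sum>r<M. \<Sum>S\<in>Pow I. 1 * (\<bar>qh S\<bar> * (\<bar>fourier I (A r) S\<bar> * \<bar>fourier I (B r) S\<bar>)))"
    unfolding abs_mult mult.assoc using c by (intro sum_mono mult_mono) auto
  also have "\<dots> = (\<Sum>S\<in>Pow I. \<bar>qh S\<bar> * h S)"
    unfolding h_def sum_distrib_left by (subst sum.swap) simp
  also have "\<dots> = (\<Sum>S | S \<subseteq> I \<and> 2 \<le> card S. \<bar>qh S\<bar> * h S)"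
    using q0 fin by (intro sum.mono_neutral_right) (auto simp: qh_def not_le)
  also have "\<dots> \<le> (\<Sum>S | S \<subseteq> I \<and> 2 \<le> card S. b (card S) * h S)"
    using qb h0 by (intro sum_mono mult_right_mono) (auto simp: qh_def)
  also have "\<dots> = (\<Sum>l=2..card I. \<Sum>S\<in>{S \<in> {S. S \<subseteq> I \<and> 2 \<le> card S}. card S = l}. b (card S) * h S)"
    using fin by (intro sum.group[symmetric]) (auto intro: card_mono)
  also have "\<dots> = (\<Sum>l=2..card I. b l * (\<Sum>S | S \<subseteq> I \<and> card S = l. h S))"
    unfolding sum_distrib_left by (intro sum.cong) auto
  also have "\<dots> \<le> (\<Sum>l=2..card I. b l * (real M powr (1 / (2 * real (p l))) * (2 * real (p l) - 1) ^ l))"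
  proof (rule sum_mono)
    fix l assume "l \<in> {2..card I}"
    \<comment> \<open>\<open>b\<close> is known to be nonnegative only at sizes that occur, hence
      the witness.\<close>
    then obtain S where S: "S \<subseteq> I" "card S = l"
      by (meson atLeastAtMost_iff obtain_subset_with_card_n)
    have b0: "b l \<ge> 0" using qb[OF S(1)] S(2) by (meson abs_ge_zero order.trans)
    have "(\<Sum>S | S \<subseteq> I \<and> card S = l. h S) =
        (\<Sum>r<M. \<Sum>S | S \<subseteq> I \<and> card S = l. \<bar>fourier I (A r) S\<bar> * \<bar>fourier I (B r) S\<bar>)"
      unfolding h_def by (rule sum.swap)
    also have "\<dots> \<le> real M powr (1 / (2 * real (p l))) * (2 * real (p l) - 1) ^ l"
      by (intro rectangle_partition_level_bound fin p A B part)
    finally show "b l * (\<Sum>S | S \<subseteq> I \<and> card S = l. h S) \<le>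
        b l * (real M powr (1 / (2 * real (p l))) * (2 * real (p l) - 1) ^ l)"
      using b0 by (rule mult_left_mono)
  qed
  finally show ?thesis .
qed

section \<open>Rectangle partitions and blocks of inputs\<close>

text \<open>A labelled rectangle partition with labels in [-1, 1]. The conditions range over the
  whole types rather than the cubes, so arbitrary maps may be substituted for the inputs.\<close>

definition rect_kernel :: "nat \<Rightarrow> ('x \<Rightarrow> 'y \<Rightarrow> real) \<Rightarrow> bool" where
  "rect_kernel M K \<longleftrightarrow> (\<exists>A B c.
     (\<forall>r x. A r x \<in> {0, 1 :: real}) \<and> (\<forall>r y. B r y \<in> {0, 1 :: real}) \<and>
     (\<forall>r. \<bar>c r\<bar> \<le> 1) \<and> (\<forall>x y. (\<Sum>r<M. A r x * B r y) = 1) \<and>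
     K = (\<lambda>x y. \<Sum>r<M. c r * (A r x * B r y)))"

text \<open>Serves to fix the inputs of one block, and to pass from vectors to functions on the
  cube.\<close>

lemma rect_kernel_comp:
  assumes "rect_kernel M K"
  shows "rect_kernel M (\<lambda>x y. K (f x) (g y))"
proof -
  obtain A B c where "\<forall>r x. A r x \<in> {0, 1 :: real}" "\<forall>r y. B r y \<in> {0, 1 :: real}"
    "\<forall>r. \<bar>c r\<bar> \<le> 1" "\<forall>x y. (\<Sum>r<M. A r x * B r y) = 1" "K = (\<lambda>x y. \<Sum>r<M. c r * (A r x * B r y))"
    using assms unfolding rect_kernel_def by blast
  then show ?thesis
    unfolding rect_kernel_def
    by (intro exI[of _ "\<lambda>r x. A r (f x)"] exI[of _ "\<lambda>r y. B r (g y)"] exI[of _ c]) auto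
qed

lemma rect_kernel_abs_le:
  assumes "rect_kernel M K"
  shows "\<bar>K x y\<bar> \<le> 1"
proof -
  obtain A B c where *: "\<forall>r x. A r x \<in> {0, 1 :: real}" "\<forall>r y. B r y \<in> {0, 1 :: real}"
    "\<forall>r. \<bar>c r\<bar> \<le> 1" "\<forall>x y. (\<Sum>r<M. A r x * B r y) = 1" "K = (\<lambda>x y. \<Sum>r<M. c r * (A r x * B r y))"
    using assms unfolding rect_kernel_def by blast
  have nn: "A r x * B r y \<ge> 0" for r
    using *(1,2) by (metis insert_iff mult_nonneg_nonneg order_refl singletonD zero_le_one)
  have "\<bar>K x y\<bar> \<le> (\<Sum>r<M. \<bar>c r * (A r x * B r y)\<bar>)"
    unfolding *(5) by (rule sum_abs)
  also have "\<dots> \<le> (\<Sum>r<M. 1 * (A r x * B r y))"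
    unfolding abs_mult[of "c _"] using nn *(3) by (intro sum_mono mult_mono) auto
  also have "\<dots> = 1" using *(4) by simp
  finally show ?thesis .
qed

text \<open>The leaves of the protocol tree, each with the rectangle of inputs that reach it. The
  test function \<open>h\<close> packs two facts into one: the constant 1 shows that the rectangles
  partition the inputs, and a general \<open>h\<close> recovers the output.\<close>

lemma protocol_rectangles:
  "\<exists>Rs. length Rs \<le> 2 ^ depth p \<and>
     (\<forall>x y h. (\<Sum>(A, B, r)\<leftarrow>Rs. of_bool (A x) * of_bool (B y) * h r) = (h (run p x y) :: real))"
proof (induction p)
  case (Output r)
  show ?case by (rule exI[of _ "[(\<lambda>_. True, \<lambda>_. True, r)]"]) simp
next
  case (Alice s p q)
  then obtain Rp Rq where
    p: "length Rp \<le> 2 ^ depth p" "\<And>x y h. (\<Sum>(A, B, r)\<leftarrow>Rp. of_bool (A x) * of_bool (B y) * h r) = (h (run p x y) :: real)"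
    and q: "length Rq \<le> 2 ^ depth q" "\<And>x y h. (\<Sum>(A, B, r)\<leftarrow>Rq. of_bool (A x) * of_bool (B y) * h r) = (h (run q x y) :: real)"
    by blast
  let ?R = "map (\<lambda>(A, B, r). (\<lambda>x. s x \<and> A x, B, r)) Rp @ map (\<lambda>(A, B, r). (\<lambda>x. \<not> s x \<and> A x, B, r)) Rq"
  have "(2::nat) ^ depth p \<le> 2 ^ max (depth p) (depth q)" "(2::nat) ^ depth q \<le> 2 ^ max (depth p) (depth q)"
    by (auto intro: power_increasing)
  from add_mono[OF order.trans[OF p(1) this(1)] order.trans[OF q(1) this(2)]]
  have "length ?R \<le> 2 ^ depth (Alice s p q)" by simp
  moreover have "(\<Sum>(A, B, r)\<leftarrow>?R. of_bool (A x) * of_bool (B y) * h r) = h (run (Alice s p q) x y)" for x y and h :: "_ \<Rightarrow> real"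
    using p(2)[where x = x and y = y and h = h] q(2)[where x = x and y = y and h = h]
    by (cases "s x") (simp_all add: comp_def case_prod_unfold)
  ultimately show ?case by blast
next
  case (Bob s p q)
  then obtain Rp Rq where
    p: "length Rp \<le> 2 ^ depth p" "\<And>x y h. (\<Sum>(A, B, r)\<leftarrow>Rp. of_bool (A x) * of_bool (B y) * h r) = (h (run p x y) :: real)"
    and q: "length Rq \<le> 2 ^ depth q" "\<And>x y h. (\<Sum>(A, B, r)\<leftarrow>Rq. of_bool (A x) * of_bool (B y) * h r) = (h (run q x y) :: real)"
    by blast
  let ?R = "map (\<lambda>(A, B, r). (A, \<lambda>y. s y \<and> B y, r)) Rp @ map (\<lambda>(A, B, r). (A, \<lambda>y. \<not> s y \<and> B y, r)) Rq"
  have "(2::nat) ^ depth p \<le> 2 ^ max (depth p) (depth q)" "(2::nat) ^ depth q \<le> 2 ^ max (depth p) (depth q)"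
    by (auto intro: power_increasing)
  from add_mono[OF order.trans[OF p(1) this(1)] order.trans[OF q(1) this(2)]]
  have "length ?R \<le> 2 ^ depth (Bob s p q)" by simp
  moreover have "(\<Sum>(A, B, r)\<leftarrow>?R. of_bool (A x) * of_bool (B y) * h r) = h (run (Bob s p q) x y)" for x y and h :: "_ \<Rightarrow> real"
    using p(2)[where x = x and y = y and h = h] q(2)[where x = x and y = y and h = h]
    by (cases "s y") (simp_all add: comp_def case_prod_unfold)
  ultimately show ?case by blast
qed

lemma protocol_rect_kernel:
  assumes "\<And>r. \<bar>h r\<bar> \<le> 1"
  shows "\<exists>M \<le> 2 ^ depth p. rect_kernel M (\<lambda>x y. h (run p x y))"
proof -
  obtain Rs where Rs: "length Rs \<le> 2 ^ depth p"
    "\<forall>x y h. (\<Sum>(A, B, r)\<leftarrow>Rs. of_bool (A x) * of_bool (B y) * h r) = (h (run p x y) :: real)"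
    using protocol_rectangles[of p] by blast
  have sum: "(\<Sum>i<length Rs. of_bool (fst (Rs ! i) x) * of_bool (fst (snd (Rs ! i)) y) * h (snd (snd (Rs ! i)))) = h (run p x y)" for x y and h :: "_ \<Rightarrow> real"
    using Rs(2)[rule_format, where x = x and y = y and h = h]
    by (simp add: sum_list_sum_nth case_prod_unfold atLeast0LessThan)
  have "rect_kernel (length Rs) (\<lambda>x y. h (run p x y))"
    unfolding rect_kernel_def
    using sum[where h = "\<lambda>_. 1"] sum[where h = h] assms
    by (intro exI[of _ "\<lambda>r x. of_bool (fst (Rs ! r) x)"] exI[of _ "\<lambda>r y. of_bool (fst (snd (Rs ! r)) y)"]
        exI[of _ "\<lambda>r. h (snd (snd (Rs ! r)))"]) (auto simp: mult_ac)
  with Rs(1) show ?thesis by blast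
qed

section \<open>Weights that are products over blocks\<close>

definition block_of :: "'v set \<Rightarrow> ('j \<times> 'v \<Rightarrow> real) \<Rightarrow> 'j \<Rightarrow> 'v \<Rightarrow> real" where
  "block_of V z j = (\<lambda>i\<in>V. z (j, i))"

definition add_block :: "'j \<Rightarrow> ('v \<Rightarrow> real) \<Rightarrow> ('j \<times> 'v \<Rightarrow> real) \<Rightarrow> 'j \<times> 'v \<Rightarrow> real" where
  "add_block j w z = (\<lambda>(a, i). if a = j then w i else z (a, i))"

text \<open>Alice's input \<open>x\<close> is uniform and Bob's is x z, so the weight sits on the
  coordinatewise product of the inputs. The factors \<open>q j\<close> may be signed.\<close>

definition block_corr ::
    "'v set \<Rightarrow> 'j set \<Rightarrow> ('j \<Rightarrow> ('v \<Rightarrow> real) \<Rightarrow> real) \<Rightarrow> (('j \<times> 'v \<Rightarrow> real) \<Rightarrow> ('j \<times> 'v \<Rightarrow> real) \<Rightarrow> real) \<Rightarrow> real" where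
  "block_corr V J q K = (\<Sum>z\<in>cube (J \<times> V). (\<Prod>j\<in>J. q j (block_of V z j)) *
     cube_avg (J \<times> V) (\<lambda>x. K x (cube_mult (J \<times> V) x z)))"

lemma sum_cube_add_block:
  assumes "j \<notin> J"
  shows "(\<Sum>z\<in>cube (insert j J \<times> V). f z) = (\<Sum>w\<in>cube V. \<Sum>z\<in>cube (J \<times> V). f (add_block j w z))"
proof -
  have "(\<Sum>z\<in>cube (insert j J \<times> V). f z) = (\<Sum>p\<in>cube V \<times> cube (J \<times> V). f (add_block j (fst p) (snd p)))"
  proof (rule sum.reindex_bij_witness[where j = "\<lambda>z. (block_of V z j, restrict z (J \<times> V))"
        and i = "\<lambda>p. add_block j (fst p) (snd p)"])
    fix z assume z: "z \<in> cube (insert j J \<times> V)"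
    show "add_block j (fst (block_of V z j, restrict z (J \<times> V))) (snd (block_of V z j, restrict z (J \<times> V))) = z"
      using z unfolding cube_def add_block_def block_of_def
      by (auto simp: fun_eq_iff PiE_def extensional_def)
    then show "f (add_block j (fst (block_of V z j, restrict z (J \<times> V))) (snd (block_of V z j, restrict z (J \<times> V)))) = f z"
      by simp
    show "(block_of V z j, restrict z (J \<times> V)) \<in> cube V \<times> cube (J \<times> V)"
      using z unfolding cube_def block_of_def by (auto simp: PiE_def Pi_iff)
  next
    fix p assume p: "p \<in> cube V \<times> cube (J \<times> V)"
    show "(block_of V (add_block j (fst p) (snd p)) j, restrict (add_block j (fst p) (snd p)) (J \<times> V)) = p"
      using p assms unfolding cube_def add_block_def block_of_def
      by (cases p) (auto simp: fun_eq_iff PiE_def extensional_def)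
    show "add_block j (fst p) (snd p) \<in> cube (insert j J \<times> V)"
      using p unfolding cube_def add_block_def by (auto simp: PiE_def Pi_iff extensional_def)
  qed
  then show ?thesis
    by (simp add: sum.cartesian_product case_prod_unfold)
qed

lemma block_of_add_block:
  "w \<in> cube V \<Longrightarrow> block_of V (add_block j w z) j = w"
  "a \<noteq> j \<Longrightarrow> block_of V (add_block j w z) a = block_of V z a"
  unfolding block_of_def add_block_def cube_def
  by (auto simp: fun_eq_iff PiE_def extensional_def)

lemma cube_mult_add_block:
  assumes "j \<notin> J"
  shows "cube_mult (insert j J \<times> V) (add_block j w x) (add_block j w' z) =
    add_block j (cube_mult V w w') (cube_mult (J \<times> V) x z)"
  using assms unfolding cube_mult_def add_block_def by (auto simp: fun_eq_iff)

lemma cube_avg_add_block: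
  assumes "j \<notin> J" "finite J" "finite V"
  shows "cube_avg (insert j J \<times> V) f = cube_avg V (\<lambda>w. cube_avg (J \<times> V) (\<lambda>x. f (add_block j w x)))"
proof -
  have "card (insert j J \<times> V) = card V + card (J \<times> V)"
    using assms by (simp add: card_cartesian_product)
  then show ?thesis
    unfolding cube_avg_def sum_cube_add_block[OF assms(1)]
    by (simp add: power_add sum_divide_distrib mult.commute)
qed

lemma sum_cube_block_prod:
  fixes h :: "'j \<Rightarrow> ('v \<Rightarrow> real) \<Rightarrow> real"
  assumes "finite J"
  shows "(\<Sum>z\<in>cube (J \<times> V). \<Prod>j\<in>J. h j (block_of V z j)) = (\<Prod>j\<in>J. \<Sum>w\<in>cube V. h j w)"
  using assms
proof (induction J rule: finite_induct)
  case (insert j J)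
  have "(\<Prod>a\<in>insert j J. h a (block_of V (add_block j w z) a)) = h j w * (\<Prod>a\<in>J. h a (block_of V z a))"
    if "w \<in> cube V" for w z
  proof -
    have "(\<Prod>a\<in>J. h a (block_of V (add_block j w z) a)) = (\<Prod>a\<in>J. h a (block_of V z a))"
      using insert.hyps by (intro prod.cong refl) (metis block_of_add_block(2))
    then show ?thesis using insert.hyps that by (simp add: block_of_add_block)
  qed
  then show ?case
    unfolding sum_cube_add_block[OF insert.hyps(2)] using insert
    by (simp add: sum_distrib_left[symmetric] sum_distrib_right[symmetric])
qed simp

text \<open>Once \<open>x'\<close> and \<open>w\<close> are fixed, both players' inputs in block
  \<open>j\<close> are constants, and what remains is a correlation over the other blocks with a
  substituted kernel.\<close>

lemma block_corr_insert:
  assumes "j \<notin> J" "finite J" "finite V"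
  shows "block_corr V (insert j J) q K = (\<Sum>w\<in>cube V. q j w *
    cube_avg V (\<lambda>x'. block_corr V J q (\<lambda>x y. K (add_block j x' x) (add_block j (cube_mult V x' w) y))))"
proof -
  have *: "(\<Prod>a\<in>insert j J. q a (block_of V (add_block j w z) a)) = q j w * (\<Prod>a\<in>J. q a (block_of V z a))"
    if "w \<in> cube V" for w z
  proof -
    have "(\<Prod>a\<in>J. q a (block_of V (add_block j w z) a)) = (\<Prod>a\<in>J. q a (block_of V z a))"
      using assms by (intro prod.cong refl) (metis block_of_add_block(2))
    then show ?thesis using assms that by (simp add: block_of_add_block)
  qed
  have "block_corr V (insert j J) q K = (\<Sum>w\<in>cube V. \<Sum>z\<in>cube (J \<times> V). q j w * (\<Prod>a\<in>J. q a (block_of V z a)) *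
     cube_avg V (\<lambda>x'. cube_avg (J \<times> V) (\<lambda>x. K (add_block j x' x) (add_block j (cube_mult V x' w) (cube_mult (J \<times> V) x z)))))"
    unfolding block_corr_def sum_cube_add_block[OF assms(1)] cube_avg_add_block[OF assms]
    by (intro sum.cong refl) (simp only: * cube_mult_add_block[OF assms(1)])
  also have "\<dots> = (\<Sum>w\<in>cube V. q j w * cube_avg V (\<lambda>x'. \<Sum>z\<in>cube (J \<times> V). (\<Prod>a\<in>J. q a (block_of V z a)) *
     cube_avg (J \<times> V) (\<lambda>x. K (add_block j x' x) (add_block j (cube_mult V x' w) (cube_mult (J \<times> V) x z)))))"
    unfolding cube_avg_sum cube_avg_cmult by (simp add: sum_distrib_left mult_ac)
  finally show ?thesis unfolding block_corr_def .
qed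

lemma block_corr_cong:
  "(\<And>j. j \<in> J \<Longrightarrow> q j = q' j) \<Longrightarrow> block_corr V J q K = block_corr V J q' K"
  unfolding block_corr_def by (intro sum.cong refl arg_cong2[where f = "(*)"] prod.cong) auto

lemma cube_avg_abs_le:
  assumes "finite I" "\<And>x. x \<in> cube I \<Longrightarrow> \<bar>f x\<bar> \<le> c"
  shows "\<bar>cube_avg I f\<bar> \<le> c"
proof -
  have "\<bar>cube_avg I f\<bar> \<le> cube_avg I (\<lambda>x. \<bar>f x\<bar>)"
    unfolding cube_avg_def by (simp add: divide_right_mono)
  also have "\<dots> \<le> cube_avg I (\<lambda>x. c)" by (intro cube_avg_mono assms)
  also have "\<dots> = c" using assms by (simp add: cube_avg_const)
  finally show ?thesis .
qed

text \<open>
  Every block is switched from \<open>d\<close> to \<open>g\<close>; the error \<open>g - d\<close> is absorbed by fixing the inputs of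
  that block, which turns a rectangle partition into another one.
\<close>

lemma block_corr_perturb:
  fixes J1 J2 :: "'j set"
  assumes V: "finite V"
    and base: "\<And>(J :: 'j set) K. finite J \<Longrightarrow> rect_kernel M K \<Longrightarrow> \<bar>block_corr V J (\<lambda>_. d) K\<bar> \<le> 1"
    and err: "(\<Sum>w\<in>cube V. \<bar>g w - d w\<bar>) \<le> \<eta>" and "\<eta> \<ge> 0"
    and "finite J2" "finite J1" "J1 \<inter> J2 = {}" "rect_kernel M K"
  shows "\<bar>block_corr V (J1 \<union> J2) (\<lambda>j. if j \<in> J2 then g else d) K\<bar> \<le> (1 + \<eta>) ^ card J2"
  using assms(5-8)
proof (induction J2 arbitrary: J1 K rule: finite_induct)
  case empty
  then show ?case using base by simp
next
  case (insert j J2)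
  let ?J = "J1 \<union> J2"
  let ?q = "\<lambda>a. if a \<in> J2 then g else d"
  have j: "j \<notin> ?J" "finite ?J" using insert by auto
  let ?R = "\<lambda>w. cube_avg V (\<lambda>x'. block_corr V ?J ?q (\<lambda>x y. K (add_block j x' x) (add_block j (cube_mult V x' w) y)))"
  have R: "\<bar>?R w\<bar> \<le> (1 + \<eta>) ^ card J2" for w
    using insert.prems by (intro cube_avg_abs_le V insert.IH rect_kernel_comp[OF insert.prems(3)]) auto
  have cong: "block_corr V ?J (\<lambda>a. if a \<in> insert j J2 then g else d) K' = block_corr V ?J ?q K'" for K'
    using j by (intro block_corr_cong) auto
  define L where "L = block_corr V (J1 \<union> insert j J2) (\<lambda>a. if a \<in> insert j J2 then g else d) K"
  define L' where "L' = block_corr V (insert j J1 \<union> J2) ?q K"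
  have "L = (\<Sum>w\<in>cube V. g w * ?R w)"
    unfolding L_def
    using block_corr_insert[OF j V, of "\<lambda>a. if a \<in> insert j J2 then g else d" K] unfolding cong by simp
  also have "\<dots> = (\<Sum>w\<in>cube V. d w * ?R w) + (\<Sum>w\<in>cube V. (g w - d w) * ?R w)"
    by (simp add: algebra_simps sum_subtractf)
  \<comment> \<open>The \<open>d\<close>-part is the same correlation with block \<open>j\<close>
    moved from \<open>J2\<close> to \<open>J1\<close>, which is why \<open>J1\<close> varies in the
    induction.\<close>
  also have "(\<Sum>w\<in>cube V. d w * ?R w) = L'"
    unfolding L'_def using block_corr_insert[OF j V, of ?q K] insert.hyps by simp
  finally have "\<bar>L\<bar> = \<bar>L' + (\<Sum>w\<in>cube V. (g w - d w) * ?R w)\<bar>" by (rule arg_cong)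
  also have "\<dots> \<le>
      (1 + \<eta>) ^ card J2 + (\<Sum>w\<in>cube V. \<bar>g w - d w\<bar> * (1 + \<eta>) ^ card J2)"
  proof (intro order.trans[OF abs_triangle_ineq] add_mono)
    show "\<bar>L'\<bar> \<le> (1 + \<eta>) ^ card J2"
      unfolding L'_def using insert.prems insert.hyps by (intro insert.IH) auto
    show "\<bar>\<Sum>w\<in>cube V. (g w - d w) * ?R w\<bar> \<le> (\<Sum>w\<in>cube V. \<bar>g w - d w\<bar> * (1 + \<eta>) ^ card J2)"
      by (intro order.trans[OF sum_abs] sum_mono) (simp add: abs_mult R mult_left_mono)
  qed
  also have "\<dots> \<le> (1 + \<eta>) ^ card J2 + \<eta> * (1 + \<eta>) ^ card J2"
    unfolding sum_distrib_right[symmetric] using err \<open>\<eta> \<ge> 0\<close> by (intro add_left_mono mult_right_mono) auto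
  also have "\<dots> = (1 + \<eta>) ^ card (insert j J2)"
    using insert.hyps by (simp add: algebra_simps)
  finally show ?case unfolding L_def .
qed

text \<open>Cutting \<open>S\<close> into its sections over the blocks turns the coefficient of a
  product weight into the product of the coefficients at the sections.\<close>

lemma block_weight_fourier:
  assumes "finite J" "finite V" "S \<subseteq> J \<times> V"
  shows "(\<Sum>z\<in>cube (J \<times> V). (\<Prod>j\<in>J. q j (block_of V z j)) * (\<Prod>s\<in>S. z s)) =
    (\<Prod>j\<in>J. \<Sum>w\<in>cube V. q j w * (\<Prod>i | (j, i) \<in> S. w i))"
proof -
  have S: "S = (SIGMA j:J. {i. (j, i) \<in> S})"
    using assms(3) by auto
  have fV: "block_of V z j i = z (j, i)" if "(j, i) \<in> S" for z :: "'a \<times> 'b \<Rightarrow> real" and j i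
    using that assms(3) by (auto simp: block_of_def)
  have "finite {i. (j, i) \<in> S}" for j
    by (rule finite_subset[OF _ assms(2)]) (use assms(3) in blast)
  note fin = this
  have "(\<Prod>s\<in>S. z s) = (\<Prod>j\<in>J. \<Prod>i | (j, i) \<in> S. block_of V z j i)" for z :: "'a \<times> 'b \<Rightarrow> real"
  proof -
    have "(\<Prod>s\<in>S. z s) = (\<Prod>s\<in>(SIGMA j:J. {i. (j, i) \<in> S}). z s)"
      by (rule arg_cong[OF S])
    also have "\<dots> = (\<Prod>j\<in>J. \<Prod>i | (j, i) \<in> S. z (j, i))"
      using assms(1) fin by (subst prod.Sigma) auto
    finally show ?thesis by (simp add: fV)
  qed
  then show ?thesis
    using sum_cube_block_prod[OF assms(1), of "\<lambda>j w. q j w * (\<Prod>i | (j, i) \<in> S. w i)" V]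
    by (simp only: prod.distrib[symmetric])
qed

text \<open>
  The Fourier coefficients of \<open>d\<close> are controlled at low levels by the first bound and at high levels
  by the second; at level \<open>l\<close> the moment order \<open>t div l + 1\<close> balances both factors of the level bound.
\<close>

lemma block_corr_le_1:
  fixes d :: "('v \<Rightarrow> real) \<Rightarrow> real" and J :: "'j set" and V :: "'v set" and \<alpha> \<beta> r :: real and dh :: "'v set \<Rightarrow> real"
  defines "dh \<equiv> \<lambda>T. \<Sum>w\<in>cube V. d w * (\<Prod>i\<in>T. w i)"
  assumes V: "finite V" and J: "finite J" and K: "rect_kernel M K" "M \<le> 2 ^ t"
    and dh0: "\<And>T. T \<subseteq> V \<Longrightarrow> card T < 2 \<Longrightarrow> dh T = 0"
    and dh1: "\<And>T. T \<subseteq> V \<Longrightarrow> \<beta> * card T \<le> 1 \<Longrightarrow> (dh T)\<^sup>2 \<le> (\<beta> * card T) ^ card T"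
    and dh2: "\<And>T. T \<subseteq> V \<Longrightarrow> (dh T)\<^sup>2 \<le> \<alpha> ^ card T"
    and \<alpha>: "0 \<le> \<alpha>" "\<alpha> \<le> 1 / 108" and \<beta>: "\<beta> \<ge> 0" "\<beta> * r \<le> \<alpha>\<^sup>2"
    and t: "real t ^ 2 \<le> r" "t \<le> r"
  shows "\<bar>block_corr V J (\<lambda>_. d) K\<bar> \<le> 1"
proof (cases "J = {}")
  case True
  show ?thesis
    unfolding True block_corr_def using rect_kernel_abs_le[OF K(1)]
    by (simp add: cube_avg_def)
next
  case False
  let ?I = "J \<times> V"
  have I: "finite ?I" using V J by simp
  obtain A B c where *: "\<forall>r x. A r x \<in> {0, 1 :: real}" "\<forall>r y. B r y \<in> {0, 1 :: real}"
    "\<forall>r. \<bar>c r\<bar> \<le> 1" "\<forall>x y. (\<Sum>r<M. A r x * B r y) = 1" "K = (\<lambda>x y. \<Sum>r<M. c r * (A r x * B r y))"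
    using K(1) unfolding rect_kernel_def by blast
  define q where "q z = (\<Prod>j\<in>J. d (block_of V z j))" for z :: "'j \<times> 'v \<Rightarrow> real"
  \<comment> \<open>The hypotheses bound squares of coefficients, hence the root. The switch takes
    place at level \<open>r\<close>, which is sqrt N in the application.\<close>
  define b where "b l = sqrt (if real l \<le> r then (\<beta> * l) ^ l else \<alpha> ^ l)" for l :: nat
  define p where "p l = t div l + 1" for l
  define T where "T S j = {i. (j, i) \<in> S}" for S :: "('j \<times> 'v) set" and j
  have qh: "(\<Sum>z\<in>cube ?I. q z * (\<Prod>i\<in>S. z i)) = (\<Prod>j\<in>J. dh (T S j))" if "S \<subseteq> ?I" for S
    unfolding q_def dh_def T_def by (rule block_weight_fourier[OF J V that])
  have TV: "T S j \<subseteq> V" if "S \<subseteq> ?I" for S j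
    using that by (auto simp: T_def)
  have card: "card S = (\<Sum>j\<in>J. card (T S j))" if "S \<subseteq> ?I" for S
  proof -
    have "S = (SIGMA j:J. T S j)" using that by (auto simp: T_def)
    moreover have "card (SIGMA j:J. T S j) = (\<Sum>j\<in>J. card (T S j))"
      using J V TV[OF that] by (intro card_SigmaI) (auto intro: finite_subset)
    ultimately show ?thesis by simp
  qed
  have q0: "(\<Sum>z\<in>cube ?I. q z * (\<Prod>i\<in>S. z i)) = 0" if S: "S \<subseteq> ?I" "card S < 2" for S
  proof -
    obtain j where j: "j \<in> J" using False by blast
    have "card (T S j) \<le> card S"
      unfolding card[OF S(1)] using j J by (intro member_le_sum) auto
    then have "dh (T S j) = 0" using dh0 TV[OF S(1)] S(2) by simp
    then show ?thesis unfolding qh[OF S(1)] using j J by (intro prod_zero) auto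
  qed
  have qb: "\<bar>\<Sum>z\<in>cube ?I. q z * (\<Prod>i\<in>S. z i)\<bar> \<le> b (card S)" if S: "S \<subseteq> ?I" for S
  proof -
    have "(\<Prod>j\<in>J. dh (T S j))\<^sup>2 = (\<Prod>j\<in>J. (dh (T S j))\<^sup>2)" by (rule prod_power_distrib)
    also have "\<dots> \<le> (if real (card S) \<le> r then (\<beta> * card S) ^ card S else \<alpha> ^ card S)"
    proof (cases "real (card S) \<le> r")
      case True
      have *: "card (T S j) \<le> card S" if "j \<in> J" for j
        unfolding card[OF S(1)] using that J by (intro member_le_sum) auto
      have "\<beta> * card S \<le> \<beta> * r" using \<beta> True by (intro mult_left_mono) auto
      also have "\<dots> \<le> 1" using \<beta> \<alpha> power_le_one[of \<alpha> 2] by linarith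
      finally have 1: "\<beta> * card S \<le> 1" .
      \<comment> \<open>Enlarging every base to \<beta> * card S lets the exponents add up to card
        S.\<close>
      have "(\<Prod>j\<in>J. (dh (T S j))\<^sup>2) \<le> (\<Prod>j\<in>J. (\<beta> * card S) ^ card (T S j))"
      proof (intro prod_mono conjI)
        fix j assume j: "j \<in> J"
        have "\<beta> * card (T S j) \<le> \<beta> * card S" using \<beta> *[OF j] by (intro mult_left_mono) auto
        then have "(dh (T S j))\<^sup>2 \<le> (\<beta> * card (T S j)) ^ card (T S j)"
          using 1 TV[OF S] by (intro dh1) auto
        also have "\<dots> \<le> (\<beta> * card S) ^ card (T S j)"
          using \<open>\<beta> * card (T S j) \<le> \<beta> * card S\<close> \<beta> by (intro power_mono) auto
        finally show "(dh (T S j))\<^sup>2 \<le> (\<beta> * card S) ^ card (T S j)" .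
      qed auto
      also have "\<dots> = (\<beta> * card S) ^ card S"
        by (subst (3) card[OF S]) (rule power_sum[symmetric])
      finally show ?thesis using True by simp
    next
      case False
      have "(\<Prod>j\<in>J. (dh (T S j))\<^sup>2) \<le> (\<Prod>j\<in>J. \<alpha> ^ card (T S j))"
        using dh2 TV[OF S] by (intro prod_mono conjI) auto
      also have "\<dots> = \<alpha> ^ card S"
        by (subst card[OF S]) (rule power_sum[symmetric])
      finally show ?thesis using False by simp
    qed
    finally show ?thesis unfolding qh[OF S] b_def by (metis real_sqrt_abs real_sqrt_le_iff)
  qed
  have sq_le: "(2 * a + 1)\<^sup>2 \<le> 8 * a\<^sup>2 + 2" for a :: real
    using zero_le_power2[of "2 * a - 1"] by (simp add: power2_eq_square algebra_simps)
  have lvl: "b l * (real M powr (1 / (2 * real (p l))) * (2 * real (p l) - 1) ^ l) \<le> (1 / 3) ^ l"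
    if l: "l \<ge> 2" for l
  proof -
    have p0: "real (p l) > 0" by (simp add: p_def)
    have pl: "real (p l) \<le> real t / l + 1" "real t / real (p l) \<le> l"
    proof -
      show "real (p l) \<le> real t / l + 1"
        unfolding p_def using of_nat_div_le_of_nat[of t l] by simp
      \<comment> \<open>The summand 1 in \<open>p l\<close> gives this strict inequality, from which
        M^(1/p) is at most 2^l.\<close>
      have "t < l * p l" unfolding p_def using l by (simp add: dividend_less_times_div)
      then have "real t \<le> real l * real (p l)" by (metis of_nat_less_iff of_nat_mult less_imp_le)
      then show "real t / real (p l) \<le> l" using p0 by (simp add: divide_le_eq)
    qed
    have M0: "M > 0" using *(4) by (cases M) auto
    have "real M \<le> 2 ^ t" using K(2) by (metis of_nat_le_iff of_nat_numeral of_nat_power)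
    then have "real M powr (1 / real (p l)) \<le> (2 ^ t) powr (1 / real (p l))"
      using M0 p0 by (intro powr_mono2) auto
    also have "\<dots> = 2 powr (real t / real (p l))"
      by (simp add: powr_powr flip: powr_realpow)
    also have "\<dots> \<le> 2 powr l" using pl(2) by simp
    also have "\<dots> = 2 ^ l" by (simp add: powr_realpow)
    finally have Mp: "real M powr (1 / real (p l)) \<le> 2 ^ l" .
    have sq: "(real M powr (1 / (2 * real (p l))))\<^sup>2 = real M powr (1 / real (p l))"
      using M0 by (simp add: powr_powr flip: powr_realpow)
    have b2: "(b l)\<^sup>2 = (if real l \<le> r then (\<beta> * l) ^ l else \<alpha> ^ l)"
      unfolding b_def using \<alpha> \<beta> by (simp add: real_sqrt_pow2)
    \<comment> \<open>The estimate is squared to avoid half-integral powers. Up to level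
      \<open>r\<close>, the chain 2 \<beta> l (2 t/l + 1)^2 \<le> \<beta> (16 t^2 / l + 4 l) \<le>
      12 \<beta> r is where t^2 \<le> r enters.\<close>
    have main: "(b l)\<^sup>2 * (2 ^ l * ((2 * real (p l) - 1)\<^sup>2) ^ l) \<le> (1 / 9) ^ l"
    proof (cases "real l \<le> r")
      case True
      have "(2 * real (p l) - 1)\<^sup>2 \<le> (2 * (real t / l) + 1)\<^sup>2"
        using pl(1) by (intro power_mono) (auto simp: p_def)
      also have "\<dots> \<le> 8 * (real t / l)\<^sup>2 + 2"
        by (rule sq_le)
      finally have "2 * \<beta> * l * (2 * real (p l) - 1)\<^sup>2 \<le> 2 * \<beta> * l * (8 * (real t / l)\<^sup>2 + 2)"
        using \<beta> by (intro mult_left_mono) auto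
      also have "\<dots> = \<beta> * (16 * (real t ^ 2 / l) + 4 * l)"
        using l by (simp add: power_divide power2_eq_square field_simps)
      also have "\<dots> \<le> \<beta> * (8 * r + 4 * r)"
      proof (intro mult_left_mono add_mono)
        have "real t ^ 2 / l \<le> real t ^ 2 / 2" using l by (intro divide_left_mono) auto
        then show "16 * (real t ^ 2 / l) \<le> 8 * r" using t by simp
      qed (use True \<beta> in auto)
      also have "\<dots> \<le> 12 * \<alpha>\<^sup>2" using \<beta> by (simp add: algebra_simps)
      also have "\<dots> \<le> 1 / 9"
        using \<alpha> power_mono[of \<alpha> "1/108" 2] by (simp add: power2_eq_square)
      finally have "2 * \<beta> * l * (2 * real (p l) - 1)\<^sup>2 \<le> 1 / 9" .
      then have "(2 * \<beta> * l * (2 * real (p l) - 1)\<^sup>2) ^ l \<le> (1 / 9) ^ l"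
        using \<beta> by (intro power_mono) auto
      then show ?thesis using True by (simp add: b2 power_mult_distrib mult_ac)
    next
      case False
      \<comment> \<open>Beyond level \<open>r\<close> the cost is smaller than the level, so
        \<open>p l\<close> is 1 and the Bonami factor 2 p - 1 is 1 as well.\<close>
      then have "t < l" using t by linarith
      then have "p l = 1" by (simp add: p_def)
      moreover have "(2 * \<alpha>) ^ l \<le> (1 / 9) ^ l" using \<alpha> by (intro power_mono) auto
      ultimately show ?thesis using False by (simp add: b2 power_mult_distrib mult_ac)
    qed
    have "(b l * (real M powr (1 / (2 * real (p l))) * (2 * real (p l) - 1) ^ l))\<^sup>2
        = (b l)\<^sup>2 * (real M powr (1 / real (p l)) * ((2 * real (p l) - 1)\<^sup>2) ^ l)"
      unfolding power_mult_distrib sq by (simp add: mult_ac flip: power_mult)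
    also have "\<dots> \<le> (b l)\<^sup>2 * (2 ^ l * ((2 * real (p l) - 1)\<^sup>2) ^ l)"
      using Mp by (intro mult_left_mono mult_right_mono) auto
    also have "\<dots> \<le> (1 / 9) ^ l" by (rule main)
    also have "\<dots> = ((1 / 3) ^ l)\<^sup>2" by (simp add: power2_eq_square flip: power_mult_distrib)
    finally show ?thesis by (rule power2_le_imp_le) simp
  qed
  have "\<bar>block_corr V J (\<lambda>_. d) K\<bar> = \<bar>\<Sum>z\<in>cube ?I. q z * cube_avg ?I (\<lambda>x. \<Sum>r<M. c r * (A r x * B r (cube_mult ?I x z)))\<bar>"
    unfolding block_corr_def q_def *(5) ..
  also have "\<dots> \<le> (\<Sum>l=2..card ?I. b l * (real M powr (1 / (2 * real (p l))) * (2 * real (p l) - 1) ^ l))"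
    by (rule rectangle_partition_correlation_bound[OF I]) (use * q0 qb in \<open>auto simp: p_def\<close>)
  also have "\<dots> \<le> (\<Sum>l=2..card ?I. (1 / 3) ^ l)"
    by (intro sum_mono lvl) auto
  also have "\<dots> \<le> (\<Sum>l\<in>{..card ?I} - {0}. (1 / 3) ^ l)"
    by (intro sum_mono2) auto
  also have "\<dots> = (\<Sum>l\<le>card ?I. (1 / 3) ^ l) - 1"
    by (subst sum_diff) auto
  also have "\<dots> \<le> 1"
  proof -
    have "(\<Sum>l\<le>card ?I. (1 / 3 :: real) ^ l) * 2 = 3 - (1 / 3) ^ card ?I"
      using sum_gp0[of "1 / 3 :: real" "card ?I"] by simp
    then show ?thesis using zero_le_power[of "1 / 3 :: real" "card ?I"] by linarith
  qed
  finally show ?thesis .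
qed

section \<open>Gaussian moments of sines\<close>

definition gauss :: "nat \<Rightarrow> (nat \<Rightarrow> real) measure" where
  "gauss N = Pi\<^sub>M {..<N} (\<lambda>_. std_normal_distribution)"

lemma prob_space_std_normal: "prob_space std_normal_distribution"
  by (simp add: prob_space_normal_density)

lemma prob_space_gauss: "prob_space (gauss N)"
  unfolding gauss_def by (intro prob_space_PiM prob_space_std_normal)

lemma measurable_gauss_component [measurable]: "a < N \<Longrightarrow> (\<lambda>X. X a) \<in> borel_measurable (gauss N)"
  unfolding gauss_def
  by (rule measurable_compose[OF measurable_component_singleton[of a]]) auto

lemma measurable_gauss_linear [measurable]: "(\<lambda>X. \<Sum>a<N. c a * X a) \<in> borel_measurable (gauss N)"
  by (intro borel_measurable_sum borel_measurable_times measurable_gauss_component) auto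

lemma gauss_integral_prod:
  fixes f :: "nat \<Rightarrow> real \<Rightarrow> 'a :: {real_normed_field, banach, second_countable_topology}"
  assumes "\<And>a. a < N \<Longrightarrow> integrable std_normal_distribution (f a)"
  shows "(\<integral>X. (\<Prod>a<N. f a (X a)) \<partial>gauss N) = (\<Prod>a<N. \<integral>x. f a x \<partial>std_normal_distribution)"
proof -
  interpret product_sigma_finite "\<lambda>_. std_normal_distribution"
    by (intro product_sigma_finite.intro prob_space_imp_sigma_finite prob_space_std_normal)
  show ?thesis unfolding gauss_def by (rule product_integral_prod) (use assms in auto)
qed

lemma integral_gauss_iexp:
  "(CLINT X|gauss N. iexp (\<Sum>a<N. c a * X a)) = complex_of_real (exp (- (\<Sum>a<N. (c a)\<^sup>2) / 2))"
proof -
  interpret std: prob_space std_normal_distribution by (rule prob_space_std_normal)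
  have "(CLINT X|gauss N. iexp (\<Sum>a<N. c a * X a)) = (CLINT X|gauss N. (\<Prod>a<N. iexp (c a * X a)))"
    by (simp add: exp_sum sum_distrib_left of_real_sum flip: of_real_mult)
  also have "\<dots> = (\<Prod>a<N. CLINT x|std_normal_distribution. iexp (c a * x))"
    by (rule gauss_integral_prod, rule std.integrable_const_bound[where B = 1]) auto
  also have "\<dots> = (\<Prod>a<N. complex_of_real (exp (- ((c a)\<^sup>2) / 2)))"
    using char_std_normal_distribution by (simp add: char_def fun_eq_iff)
  also have "\<dots> = complex_of_real (exp (- (\<Sum>a<N. (c a)\<^sup>2) / 2))"
    by (simp only: of_real_prod[symmetric] exp_sum[OF finite_lessThan, symmetric] sum_negf sum_divide_distrib[symmetric])
  finally show ?thesis .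
qed

lemma integrable_gauss_iexp: "integrable (gauss N) (\<lambda>X. iexp (\<Sum>a<N. c a * X a))"
proof -
  interpret prob_space "gauss N" by (rule prob_space_gauss)
  show ?thesis by (rule integrable_const_bound[where B = 1]) auto
qed

text \<open>Each sine is the average over a sign \<sigma> of -i \<sigma> exp(i \<sigma> t).
  Expanding the product leaves one Gaussian characteristic function for every sign pattern on
  \<open>T\<close>.\<close>

lemma integral_gauss_prod_sin:
  fixes \<xi> :: "'i \<Rightarrow> nat \<Rightarrow> real"
  assumes T: "finite T"
  shows "complex_of_real (\<integral>X. (\<Prod>i\<in>T. sin (\<alpha> * (\<Sum>a<N. \<xi> i a * X a))) \<partial>gauss N) =
    (- \<i>) ^ card T * complex_of_real (cube_avg T (\<lambda>\<sigma>. (\<Prod>i\<in>T. \<sigma> i) *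
      exp (- \<alpha>\<^sup>2 / 2 * (\<Sum>a<N. (\<Sum>i\<in>T. \<sigma> i * \<xi> i a)\<^sup>2))))"
proof -
  define L where "L i X = (\<Sum>a<N. \<xi> i a * X a)" for i X
  have sin: "complex_of_real (sin t) = complex_of_real 1 / (2 * \<i>) * iexp (1 * t) + complex_of_real (- 1) / (2 * \<i>) * iexp (- 1 * t)" for t
    using sin_exp_eq[of "complex_of_real t"] by (simp add: sin_of_real field_simps)
  have "complex_of_real (\<Prod>i\<in>T. sin (\<alpha> * L i X)) =
      (\<Sum>\<sigma>\<in>cube T. (- \<i> / 2) ^ card T * complex_of_real (\<Prod>i\<in>T. \<sigma> i) * iexp (\<Sum>a<N. (\<alpha> * (\<Sum>i\<in>T. \<sigma> i * \<xi> i a)) * X a))" for X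
  proof -
    have "complex_of_real (\<Prod>i\<in>T. sin (\<alpha> * L i X)) =
        (\<Sum>\<sigma>\<in>cube T. \<Prod>i\<in>T. complex_of_real (\<sigma> i) / (2 * \<i>) * iexp (\<sigma> i * (\<alpha> * L i X)))"
      unfolding sum_cube_prod[OF T, of "\<lambda>i s. complex_of_real s / (2 * \<i>) * iexp (s * (\<alpha> * L i X))"] of_real_prod sin ..
    also have "\<dots> = (\<Sum>\<sigma>\<in>cube T. (- \<i> / 2) ^ card T * complex_of_real (\<Prod>i\<in>T. \<sigma> i) * iexp (\<Sum>a<N. (\<alpha> * (\<Sum>i\<in>T. \<sigma> i * \<xi> i a)) * X a))"
    proof (rule sum.cong[OF refl])
      fix \<sigma>
      have "(\<Sum>i\<in>T. \<sigma> i * (\<alpha> * L i X)) = (\<Sum>a<N. (\<alpha> * (\<Sum>i\<in>T. \<sigma> i * \<xi> i a)) * X a)"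
        unfolding L_def sum_distrib_left sum_distrib_right by (subst sum.swap) (simp add: mult_ac)
      then have "(\<Prod>i\<in>T. iexp (\<sigma> i * (\<alpha> * L i X))) = iexp (\<Sum>a<N. (\<alpha> * (\<Sum>i\<in>T. \<sigma> i * \<xi> i a)) * X a)"
        using T by (simp add: exp_sum[symmetric] sum_distrib_left[symmetric] flip: of_real_mult of_real_sum)
      moreover have "(\<Prod>i\<in>T. complex_of_real (\<sigma> i) / (2 * \<i>)) = (- \<i> / 2) ^ card T * complex_of_real (\<Prod>i\<in>T. \<sigma> i)"
      proof -
        have "complex_of_real (\<sigma> i) / (2 * \<i>) = (- \<i> / 2) * complex_of_real (\<sigma> i)" for i
          by (simp add: field_simps)
        then show ?thesis by (simp only: prod.distrib prod_constant of_real_prod)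
      qed
      ultimately show "(\<Prod>i\<in>T. complex_of_real (\<sigma> i) / (2 * \<i>) * iexp (\<sigma> i * (\<alpha> * L i X))) =
          (- \<i> / 2) ^ card T * complex_of_real (\<Prod>i\<in>T. \<sigma> i) * iexp (\<Sum>a<N. (\<alpha> * (\<Sum>i\<in>T. \<sigma> i * \<xi> i a)) * X a)"
        by (simp only: prod.distrib)
    qed
    finally show ?thesis .
  qed
  then have "complex_of_real (\<integral>X. (\<Prod>i\<in>T. sin (\<alpha> * L i X)) \<partial>gauss N) =
      (CLINT X|gauss N. (\<Sum>\<sigma>\<in>cube T. (- \<i> / 2) ^ card T * complex_of_real (\<Prod>i\<in>T. \<sigma> i) * iexp (\<Sum>a<N. (\<alpha> * (\<Sum>i\<in>T. \<sigma> i * \<xi> i a)) * X a)))"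
    unfolding integral_complex_of_real[symmetric] by simp
  also have "\<dots> = (\<Sum>\<sigma>\<in>cube T. (- \<i> / 2) ^ card T * complex_of_real (\<Prod>i\<in>T. \<sigma> i) *
      complex_of_real (exp (- (\<Sum>a<N. (\<alpha> * (\<Sum>i\<in>T. \<sigma> i * \<xi> i a))\<^sup>2) / 2)))"
    by (subst Bochner_Integration.integral_sum)
      (intro integrable_mult_right integrable_gauss_iexp, simp only: integral_mult_right_zero integral_gauss_iexp)
  also have "\<dots> = (- \<i>) ^ card T * complex_of_real (cube_avg T (\<lambda>\<sigma>. (\<Prod>i\<in>T. \<sigma> i) *
      exp (- \<alpha>\<^sup>2 / 2 * (\<Sum>a<N. (\<Sum>i\<in>T. \<sigma> i * \<xi> i a)\<^sup>2))))"
    unfolding cube_avg_def power_divide power_mult_distrib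
    by (simp add: sum_distrib_left sum_distrib_right sum_divide_distrib of_real_sum mult_ac sum_negf)
  finally show ?thesis unfolding L_def .
qed

text \<open>Quadratic expressions in the linear forms depend on the covariances alone, which makes
  families with equal covariance interchangeable.\<close>

lemma sum_linear_forms:
  fixes \<xi> :: "'i \<Rightarrow> nat \<Rightarrow> real"
  shows "(\<Sum>a<N. (\<Sum>i\<in>P. s i * \<xi> i a) * (\<Sum>j\<in>Q. t j * \<xi> j a)) =
    (\<Sum>i\<in>P. s i * (\<Sum>j\<in>Q. t j * (\<Sum>a<N. \<xi> i a * \<xi> j a)))"
proof -
  have "(\<Sum>a<N. (\<Sum>i\<in>P. s i * \<xi> i a) * (\<Sum>j\<in>Q. t j * \<xi> j a)) =
      (\<Sum>a<N. \<Sum>i\<in>P. \<Sum>j\<in>Q. s i * (t j * (\<xi> i a * \<xi> j a)))"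
    by (simp add: sum_product mult_ac)
  also have "\<dots> = (\<Sum>i\<in>P. \<Sum>a<N. \<Sum>j\<in>Q. s i * (t j * (\<xi> i a * \<xi> j a)))"
    by (rule sum.swap)
  also have "\<dots> = (\<Sum>i\<in>P. \<Sum>j\<in>Q. \<Sum>a<N. s i * (t j * (\<xi> i a * \<xi> j a)))"
    by (intro sum.cong refl sum.swap)
  finally show ?thesis by (simp add: sum_distrib_left)
qed

text \<open>
  The hypotheses say that the Gaussians indexed by \<open>P\<close> are independent, and so are those indexed by \<open>Q\<close>;
  averaging out the signs on \<open>P\<close> leaves one hyperbolic sine for each element of \<open>P\<close>.
\<close>

lemma cube_avg_gauss_eq:
  fixes \<xi> :: "'i \<Rightarrow> nat \<Rightarrow> real"
  assumes fin: "finite P" "finite Q" and disj: "P \<inter> Q = {}"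
    and C: "\<And>i j. C i j = (\<Sum>a<N. \<xi> i a * \<xi> j a)"
    and PP: "\<And>i j. i \<in> P \<Longrightarrow> j \<in> P \<Longrightarrow> C i j = of_bool (i = j)"
    and QQ: "\<And>i j. i \<in> Q \<Longrightarrow> j \<in> Q \<Longrightarrow> C i j = of_bool (i = j)"
  shows "cube_avg (P \<union> Q) (\<lambda>\<sigma>. (\<Prod>i\<in>P \<union> Q. \<sigma> i) *
      exp (- \<alpha>\<^sup>2 / 2 * (\<Sum>a<N. (\<Sum>i\<in>P \<union> Q. \<sigma> i * \<xi> i a)\<^sup>2))) =
    exp (- \<alpha>\<^sup>2 / 2 * (card P + card Q)) *
      cube_avg Q (\<lambda>v. (\<Prod>j\<in>Q. v j) * (\<Prod>i\<in>P. - sinh (\<alpha>\<^sup>2 * (\<Sum>j\<in>Q. v j * C i j))))"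
proof -
  define w where "w v i = (\<Sum>j\<in>Q. v j * C i j)" for v i
  have sq: "(\<Sum>i\<in>R. s i * (\<Sum>j\<in>R. s j * C i j)) = card R"
    if "finite R" "s \<in> cube R" "\<And>i j. i \<in> R \<Longrightarrow> j \<in> R \<Longrightarrow> C i j = of_bool (i = j)" for R s
  proof -
    have "(\<Sum>j\<in>R. s j * C i j) = s i" if "i \<in> R" for i
    proof -
      have "(\<Sum>j\<in>R. s j * C i j) = (\<Sum>j\<in>R. if i = j then s j else 0)"
        using that by (intro sum.cong refl) (auto simp: \<open>\<And>i j. i \<in> R \<Longrightarrow> j \<in> R \<Longrightarrow> C i j = of_bool (i = j)\<close>)
      then show ?thesis using that \<open>finite R\<close> by simp
    qed
    then have "(\<Sum>i\<in>R. s i * (\<Sum>j\<in>R. s j * C i j)) = (\<Sum>i\<in>R. s i * s i)" by simp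
    also have "\<dots> = (\<Sum>i\<in>R. 1)"
      using cube_val[OF \<open>s \<in> cube R\<close>] by (intro sum.cong refl) force
    finally show ?thesis by simp
  qed
  have square: "(\<Sum>a<N. (f a + g a)\<^sup>2) = (\<Sum>a<N. f a * f a) + (\<Sum>a<N. g a * g a) + 2 * (\<Sum>a<N. f a * g a)"
    for f g :: "nat \<Rightarrow> real"
    by (induction N) (simp_all add: power2_eq_square algebra_simps)
  \<comment> \<open>Orthonormality turns the squares over \<open>P\<close> and over \<open>Q\<close>
    into constants, so only the cross term depends on the signs.\<close>
  have quad: "(\<Sum>a<N. ((\<Sum>i\<in>P. u i * \<xi> i a) + (\<Sum>i\<in>Q. v i * \<xi> i a))\<^sup>2) =
      (card P + card Q) + 2 * (\<Sum>i\<in>P. u i * w v i)" if "u \<in> cube P" "v \<in> cube Q" for u v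
  proof -
    have "(\<Sum>a<N. ((\<Sum>i\<in>P. u i * \<xi> i a) + (\<Sum>i\<in>Q. v i * \<xi> i a))\<^sup>2) =
        (\<Sum>a<N. (\<Sum>i\<in>P. u i * \<xi> i a) * (\<Sum>i\<in>P. u i * \<xi> i a)) + (\<Sum>a<N. (\<Sum>i\<in>Q. v i * \<xi> i a) * (\<Sum>i\<in>Q. v i * \<xi> i a))
        + 2 * (\<Sum>a<N. (\<Sum>i\<in>P. u i * \<xi> i a) * (\<Sum>i\<in>Q. v i * \<xi> i a))"
      by (rule square)
    also have "\<dots> = (card P + card Q) + 2 * (\<Sum>i\<in>P. u i * w v i)"
      unfolding sum_linear_forms C[symmetric] w_def using sq[OF fin(1) that(1) PP] sq[OF fin(2) that(2) QQ] by simp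
    finally show ?thesis .
  qed
  have inner: "(\<Sum>u\<in>cube P. (\<Prod>i\<in>P. u i) * exp (- \<alpha>\<^sup>2 * (\<Sum>i\<in>P. u i * w v i))) =
      2 ^ card P * (\<Prod>i\<in>P. - sinh (\<alpha>\<^sup>2 * w v i))" for v
  proof -
    have "(\<Sum>u\<in>cube P. (\<Prod>i\<in>P. u i) * exp (- \<alpha>\<^sup>2 * (\<Sum>i\<in>P. u i * w v i))) =
        (\<Sum>u\<in>cube P. \<Prod>i\<in>P. u i * exp (- \<alpha>\<^sup>2 * (u i * w v i)))"
      using fin by (simp add: exp_sum sum_distrib_left prod.distrib flip: sum_negf)
    also have "\<dots> = (\<Prod>i\<in>P. 2 * (- sinh (\<alpha>\<^sup>2 * w v i)))"
      by (subst sum_cube_prod[OF fin(1), of "\<lambda>i s. s * exp (- \<alpha>\<^sup>2 * (s * w v i))"])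
        (simp add: sinh_def algebra_simps)
    also have "\<dots> = 2 ^ card P * (\<Prod>i\<in>P. - sinh (\<alpha>\<^sup>2 * w v i))"
      by (simp only: prod.distrib prod_constant)
    finally show ?thesis .
  qed
  have merge: "(\<Prod>i\<in>P \<union> Q. if i \<in> P then u i else v i) = (\<Prod>i\<in>P. u i) * (\<Prod>i\<in>Q. v i)"
    "(\<Sum>i\<in>P \<union> Q. (if i \<in> P then u i else v i) * \<xi> i a) = (\<Sum>i\<in>P. u i * \<xi> i a) + (\<Sum>i\<in>Q. v i * \<xi> i a)" for u v a
  proof -
    have nP: "i \<notin> P" if "i \<in> Q" for i using disj that by blast
    show "(\<Prod>i\<in>P \<union> Q. if i \<in> P then u i else v i) = (\<Prod>i\<in>P. u i) * (\<Prod>i\<in>Q. v i)"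
      by (subst prod.union_disjoint[OF fin disj]) (simp add: nP)
    show "(\<Sum>i\<in>P \<union> Q. (if i \<in> P then u i else v i) * \<xi> i a) = (\<Sum>i\<in>P. u i * \<xi> i a) + (\<Sum>i\<in>Q. v i * \<xi> i a)"
      by (subst sum.union_disjoint[OF fin disj]) (simp add: nP)
  qed
  have card: "card (P \<union> Q) = card P + card Q" using fin disj by (rule card_Un_disjoint)
  have "(\<Sum>\<sigma>\<in>cube (P \<union> Q). (\<Prod>i\<in>P \<union> Q. \<sigma> i) * exp (- \<alpha>\<^sup>2 / 2 * (\<Sum>a<N. (\<Sum>i\<in>P \<union> Q. \<sigma> i * \<xi> i a)\<^sup>2))) =
      (\<Sum>u\<in>cube P. \<Sum>v\<in>cube Q. exp (- \<alpha>\<^sup>2 / 2 * (card P + card Q)) * ((\<Prod>i\<in>Q. v i) *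
        ((\<Prod>i\<in>P. u i) * exp (- \<alpha>\<^sup>2 * (\<Sum>i\<in>P. u i * w v i)))))"
    unfolding sum_cube_union[OF disj] merge
    by (intro sum.cong refl) (simp add: quad algebra_simps flip: exp_add)
  also have "\<dots> = (\<Sum>v\<in>cube Q. \<Sum>u\<in>cube P. exp (- \<alpha>\<^sup>2 / 2 * (card P + card Q)) * ((\<Prod>i\<in>Q. v i) *
        ((\<Prod>i\<in>P. u i) * exp (- \<alpha>\<^sup>2 * (\<Sum>i\<in>P. u i * w v i)))))"
    by (rule sum.swap)
  also have "\<dots> = exp (- \<alpha>\<^sup>2 / 2 * (card P + card Q)) * (\<Sum>v\<in>cube Q. (\<Prod>i\<in>Q. v i) *
        (2 ^ card P * (\<Prod>i\<in>P. - sinh (\<alpha>\<^sup>2 * w v i))))"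
    by (simp only: sum_distrib_left[symmetric] inner)
  finally show ?thesis
    unfolding cube_avg_def card power_add w_def
    by (simp add: sum_distrib_left sum_divide_distrib mult_ac)
qed

text \<open>Each of the card P hyperbolic sines has an argument of modulus at most \<alpha>^2 card Q
  h. The bound is not symmetric in \<open>P\<close> and \<open>Q\<close>; it is applied in both
  orders so that the larger set can supply the exponent.\<close>

lemma cube_avg_gauss_le_sinh:
  fixes \<xi> :: "'i \<Rightarrow> nat \<Rightarrow> real" and h :: real
  assumes fin: "finite P" "finite Q" and disj: "P \<inter> Q = {}"
    and C: "\<And>i j. C i j = (\<Sum>a<N. \<xi> i a * \<xi> j a)"
    and PP: "\<And>i j. i \<in> P \<Longrightarrow> j \<in> P \<Longrightarrow> C i j = of_bool (i = j)"
    and QQ: "\<And>i j. i \<in> Q \<Longrightarrow> j \<in> Q \<Longrightarrow> C i j = of_bool (i = j)"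
    and PQ: "\<And>i j. i \<in> P \<Longrightarrow> j \<in> Q \<Longrightarrow> \<bar>C i j\<bar> \<le> h"
  shows "\<bar>cube_avg (P \<union> Q) (\<lambda>\<sigma>. (\<Prod>i\<in>P \<union> Q. \<sigma> i) *
      exp (- \<alpha>\<^sup>2 / 2 * (\<Sum>a<N. (\<Sum>i\<in>P \<union> Q. \<sigma> i * \<xi> i a)\<^sup>2)))\<bar> \<le> sinh (\<alpha>\<^sup>2 * (card Q * h)) ^ card P"
proof -
  have "\<bar>(\<Prod>j\<in>Q. v j) * (\<Prod>i\<in>P. - sinh (\<alpha>\<^sup>2 * (\<Sum>j\<in>Q. v j * C i j)))\<bar> \<le> sinh (\<alpha>\<^sup>2 * (card Q * h)) ^ card P"
    if v: "v \<in> cube Q" for v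
  proof -
    have v1: "\<bar>v j\<bar> = 1" if "j \<in> Q" for j using cube_val[OF v that] by auto
    have "\<bar>- sinh (\<alpha>\<^sup>2 * (\<Sum>j\<in>Q. v j * C i j))\<bar> \<le> sinh (\<alpha>\<^sup>2 * (card Q * h))" if i: "i \<in> P" for i
    proof -
      have "\<bar>\<Sum>j\<in>Q. v j * C i j\<bar> \<le> (\<Sum>j\<in>Q. \<bar>v j * C i j\<bar>)" by (rule sum_abs)
      also have "\<dots> \<le> (\<Sum>j\<in>Q. h)" using PQ[OF i] v1 by (intro sum_mono) (simp add: abs_mult)
      finally have "\<bar>\<Sum>j\<in>Q. v j * C i j\<bar> \<le> card Q * h" by simp
      then have "\<bar>\<alpha>\<^sup>2 * (\<Sum>j\<in>Q. v j * C i j)\<bar> \<le> \<alpha>\<^sup>2 * (card Q * h)"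
        unfolding abs_mult by (simp add: mult_left_mono)
      then have "sinh \<bar>\<alpha>\<^sup>2 * (\<Sum>j\<in>Q. v j * C i j)\<bar> \<le> sinh (\<alpha>\<^sup>2 * (card Q * h))"
        by (simp only: sinh_real_le_iff)
      then show ?thesis by (simp add: sinh_real_abs)
    qed
    then have "(\<Prod>i\<in>P. \<bar>- sinh (\<alpha>\<^sup>2 * (\<Sum>j\<in>Q. v j * C i j))\<bar>) \<le> (\<Prod>i\<in>P. sinh (\<alpha>\<^sup>2 * (card Q * h)))"
      by (intro prod_mono) auto
    moreover have "(\<Prod>j\<in>Q. \<bar>v j\<bar>) = 1" using v1 by simp
    ultimately show ?thesis by (simp add: abs_mult abs_prod)
  qed
  then have "\<bar>cube_avg Q (\<lambda>v. (\<Prod>j\<in>Q. v j) * (\<Prod>i\<in>P. - sinh (\<alpha>\<^sup>2 * (\<Sum>j\<in>Q. v j * C i j))))\<bar>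
      \<le> sinh (\<alpha>\<^sup>2 * (card Q * h)) ^ card P"
    by (intro cube_avg_abs_le fin) 
  moreover have "\<bar>exp (- \<alpha>\<^sup>2 / 2 * (card P + card Q))\<bar> \<le> 1"
    by simp
  ultimately have "\<bar>exp (- \<alpha>\<^sup>2 / 2 * (card P + card Q))\<bar> *
      \<bar>cube_avg Q (\<lambda>v. (\<Prod>j\<in>Q. v j) * (\<Prod>i\<in>P. - sinh (\<alpha>\<^sup>2 * (\<Sum>j\<in>Q. v j * C i j))))\<bar>
      \<le> 1 * sinh (\<alpha>\<^sup>2 * (card Q * h)) ^ card P"
    by (intro mult_mono) auto
  then show ?thesis
    by (subst cube_avg_gauss_eq[where C = C, OF fin disj C PP QQ]) (simp_all add: abs_mult)
qed

lemma sinh_le_double: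
  fixes u :: real
  assumes "0 \<le> u" "u \<le> 1"
  shows "sinh u \<le> 2 * u"
proof -
  have "exp u \<le> 1 + u + u\<^sup>2" using assms by (intro exp_bound) auto
  moreover have "exp (- u) \<ge> 1 - u" using exp_ge_add_one_self[of "- u"] by simp
  ultimately have "sinh u \<le> u + u\<^sup>2 / 2" by (simp add: sinh_def)
  moreover have "u\<^sup>2 \<le> u" using assms by (simp add: power2_eq_square mult_left_le)
  ultimately show ?thesis using assms by linarith
qed

text \<open>The forms indexed by \<open>P\<close> are distinct coordinates of \<open>X\<close>, so
  their sines are independent. The other factors are bounded by 1, and E|sin(\<alpha> X)| \<le>
  \<alpha> E|X| = \<alpha> sqrt(2/pi) \<le> \<alpha>.\<close>

lemma integral_gauss_prod_sin_le:
  fixes \<xi> :: "'i \<Rightarrow> nat \<Rightarrow> real"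
  assumes T: "finite T" and P: "P \<subseteq> T" and f: "inj_on f P" "f ` P \<subseteq> {..<N}"
    and \<xi>: "\<And>i a. i \<in> P \<Longrightarrow> a < N \<Longrightarrow> \<xi> i a = of_bool (a = f i)" and \<alpha>: "\<alpha> \<ge> 0"
  shows "\<bar>\<integral>X. (\<Prod>i\<in>T. sin (\<alpha> * (\<Sum>a<N. \<xi> i a * X a))) \<partial>gauss N\<bar> \<le> \<alpha> ^ card P"
proof -
  interpret std: prob_space std_normal_distribution by (rule prob_space_std_normal)
  interpret prob_space "gauss N" by (rule prob_space_gauss)
  have finP: "finite P" using T P finite_subset by blast
  have L: "(\<Sum>a<N. \<xi> i a * X a) = X (f i)" if "i \<in> P" for i X
  proof -
    have "(\<Sum>a<N. \<xi> i a * X a) = (\<Sum>a<N. if a = f i then X a else 0)"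
      using that by (intro sum.cong refl) (auto simp: \<xi>)
    then show ?thesis using f that by auto
  qed
  define g where "g a x = (if a \<in> f ` P then \<bar>sin (\<alpha> * x)\<bar> else 1)" for a x
  have gX: "(\<Prod>a<N. g a (X a)) = (\<Prod>i\<in>P. \<bar>sin (\<alpha> * X (f i))\<bar>)" for X
  proof -
    have "(\<Prod>a<N. g a (X a)) = (\<Prod>a\<in>f ` P. \<bar>sin (\<alpha> * X a)\<bar>)"
      unfolding g_def using f by (intro prod.mono_neutral_cong_right) auto
    then show ?thesis using f by (simp add: prod.reindex)
  qed
  have int_sin: "integrable std_normal_distribution (\<lambda>x. \<bar>sin (\<alpha> * x)\<bar>)"
    by (rule std.integrable_const_bound[where B = 1]) auto
  have int1: "integrable std_normal_distribution (\<lambda>x. \<bar>x\<bar>)"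
    using integrable_std_normal_distribution_moment[of 1] by (intro integrable_abs) simp
  have "(\<integral>x. \<bar>sin (\<alpha> * x)\<bar> \<partial>std_normal_distribution) \<le> (\<integral>x. \<alpha> * \<bar>x\<bar> \<partial>std_normal_distribution)"
  proof (rule integral_mono)
    show "\<bar>sin (\<alpha> * x)\<bar> \<le> \<alpha> * \<bar>x\<bar>" for x
      using abs_sin_x_le_abs_x[of "\<alpha> * x"] \<alpha> by (simp add: abs_mult)
  qed (use int_sin int1 in auto)
  also have "\<dots> = \<alpha> * sqrt (2 / pi)"
    using std_normal_distribution_odd_moments_abs[of 0] by simp
  also have "\<dots> \<le> \<alpha> * 1"
    using \<alpha> pi_gt3 by (intro mult_left_mono) auto
  finally have E: "(\<integral>x. \<bar>sin (\<alpha> * x)\<bar> \<partial>std_normal_distribution) \<le> \<alpha>" by simp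
  have int_g: "integrable std_normal_distribution (g a)" for a
    unfolding g_def by (cases "a \<in> f ` P") (use int_sin in simp_all)
  have "\<bar>\<integral>X. (\<Prod>i\<in>T. sin (\<alpha> * (\<Sum>a<N. \<xi> i a * X a))) \<partial>gauss N\<bar> \<le>
      (\<integral>X. \<bar>\<Prod>i\<in>T. sin (\<alpha> * (\<Sum>a<N. \<xi> i a * X a))\<bar> \<partial>gauss N)"
    by (rule integral_abs_bound)
  also have "\<dots> \<le> (\<integral>X. (\<Prod>a<N. g a (X a)) \<partial>gauss N)"
  proof (rule integral_mono)
    have b: "\<bar>\<Prod>i\<in>T. sin (\<alpha> * (\<Sum>a<N. \<xi> i a * X a))\<bar> \<le> (\<Prod>a<N. g a (X a))" for X
    proof -
      have "\<bar>\<Prod>i\<in>T. sin (\<alpha> * (\<Sum>a<N. \<xi> i a * X a))\<bar> =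
          (\<Prod>i\<in>T - P. \<bar>sin (\<alpha> * (\<Sum>a<N. \<xi> i a * X a))\<bar>) * (\<Prod>i\<in>P. \<bar>sin (\<alpha> * (\<Sum>a<N. \<xi> i a * X a))\<bar>)"
        unfolding abs_prod by (rule prod.subset_diff[OF P T])
      also have "\<dots> \<le> 1 * (\<Prod>i\<in>P. \<bar>sin (\<alpha> * (\<Sum>a<N. \<xi> i a * X a))\<bar>)"
        by (intro mult_right_mono prod_le_1 prod_nonneg) auto
      also have "\<dots> = (\<Prod>a<N. g a (X a))"
        unfolding gX by (simp add: L)
      finally show ?thesis .
    qed
    then show "\<bar>\<Prod>i\<in>T. sin (\<alpha> * (\<Sum>a<N. \<xi> i a * X a))\<bar> \<le> (\<Prod>a<N. g a (X a))" for X .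
    show "integrable (gauss N) (\<lambda>X. \<bar>\<Prod>i\<in>T. sin (\<alpha> * (\<Sum>a<N. \<xi> i a * X a))\<bar>)"
      by (rule integrable_const_bound[where B = 1]) (auto simp: abs_prod intro!: prod_le_1)
    have "(\<lambda>X. \<Prod>a<N. g a (X a)) \<in> borel_measurable (gauss N)"
      unfolding g_def by (intro borel_measurable_prod) (auto intro!: borel_measurable_sin borel_measurable_abs)
    then show "integrable (gauss N) (\<lambda>X. \<Prod>a<N. g a (X a))"
      by (rule integrable_const_bound[where B = 1, rotated]) (auto simp: gX abs_prod intro!: prod_le_1)
  qed
  also have "\<dots> = (\<Prod>a<N. \<integral>x. g a x \<partial>std_normal_distribution)"
    by (rule gauss_integral_prod) (rule int_g)
  also have "\<dots> = (\<Prod>a\<in>f ` P. \<integral>x. \<bar>sin (\<alpha> * x)\<bar> \<partial>std_normal_distribution)"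
    unfolding g_def using f std.prob_space by (intro prod.mono_neutral_cong_right) auto
  also have "\<dots> \<le> (\<Prod>a\<in>f ` P. \<alpha>)"
    by (intro prod_mono conjI E integral_nonneg) auto
  also have "\<dots> = \<alpha> ^ card P" using f by (simp add: card_image)
  finally show ?thesis .
qed

lemma cube_avg_empty [simp]: "cube_avg {} f = f (\<lambda>_. undefined)"
  by (simp add: cube_avg_def)

lemma cube_avg_insert:
  "finite I \<Longrightarrow> i \<notin> I \<Longrightarrow> cube_avg (insert i I) f = cube_avg I (\<lambda>x. (f (x(i := 1)) + f (x(i := - 1))) / 2)"
  by (simp add: cube_avg_def sum_cube_insert flip: sum_divide_distrib)

text \<open>Since (1 + u + u^2/2)(1 - u + u^2/2) = 1 + u^4/4, the lower Taylor bound for exp u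
  becomes an upper bound for its inverse.\<close>

lemma exp_minus_le:
  fixes u :: real
  assumes "u \<ge> 0"
  shows "exp (- u) \<le> 1 - u + u\<^sup>2 / 2"
proof -
  have "1 * 1 \<le> (1 + u + u\<^sup>2 / 2) * (1 - u + u\<^sup>2 / 2)"
    using assms by (simp add: algebra_simps power2_eq_square)
  also have "\<dots> \<le> exp u * (1 - u + u\<^sup>2 / 2)"
  proof (rule mult_right_mono[OF exp_lower_Taylor_quadratic[OF assms]])
    have "1 - u + u\<^sup>2 / 2 = (1 - u)\<^sup>2 / 2 + 1 / 2" by (simp add: power2_eq_square field_simps)
    then show "0 \<le> 1 - u + u\<^sup>2 / 2" by simp
  qed
  finally show ?thesis by (simp add: exp_minus field_simps)
qed

lemma sinh_ge_self:
  fixes u :: real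
  assumes "u \<ge> 0"
  shows "u \<le> sinh u"
  using exp_lower_Taylor_quadratic[OF assms] exp_minus_le[OF assms] by (simp add: sinh_def)

text \<open>Two rows and two columns of \<open>H\<close> meet in four entries, each h or -h. On the
  right their signs survive only through their product, the form in which the fourth moments can be
  summed by orthogonality.\<close>

lemma sinh_sign_identity:
  fixes t h :: real
  assumes "s1 = 1 \<or> s1 = - 1" "s2 = 1 \<or> s2 = - 1" "s3 = 1 \<or> s3 = - 1" "s4 = 1 \<or> s4 = - 1"
  shows "(s1 * h) * (s4 * h) * ((sinh (t * (s1 * h + s2 * h)) * sinh (t * (s3 * h + s4 * h)) -
      sinh (t * (s1 * h - s2 * h)) * sinh (t * (s3 * h - s4 * h))) / 2) =
    (sinh (2 * (t * h)))\<^sup>2 / 4 * (h\<^sup>2 + h\<^sup>2 * (s1 * s2 * (s3 * s4)))"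
proof -
  have e: "t * (2 * h) = 2 * (t * h)" "t * (- h - h) = - (2 * (t * h))" "t * (- h + - h) = - (2 * (t * h))"
    by (simp_all add: algebra_simps)
  show ?thesis
    using assms by (elim disjE) (simp_all add: e power2_eq_square)
qed

section \<open>The Gaussian Forrelation distribution\<close>

text \<open>The last assumption, flatness, gives every covariance between the two halves of the
  Gaussian family the size 1/sqrt N.\<close>

locale hadamard_matrix =
  fixes N :: nat and H :: "nat \<Rightarrow> nat \<Rightarrow> real"
  assumes N: "N > 0"
    and sym: "a < N \<Longrightarrow> b < N \<Longrightarrow> H a b = H b a"
    and orth: "b < N \<Longrightarrow> b' < N \<Longrightarrow> (\<Sum>a<N. H a b * H a b') = of_bool (b = b')"
    and H_abs: "a < N \<Longrightarrow> b < N \<Longrightarrow> \<bar>H a b\<bar> = 1 / sqrt N"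
begin

text \<open>
  For a standard Gaussian vector \<open>X\<close>, the family \<open>\<Sum>a. \<xi> i a * X a\<close> consists of \<open>X\<close> followed by \<open>H X\<close>;
  \<open>\<xi>'\<close> gives a family with the same law that consists of \<open>H X\<close> followed by \<open>X\<close>.
\<close>

definition \<xi> :: "nat \<Rightarrow> nat \<Rightarrow> real" where
  "\<xi> i a = (if i < N then of_bool (a = i) else H a (i - N))"

definition \<xi>' :: "nat \<Rightarrow> nat \<Rightarrow> real" where
  "\<xi>' i a = (if i < N then H a i else of_bool (a = i - N))"

abbreviation lin :: "nat \<Rightarrow> (nat \<Rightarrow> real) \<Rightarrow> real" where
  "lin i X \<equiv> \<Sum>a<N. \<xi> i a * X a"

abbreviation \<Omega> :: "(nat \<Rightarrow> real) set" where
  "\<Omega> \<equiv> cube {..<2 * N}"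

text \<open>The common covariance of the families given by \<open>\<xi>\<close> and
  \<open>\<xi>'\<close>.\<close>

definition cov :: "nat \<Rightarrow> nat \<Rightarrow> real" where
  "cov i j = (if i < N then (if j < N then of_bool (i = j) else H i (j - N))
     else (if j < N then H j (i - N) else of_bool (i = j)))"

lemma cov_\<xi>: "i < 2 * N \<Longrightarrow> j < 2 * N \<Longrightarrow> (\<Sum>a<N. \<xi> i a * \<xi> j a) = cov i j"
  unfolding \<xi>_def cov_def using orth[of "i - N" "j - N"]
  by (auto simp: of_bool_def if_distrib[of "\<lambda>x. x * _"] if_distrib[of "\<lambda>x. _ * x"] cong: if_cong)

lemma cov_\<xi>': "i < 2 * N \<Longrightarrow> j < 2 * N \<Longrightarrow> (\<Sum>a<N. \<xi>' i a * \<xi>' j a) = cov i j"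
  unfolding \<xi>'_def cov_def using orth[of i j] sym[of i "j - N"] sym[of j "i - N"]
  by (auto simp: of_bool_def if_distrib[of "\<lambda>x. x * _"] if_distrib[of "\<lambda>x. _ * x"] cong: if_cong)

section \<open>Fourier coefficients of the Gaussian Forrelation distribution\<close>

definition mom :: "real \<Rightarrow> nat set \<Rightarrow> real" where
  "mom \<alpha> T = (\<integral>X. (\<Prod>i\<in>T. sin (\<alpha> * lin i X)) \<partial>gauss N)"

text \<open>
  The sine keeps the conditional means of the signs in \<open>[- 1, 1]\<close>, so no truncation of the Gaussians is
  needed, and its moments come from the Gaussian characteristic function. For \<open>\<alpha> = 0\<close> this is the
  uniform distribution.
\<close>

definition dens :: "real \<Rightarrow> (nat \<Rightarrow> real) \<Rightarrow> real" where
  "dens \<alpha> w = (\<integral>X. (\<Prod>i<2 * N. (1 + w i * sin (\<alpha> * lin i X)) / 2) \<partial>gauss N)"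

definition forrel :: "(nat \<Rightarrow> real) \<Rightarrow> real" where
  "forrel w = (\<Sum>a<N. \<Sum>b<N. H a b * w a * w (N + b)) / N"

lemma dens_nonneg:
  assumes "w \<in> \<Omega>"
  shows "dens \<alpha> w \<ge> 0"
  unfolding dens_def
proof (intro Bochner_Integration.integral_nonneg prod_nonneg ballI)
  fix X :: "nat \<Rightarrow> real" and i assume "i \<in> {..<2 * N}"
  then have "w i = - 1 \<or> w i = 1" using cube_val[OF assms] by auto
  moreover have "0 \<le> 1 + sin t" for t :: real using sin_ge_minus_one[of t] by linarith
  ultimately show "0 \<le> (1 + w i * sin (\<alpha> * lin i X)) / 2"
    by (elim disjE) simp_all
qed

lemma integrable_dens:
  assumes "w \<in> \<Omega>"
  shows "integrable (gauss N) (\<lambda>X. \<Prod>i<2 * N. (1 + w i * sin (\<alpha> * lin i X)) / 2)"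
proof -
  interpret prob_space "gauss N" by (rule prob_space_gauss)
  have "\<bar>(1 + w i * sin t) / 2\<bar> \<le> 1" if "i < 2 * N" for i t
  proof -
    have "w i = - 1 \<or> w i = 1" using cube_val[OF assms, of i] that by auto
    then have "\<bar>w i * sin t\<bar> \<le> 1" using abs_sin_le_one[of t] by (auto simp: abs_mult)
    then show ?thesis by (auto simp: abs_le_iff)
  qed
  then show ?thesis
    by (intro integrable_const_bound[where B = 1]) (auto simp: abs_prod intro!: prod_le_1)
qed

text \<open>Given \<open>X\<close> the signs are independent with the sines as means, so the
  conditional expectation of a character is a product of sines.\<close>

lemma dens_fourier:
  assumes "T \<subseteq> {..<2 * N}"
  shows "(\<Sum>w\<in>\<Omega>. dens \<alpha> w * (\<Prod>i\<in>T. w i)) = mom \<alpha> T"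
proof -
  have "(\<Sum>w\<in>\<Omega>. dens \<alpha> w * (\<Prod>i\<in>T. w i)) =
      (\<integral>X. (\<Sum>w\<in>\<Omega>. (\<Prod>i<2 * N. (1 + w i * sin (\<alpha> * lin i X)) / 2) * (\<Prod>i\<in>T. w i)) \<partial>gauss N)"
    unfolding dens_def
    by (subst Bochner_Integration.integral_sum) (auto intro!: integrable_mult_left integrable_dens)
  also have "\<dots> = mom \<alpha> T"
    unfolding mom_def
  proof (intro Bochner_Integration.integral_cong refl)
    fix X :: "nat \<Rightarrow> real"
    define s where "s i = sin (\<alpha> * lin i X)" for i
    have "(\<Prod>i\<in>T. w i) = (\<Prod>i<2 * N. if i \<in> T then w i else 1)" for w :: "nat \<Rightarrow> real"
      using assms by (intro prod.mono_neutral_cong_left) auto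
    then have "(\<Sum>w\<in>\<Omega>. (\<Prod>i<2 * N. (1 + w i * s i) / 2) * (\<Prod>i\<in>T. w i)) =
        (\<Sum>w\<in>\<Omega>. \<Prod>i<2 * N. (1 + w i * s i) / 2 * (if i \<in> T then w i else 1))"
      by (simp only: prod.distrib)
    also have "\<dots> = (\<Prod>i<2 * N. (1 + 1 * s i) / 2 * (if i \<in> T then 1 else 1) + (1 + (- 1) * s i) / 2 * (if i \<in> T then - 1 else 1))"
      by (rule sum_cube_prod[where f = "\<lambda>i v. (1 + v * s i) / 2 * (if i \<in> T then v else 1)"]) simp
    also have "\<dots> = (\<Prod>i<2 * N. if i \<in> T then s i else 1)"
      by (intro prod.cong refl) (auto simp: field_simps)
    also have "\<dots> = (\<Prod>i\<in>T. s i)"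
      using assms by (intro prod.mono_neutral_cong_right) auto
    finally show "(\<Sum>w\<in>\<Omega>. (\<Prod>i<2 * N. (1 + w i * sin (\<alpha> * lin i X)) / 2) * (\<Prod>i\<in>T. w i)) =
        (\<Prod>i\<in>T. sin (\<alpha> * lin i X))"
      unfolding s_def .
  qed
  finally show ?thesis .
qed

lemma mom_empty [simp]: "mom \<alpha> {} = 1"
  unfolding mom_def using prob_space.prob_space[OF prob_space_gauss, of N] by simp

definition quad_avg :: "real \<Rightarrow> nat set \<Rightarrow> real" where
  "quad_avg \<alpha> T = cube_avg T (\<lambda>\<sigma>. (\<Prod>i\<in>T. \<sigma> i) * exp (- \<alpha>\<^sup>2 / 2 * (\<Sum>a<N. (\<Sum>i\<in>T. \<sigma> i * \<xi> i a)\<^sup>2)))"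

lemma mom_eq_quad_avg:
  assumes "finite T"
  shows "complex_of_real (mom \<alpha> T) = (- \<i>) ^ card T * complex_of_real (quad_avg \<alpha> T)"
  unfolding mom_def quad_avg_def by (rule integral_gauss_prod_sin[OF assms])

lemma abs_mom:
  assumes "finite T"
  shows "\<bar>mom \<alpha> T\<bar> = \<bar>quad_avg \<alpha> T\<bar>"
  using arg_cong[OF mom_eq_quad_avg[OF assms, of \<alpha>], of norm] by (simp add: norm_mult norm_power)

text \<open>Moments depend on covariances only. Passing to \<open>\<xi>'\<close> makes the second
  half of the family the coordinates of the Gaussian vector, to which
  \<open>integral_gauss_prod_sin_le\<close> applies.\<close>

lemma abs_mom_swap:
  assumes T: "T \<subseteq> {..<2 * N}"
  shows "\<bar>mom \<alpha> T\<bar> = \<bar>\<integral>X. (\<Prod>i\<in>T. sin (\<alpha> * (\<Sum>a<N. \<xi>' i a * X a))) \<partial>gauss N\<bar>"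
proof -
  have fin: "finite T" using T finite_subset by blast
  have "(\<Sum>a<N. (\<Sum>i\<in>T. \<sigma> i * \<xi> i a)\<^sup>2) = (\<Sum>a<N. (\<Sum>i\<in>T. \<sigma> i * \<xi>' i a)\<^sup>2)" for \<sigma>
  proof -
    have "(\<Sum>a<N. \<xi> i a * \<xi> j a) = (\<Sum>a<N. \<xi>' i a * \<xi>' j a)" if "i \<in> T" "j \<in> T" for i j
    proof -
      have "i < 2 * N" "j < 2 * N" using T that by auto
      then show ?thesis by (simp only: cov_\<xi> cov_\<xi>')
    qed
    then show ?thesis
      unfolding power2_eq_square sum_linear_forms by simp
  qed
  then have "complex_of_real (mom \<alpha> T) = complex_of_real (\<integral>X. (\<Prod>i\<in>T. sin (\<alpha> * (\<Sum>a<N. \<xi>' i a * X a))) \<partial>gauss N)"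
    unfolding mom_eq_quad_avg[OF fin] quad_avg_def integral_gauss_prod_sin[OF fin] by simp
  then show ?thesis by simp
qed

lemma quad_avg_eq:
  assumes "P \<subseteq> {..<N}" "Q \<subseteq> {N..<2 * N}"
  shows "quad_avg \<alpha> (P \<union> Q) = exp (- \<alpha>\<^sup>2 / 2 * (card P + card Q)) *
      cube_avg Q (\<lambda>v. (\<Prod>j\<in>Q. v j) * (\<Prod>i\<in>P. - sinh (\<alpha>\<^sup>2 * (\<Sum>j\<in>Q. v j * H i (j - N)))))"
proof -
  have fin: "finite P" "finite Q" using assms finite_subset by blast+
  have disj: "P \<inter> Q = {}" using assms by fastforce
  define C where "C i j = (\<Sum>a<N. \<xi> i a * \<xi> j a)" for i j
  have C: "C i j = cov i j" if "i < 2 * N" "j < 2 * N" for i j using that by (simp add: C_def cov_\<xi>)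
  have PQ: "i < N" "j \<ge> N" "j < 2 * N" if "i \<in> P" "j \<in> Q" for i j using assms that by auto
  have "quad_avg \<alpha> (P \<union> Q) = exp (- \<alpha>\<^sup>2 / 2 * (card P + card Q)) *
      cube_avg Q (\<lambda>v. (\<Prod>j\<in>Q. v j) * (\<Prod>i\<in>P. - sinh (\<alpha>\<^sup>2 * (\<Sum>j\<in>Q. v j * C i j))))"
    unfolding quad_avg_def
  proof (rule cube_avg_gauss_eq[OF fin disj C_def])
    show "C i j = of_bool (i = j)" if "i \<in> P" "j \<in> P" for i j
    proof -
      have "i < N" "j < N" using that assms by auto
      then show ?thesis by (simp add: C cov_def)
    qed
    show "C i j = of_bool (i = j)" if "i \<in> Q" "j \<in> Q" for i j
    proof -
      have "\<not> i < N" "\<not> j < N" "i < 2 * N" "j < 2 * N" using that assms by auto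
      then show ?thesis by (simp add: C cov_def)
    qed
  qed
  also have "(\<lambda>v. (\<Prod>j\<in>Q. v j) * (\<Prod>i\<in>P. - sinh (\<alpha>\<^sup>2 * (\<Sum>j\<in>Q. v j * C i j)))) =
      (\<lambda>v. (\<Prod>j\<in>Q. v j) * (\<Prod>i\<in>P. - sinh (\<alpha>\<^sup>2 * (\<Sum>j\<in>Q. v j * H i (j - N)))))"
  proof -
    have "C i j = H i (j - N)" if "i \<in> P" "j \<in> Q" for i j
      using PQ[OF that] by (simp add: C cov_def)
    then show ?thesis by simp
  qed
  finally show ?thesis .
qed

lemma abs_quad_avg_le:
  assumes "P \<subseteq> {..<N}" "Q \<subseteq> {N..<2 * N}"
  shows "\<bar>quad_avg \<alpha> (P \<union> Q)\<bar> \<le> sinh (\<alpha>\<^sup>2 * (card Q * (1 / sqrt N))) ^ card P"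
    and "\<bar>quad_avg \<alpha> (P \<union> Q)\<bar> \<le> sinh (\<alpha>\<^sup>2 * (card P * (1 / sqrt N))) ^ card Q"
proof -
  have fin: "finite P" "finite Q" using assms finite_subset by blast+
  have disj: "P \<inter> Q = {}" "Q \<inter> P = {}" using assms by fastforce+
  define C where "C i j = (\<Sum>a<N. \<xi> i a * \<xi> j a)" for i j
  have C: "C i j = cov i j" if "i < 2 * N" "j < 2 * N" for i j using that by (simp add: C_def cov_\<xi>)
  have PP: "C i j = of_bool (i = j)" if "i \<in> P" "j \<in> P" for i j
  proof -
    have "i < N" "j < N" using that assms by auto
    then show ?thesis by (simp add: C cov_def)
  qed
  have QQ: "C i j = of_bool (i = j)" if "i \<in> Q" "j \<in> Q" for i j
  proof -
    have "\<not> i < N" "\<not> j < N" "i < 2 * N" "j < 2 * N" using that assms by auto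
    then show ?thesis by (simp add: C cov_def)
  qed
  have PQ: "\<bar>C i j\<bar> \<le> 1 / sqrt N" "\<bar>C j i\<bar> \<le> 1 / sqrt N" if "i \<in> P" "j \<in> Q" for i j
  proof -
    have "i < N" "\<not> j < N" "j < 2 * N" using that assms by auto
    then show "\<bar>C i j\<bar> \<le> 1 / sqrt N" "\<bar>C j i\<bar> \<le> 1 / sqrt N"
      using H_abs[of i "j - N"] by (simp_all add: C cov_def)
  qed
  show "\<bar>quad_avg \<alpha> (P \<union> Q)\<bar> \<le> sinh (\<alpha>\<^sup>2 * (card Q * (1 / sqrt N))) ^ card P"
    unfolding quad_avg_def by (rule cube_avg_gauss_le_sinh[OF fin disj(1) C_def PP QQ PQ(1)])
  show "\<bar>quad_avg \<alpha> (P \<union> Q)\<bar> \<le> sinh (\<alpha>\<^sup>2 * (card P * (1 / sqrt N))) ^ card Q"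
    unfolding quad_avg_def Un_commute[of P Q]
    by (rule cube_avg_gauss_le_sinh[OF fin(2,1) disj(2) C_def QQ PP PQ(2)])
qed

text \<open>The larger of the two parts of \<open>T\<close> supplies the exponent, which is then at
  least card T / 2. The smaller part has size at most card T / 2, and this absorbs the 2 of sinh u
  \<le> 2 u. Squaring brings the exponent up to card T for odd sizes too.\<close>

lemma mom_sq_le_low:
  assumes T: "T \<subseteq> {..<2 * N}" "T \<noteq> {}" and \<beta>: "\<alpha>\<^sup>2 / sqrt N * card T \<le> 1"
  shows "(mom \<alpha> T)\<^sup>2 \<le> (\<alpha>\<^sup>2 / sqrt N * card T) ^ card T"
proof -
  define P Q where "P = T \<inter> {..<N}" and "Q = T \<inter> {N..<2 * N}"
  have fin: "finite T" "finite P" "finite Q" using T finite_subset unfolding P_def Q_def by blast+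
  have PQ: "T = P \<union> Q" "P \<inter> Q = {}" using T unfolding P_def Q_def by auto
  have card: "card T = card P + card Q" unfolding PQ(1) by (rule card_Un_disjoint) (use fin PQ in auto)
  have sub: "P \<subseteq> {..<N}" "Q \<subseteq> {N..<2 * N}" unfolding P_def Q_def by auto
  note le = abs_quad_avg_le[OF sub, of \<alpha>, folded PQ(1), folded abs_mom[OF fin(1)]]
  have key: "\<bar>mom \<alpha> T\<bar> \<le> (\<alpha>\<^sup>2 / sqrt N * card T) ^ p"
    if "\<bar>mom \<alpha> T\<bar> \<le> sinh (\<alpha>\<^sup>2 * (q * (1 / sqrt N))) ^ p" "p + q = card T" "q \<le> p" for p q :: nat
  proof -
    have eq: "\<alpha>\<^sup>2 * (q * (1 / sqrt N)) = \<alpha>\<^sup>2 / sqrt N * q" by simp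
    have le: "2 * (\<alpha>\<^sup>2 / sqrt N * q) \<le> \<alpha>\<^sup>2 / sqrt N * card T"
    proof -
      have "2 * real q \<le> card T" using that by linarith
      then have "\<alpha>\<^sup>2 / sqrt N * (2 * q) \<le> \<alpha>\<^sup>2 / sqrt N * card T" by (intro mult_left_mono) auto
      then show ?thesis by (simp add: mult_ac)
    qed
    have "sinh (\<alpha>\<^sup>2 * (q * (1 / sqrt N))) \<le> 2 * (\<alpha>\<^sup>2 / sqrt N * q)"
      unfolding eq by (rule sinh_le_double) (use le \<beta> in auto)
    then have "sinh (\<alpha>\<^sup>2 * (q * (1 / sqrt N))) ^ p \<le> (\<alpha>\<^sup>2 / sqrt N * card T) ^ p"
      using le by (intro power_mono) auto
    then show ?thesis using that by linarith
  qed
  have "\<exists>p. card T \<le> 2 * p \<and> \<bar>mom \<alpha> T\<bar> \<le> (\<alpha>\<^sup>2 / sqrt N * card T) ^ p"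
  proof (cases "card Q \<le> card P")
    case True
    have "\<bar>mom \<alpha> T\<bar> \<le> (\<alpha>\<^sup>2 / sqrt N * card T) ^ card P"
      by (rule key[where q = "card Q"]) (use True card le(1) in auto)
    then show ?thesis using True card by (intro exI[of _ "card P"]) auto
  next
    case False
    have "\<bar>mom \<alpha> T\<bar> \<le> (\<alpha>\<^sup>2 / sqrt N * card T) ^ card Q"
      by (rule key[where q = "card P"]) (use False card le(2) in auto)
    then show ?thesis using False card by (intro exI[of _ "card Q"]) auto
  qed
  then obtain p where p: "card T \<le> 2 * p" "\<bar>mom \<alpha> T\<bar> \<le> (\<alpha>\<^sup>2 / sqrt N * card T) ^ p" by blast
  have "(mom \<alpha> T)\<^sup>2 \<le> ((\<alpha>\<^sup>2 / sqrt N * card T) ^ p)\<^sup>2"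
    using power_mono[OF p(2), of 2] by simp
  also have "\<dots> = (\<alpha>\<^sup>2 / sqrt N * card T) ^ (2 * p)" by (simp add: power_mult[symmetric] mult.commute)
  also have "\<dots> \<le> (\<alpha>\<^sup>2 / sqrt N * card T) ^ card T"
    using p(1) \<beta> by (intro power_decreasing) auto
  finally show ?thesis .
qed

text \<open>Either half of the Gaussians is an independent family, which gives one bound with
  exponent card P and one with card Q; their product bounds the square. Unlike in the preceding
  bound, the base does not grow with \<open>T\<close>.\<close>

lemma mom_sq_le_high:
  assumes T: "T \<subseteq> {..<2 * N}" and \<alpha>: "0 \<le> \<alpha>" "\<alpha> \<le> 1"
  shows "(mom \<alpha> T)\<^sup>2 \<le> \<alpha> ^ card T"
proof -
  define P Q where "P = T \<inter> {..<N}" and "Q = T \<inter> {N..<2 * N}"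
  have fin: "finite T" "finite P" "finite Q" using T finite_subset unfolding P_def Q_def by blast+
  have PQ: "T = P \<union> Q" "P \<inter> Q = {}" using T unfolding P_def Q_def by auto
  have card: "card T = card P + card Q" unfolding PQ(1) by (rule card_Un_disjoint) (use fin PQ in auto)
  have 1: "\<bar>mom \<alpha> T\<bar> \<le> \<alpha> ^ card P"
    unfolding mom_def by (rule integral_gauss_prod_sin_le[where f = id]) (use fin \<alpha> in \<open>auto simp: P_def \<xi>_def\<close>)
  have 2: "\<bar>mom \<alpha> T\<bar> \<le> \<alpha> ^ card Q"
    unfolding abs_mom_swap[OF T]
    by (rule integral_gauss_prod_sin_le[where f = "\<lambda>i. i - N"]) (use fin \<alpha> in \<open>auto simp: Q_def \<xi>'_def inj_on_def\<close>)
  have "\<bar>mom \<alpha> T\<bar> * \<bar>mom \<alpha> T\<bar> \<le> \<alpha> ^ card P * \<alpha> ^ card Q"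
    using 1 2 \<alpha> by (intro mult_mono) auto
  then show ?thesis by (simp add: card power_add power2_eq_square)
qed

section \<open>Mean and variance of Forrelation\<close>

lemma mom_pair:
  assumes "a < N" "b < N"
  shows "mom \<alpha> {a, N + b} = exp (- \<alpha>\<^sup>2) * sinh (\<alpha>\<^sup>2 * H a b)"
proof -
  have "complex_of_real (mom \<alpha> {a, N + b}) = complex_of_real (- quad_avg \<alpha> {a, N + b})"
    using assms by (simp add: mom_eq_quad_avg)
  then have "mom \<alpha> {a, N + b} = - quad_avg \<alpha> ({a} \<union> {N + b})"
    by (metis of_real_eq_iff insert_is_Un)
  also have "\<dots> = exp (- \<alpha>\<^sup>2) * sinh (\<alpha>\<^sup>2 * H a b)"
    using assms by (subst quad_avg_eq) (auto simp: cube_avg_insert)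
  finally show ?thesis .
qed

text \<open>The two signs on the columns are equal or opposite, which gives the two products of
  hyperbolic sines; the prefactor (-i)^4 is 1.\<close>

lemma mom_quadruple:
  assumes "a < N" "b < N" "a' < N" "b' < N" "a \<noteq> a'" "b \<noteq> b'"
  shows "mom \<alpha> {a, a', N + b, N + b'} = exp (- 2 * \<alpha>\<^sup>2) *
    ((sinh (\<alpha>\<^sup>2 * (H a b + H a b')) * sinh (\<alpha>\<^sup>2 * (H a' b + H a' b')) -
      sinh (\<alpha>\<^sup>2 * (H a b - H a b')) * sinh (\<alpha>\<^sup>2 * (H a' b - H a' b'))) / 2)"
proof -
  have "card {a, a', N + b, N + b'} = 4" using assms by auto
  then have "complex_of_real (mom \<alpha> {a, a', N + b, N + b'}) = complex_of_real (quad_avg \<alpha> {a, a', N + b, N + b'})"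
    by (simp add: mom_eq_quad_avg)
  moreover have "{a, a', N + b, N + b'} = {a, a'} \<union> {N + b, N + b'}" by blast
  ultimately have "mom \<alpha> {a, a', N + b, N + b'} = quad_avg \<alpha> ({a, a'} \<union> {N + b, N + b'})"
    by (metis of_real_eq_iff)
  also have "quad_avg \<alpha> ({a, a'} \<union> {N + b, N + b'}) = exp (- 2 * \<alpha>\<^sup>2) *
    ((sinh (\<alpha>\<^sup>2 * (H a b + H a b')) * sinh (\<alpha>\<^sup>2 * (H a' b + H a' b')) -
      sinh (\<alpha>\<^sup>2 * (H a b - H a b')) * sinh (\<alpha>\<^sup>2 * (H a' b - H a' b'))) / 2)"
  proof -
    have m: "sinh (\<alpha>\<^sup>2 * (- y - x)) = - sinh (\<alpha>\<^sup>2 * (x + y))" "sinh (\<alpha>\<^sup>2 * (y - x)) = - sinh (\<alpha>\<^sup>2 * (x - y))" for x y :: real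
      by (simp_all add: algebra_simps flip: sinh_minus)
    show ?thesis
      using assms
      by (subst quad_avg_eq) (simp_all add: cube_avg_insert m(1) m(2)[of "H a b'" "H a b"] m(2)[of "H a' b'" "H a' b"])
  qed
  finally show ?thesis .
qed

text \<open>Coordinates in the same half are uncorrelated, so the bound with an empty opposite part
  is a power of sinh 0.\<close>

lemma mom_same_side:
  assumes "i < N \<and> j < N \<or> N \<le> i \<and> i < 2 * N \<and> N \<le> j \<and> j < 2 * N" "i \<noteq> j"
  shows "mom \<alpha> {i, j} = 0"
  using assms(1)
proof
  assume "i < N \<and> j < N"
  then have "\<bar>quad_avg \<alpha> ({i, j} \<union> {})\<bar> \<le> 0"
    using abs_quad_avg_le(1)[of "{i, j}" "{}" \<alpha>] assms(2) by simp
  then show ?thesis using abs_mom[of "{i, j}" \<alpha>] by simp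
next
  assume "N \<le> i \<and> i < 2 * N \<and> N \<le> j \<and> j < 2 * N"
  then have "\<bar>quad_avg \<alpha> ({} \<union> {i, j})\<bar> \<le> 0"
    using abs_quad_avg_le(2)[of "{}" "{i, j}" \<alpha>] assms(2) by simp
  then show ?thesis using abs_mom[of "{i, j}" \<alpha>] by simp
qed

lemma sum_dens: "(\<Sum>w\<in>\<Omega>. dens \<alpha> w) = 1"
  using dens_fourier[of "{}" \<alpha>] by simp

text \<open>The hyperbolic sine is odd, so the sign of the entry cancels and every pair of indices
  contributes equally to the mean.\<close>

lemma sinh_H: "a < N \<Longrightarrow> b < N \<Longrightarrow> H a b * sinh (\<alpha>\<^sup>2 * H a b) = sinh (\<alpha>\<^sup>2 / sqrt N) / sqrt N"
proof -
  assume "a < N" "b < N"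
  then have "H a b = 1 / sqrt N \<or> H a b = - (1 / sqrt N)" using H_abs[of a b] by linarith
  then show ?thesis by (elim disjE) simp_all
qed

lemma mean_forrel:
  "(\<Sum>w\<in>\<Omega>. dens \<alpha> w * forrel w) = sqrt N * exp (- \<alpha>\<^sup>2) * sinh (\<alpha>\<^sup>2 / sqrt N)"
proof -
  have "(\<Sum>w\<in>\<Omega>. dens \<alpha> w * forrel w) =
      (\<Sum>w\<in>\<Omega>. \<Sum>a<N. \<Sum>b<N. H a b * (dens \<alpha> w * (w a * w (N + b))) / N)"
    unfolding forrel_def sum_divide_distrib sum_distrib_left by (simp add: mult_ac)
  also have "\<dots> = (\<Sum>a<N. \<Sum>b<N. \<Sum>w\<in>\<Omega>. H a b * (dens \<alpha> w * (w a * w (N + b))) / N)"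
    by (subst sum.swap, intro sum.cong refl sum.swap)
  also have "\<dots> = (\<Sum>a<N. \<Sum>b<N. exp (- \<alpha>\<^sup>2) * (sinh (\<alpha>\<^sup>2 / sqrt N) / sqrt N) / N)"
  proof (intro sum.cong refl)
    fix a b assume ab: "a \<in> {..<N}" "b \<in> {..<N}"
    have "(\<Sum>w\<in>\<Omega>. H a b * (dens \<alpha> w * (w a * w (N + b))) / N) =
        H a b * (\<Sum>w\<in>\<Omega>. dens \<alpha> w * (\<Prod>i\<in>{a, N + b}. w i)) / N"
      using ab by (simp add: sum_distrib_left sum_divide_distrib)
    also have "\<dots> = H a b * (exp (- \<alpha>\<^sup>2) * sinh (\<alpha>\<^sup>2 * H a b)) / N"
      using ab by (subst dens_fourier) (auto simp: mom_pair)
    also have "\<dots> = exp (- \<alpha>\<^sup>2) * (H a b * sinh (\<alpha>\<^sup>2 * H a b)) / N" by (simp only: mult_ac)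
    finally show "(\<Sum>w\<in>\<Omega>. H a b * (dens \<alpha> w * (w a * w (N + b))) / N) =
        exp (- \<alpha>\<^sup>2) * (sinh (\<alpha>\<^sup>2 / sqrt N) / sqrt N) / N"
      using ab by (simp add: sinh_H)
  qed
  also have "\<dots> = (real N / sqrt N) * exp (- \<alpha>\<^sup>2) * sinh (\<alpha>\<^sup>2 / sqrt N)"
    using N by simp
  also have "real N / sqrt N = sqrt N" using N by (simp add: real_div_sqrt)
  finally show ?thesis .
qed

text \<open>One formula has to dominate all coincidence patterns of the indices. The product of the
  four entries is kept, rather than bounded in modulus: bounding it would double the leading term of
  the second moment and spoil its cancellation against the squared mean.\<close>

lemma H_H_moment_le:
  fixes \<alpha> :: real
  defines "\<kappa> \<equiv> exp (- 2 * \<alpha>\<^sup>2) * ((sinh (2 * (\<alpha>\<^sup>2 / sqrt N)))\<^sup>2 / 4)"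
  assumes ab: "a < N" "b < N" "a' < N" "b' < N"
  shows "H a b * H a' b' * (\<Sum>w\<in>\<Omega>. dens \<alpha> w * (w a * w (N + b) * (w a' * w (N + b')))) \<le>
    of_bool (a = a' \<and> b = b') / N + \<kappa> * (1 / N + N * (H a b * H a' b * (H a b' * H a' b')))"
proof -
  let ?M = "\<Sum>w\<in>\<Omega>. dens \<alpha> w * (w a * w (N + b) * (w a' * w (N + b')))"
  define h where "h = 1 / sqrt N"
  have h2: "h\<^sup>2 = 1 / N" unfolding h_def by (simp add: power_divide)
  have "\<exists>s. (s = 1 \<or> s = - 1) \<and> H i j = s * h" if "i < N" "j < N" for i j
    using H_abs[OF that] unfolding h_def[symmetric] by (cases "H i j \<ge> 0") (auto intro: exI[of _ 1] exI[of _ "- 1"])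
  then obtain s1 s2 s3 s4 where s: "s1 = 1 \<or> s1 = - 1" "s2 = 1 \<or> s2 = - 1" "s3 = 1 \<or> s3 = - 1" "s4 = 1 \<or> s4 = - 1"
    and H: "H a b = s1 * h" "H a b' = s2 * h" "H a' b = s3 * h" "H a' b' = s4 * h"
    using ab by metis
  have Nh: "N * (h\<^sup>2 * h\<^sup>2) = h\<^sup>2" using N by (simp add: h2)
  have "1 / N + N * (H a b * H a' b * (H a b' * H a' b')) = h\<^sup>2 + N * (h\<^sup>2 * h\<^sup>2) * (s1 * s2 * (s3 * s4))"
    unfolding H h2[symmetric] by (simp add: power2_eq_square mult_ac)
  then have \<phi>: "1 / N + N * (H a b * H a' b * (H a b' * H a' b')) = h\<^sup>2 + h\<^sup>2 * (s1 * s2 * (s3 * s4))"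
    unfolding Nh .
  have \<phi>0: "h\<^sup>2 + h\<^sup>2 * (s1 * s2 * (s3 * s4)) \<ge> 0" using s by auto
  have \<kappa>0: "\<kappa> \<ge> 0" unfolding \<kappa>_def by simp
  have sq1: "w i * w i = 1" if "w \<in> \<Omega>" "i < 2 * N" for w i
    using cube_val[OF that(1), of i] that(2) by auto
  consider "a = a'" "b = b'" | "a = a'" "b \<noteq> b'" | "a \<noteq> a'" "b = b'" | "a \<noteq> a'" "b \<noteq> b'" by blast
  then show ?thesis
  proof cases
    case 1
    have "?M = (\<Sum>w\<in>\<Omega>. dens \<alpha> w * ((w a * w a) * (w (N + b) * w (N + b))))"
      using 1 by (simp add: mult_ac)
    also have "\<dots> = (\<Sum>w\<in>\<Omega>. dens \<alpha> w)"
      using ab by (intro sum.cong refl) (simp add: sq1)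
    finally have "?M = 1" by (simp add: sum_dens)
    moreover have "H a b * H a' b' = 1 / N" using 1 H s(1) h2 by (auto simp: power2_eq_square)
    ultimately show ?thesis using 1 \<phi> \<phi>0 \<kappa>0 by simp
  next
    case 2
    have "?M = (\<Sum>w\<in>\<Omega>. dens \<alpha> w * ((w a * w a) * (w (N + b) * w (N + b'))))"
      using 2 by (simp add: mult_ac)
    also have "\<dots> = (\<Sum>w\<in>\<Omega>. dens \<alpha> w * (\<Prod>i\<in>{N + b, N + b'}. w i))"
      using ab 2 by (intro sum.cong refl) (simp add: sq1)
    also have "\<dots> = 0" using ab 2 by (subst dens_fourier) (auto intro!: mom_same_side)
    finally show ?thesis using 2 \<phi> \<phi>0 \<kappa>0 by simp
  next
    case 3
    have "?M = (\<Sum>w\<in>\<Omega>. dens \<alpha> w * ((w a * w a') * (w (N + b) * w (N + b))))"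
      using 3 by (simp add: mult_ac)
    also have "\<dots> = (\<Sum>w\<in>\<Omega>. dens \<alpha> w * (\<Prod>i\<in>{a, a'}. w i))"
      using ab 3 by (intro sum.cong refl) (simp add: sq1)
    also have "\<dots> = 0" using ab 3 by (subst dens_fourier) (auto intro!: mom_same_side)
    finally show ?thesis using 3 \<phi> \<phi>0 \<kappa>0 by simp
  next
    case 4
    have "?M = (\<Sum>w\<in>\<Omega>. dens \<alpha> w * (\<Prod>i\<in>{a, a', N + b, N + b'}. w i))"
      using ab 4 by (intro sum.cong refl) (simp add: mult_ac)
    also have "\<dots> = mom \<alpha> {a, a', N + b, N + b'}"
      using ab by (subst dens_fourier) auto
    finally have "H a b * H a' b' * ?M = exp (- 2 * \<alpha>\<^sup>2) * ((s1 * h) * (s4 * h) *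
        ((sinh (\<alpha>\<^sup>2 * (s1 * h + s2 * h)) * sinh (\<alpha>\<^sup>2 * (s3 * h + s4 * h)) -
      sinh (\<alpha>\<^sup>2 * (s1 * h - s2 * h)) * sinh (\<alpha>\<^sup>2 * (s3 * h - s4 * h))) / 2))"
      unfolding mom_quadruple[OF ab 4] H by (simp only: mult_ac)
    also have "\<dots> = \<kappa> * (h\<^sup>2 + h\<^sup>2 * (s1 * s2 * (s3 * s4)))"
      unfolding sinh_sign_identity[OF s] \<kappa>_def h_def by simp
    finally show ?thesis unfolding \<phi> using 4 by simp
  qed
qed

lemma row_orth:
  assumes "a < N" "a' < N"
  shows "(\<Sum>b<N. H a b * H a' b) = of_bool (a = a')"
proof -
  have "(\<Sum>b<N. H a b * H a' b) = (\<Sum>b<N. H b a * H b a')"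
    using assms sym by (intro sum.cong refl) auto
  then show ?thesis using orth[OF assms] by simp
qed

lemma second_moment_forrel:
  "(\<Sum>w\<in>\<Omega>. dens \<alpha> w * (forrel w)\<^sup>2) \<le>
    1 / N + exp (- 2 * \<alpha>\<^sup>2) * ((sinh (2 * (\<alpha>\<^sup>2 / sqrt N)))\<^sup>2 / 4) * (N + 1)"
proof -
  define \<kappa> where "\<kappa> = exp (- 2 * \<alpha>\<^sup>2) * ((sinh (2 * (\<alpha>\<^sup>2 / sqrt N)))\<^sup>2 / 4)"
  let ?M = "\<lambda>a b a' b'. \<Sum>w\<in>\<Omega>. dens \<alpha> w * (w a * w (N + b) * (w a' * w (N + b')))"
  have "(forrel w)\<^sup>2 = (\<Sum>a<N. \<Sum>b<N. \<Sum>a'<N. \<Sum>b'<N. H a b * H a' b' * (w a * w (N + b) * (w a' * w (N + b')))) / N\<^sup>2" for w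
  proof -
    have "(forrel w)\<^sup>2 = (\<Sum>a<N. \<Sum>b<N. H a b * w a * w (N + b)) * (\<Sum>a'<N. \<Sum>b'<N. H a' b' * w a' * w (N + b')) / N\<^sup>2"
      unfolding forrel_def power_divide power2_eq_square[of "sum _ _"] by simp
    also have "\<dots> = (\<Sum>a<N. \<Sum>b<N. \<Sum>a'<N. \<Sum>b'<N. (H a b * w a * w (N + b)) * (H a' b' * w a' * w (N + b'))) / N\<^sup>2"
      unfolding sum_distrib_right unfolding sum_distrib_left ..
    finally show ?thesis by (simp only: mult_ac)
  qed
  then have "(\<Sum>w\<in>\<Omega>. dens \<alpha> w * (forrel w)\<^sup>2) =
      (\<Sum>w\<in>\<Omega>. \<Sum>a<N. \<Sum>b<N. \<Sum>a'<N. \<Sum>b'<N. H a b * H a' b' * (dens \<alpha> w * (w a * w (N + b) * (w a' * w (N + b'))))) / N\<^sup>2"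
    by (simp add: sum_distrib_left sum_divide_distrib mult_ac)
  also have "(\<Sum>w\<in>\<Omega>. \<Sum>a<N. \<Sum>b<N. \<Sum>a'<N. \<Sum>b'<N. H a b * H a' b' * (dens \<alpha> w * (w a * w (N + b) * (w a' * w (N + b'))))) =
      (\<Sum>a<N. \<Sum>b<N. \<Sum>a'<N. \<Sum>b'<N. H a b * H a' b' * ?M a b a' b')"
    unfolding sum_distrib_left
    by (subst sum.swap, rule sum.cong[OF refl], subst sum.swap, rule sum.cong[OF refl],
        subst sum.swap, rule sum.cong[OF refl], rule sum.swap)
  also have "\<dots> / N\<^sup>2 \<le> (\<Sum>a<N. \<Sum>b<N. \<Sum>a'<N. \<Sum>b'<N. of_bool (a = a' \<and> b = b') / N + \<kappa> * (1 / N + N * (H a b * H a' b * (H a b' * H a' b')))) / N\<^sup>2"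
    unfolding \<kappa>_def by (intro divide_right_mono sum_mono H_H_moment_le) auto
  also have "(\<Sum>a<N. \<Sum>b<N. \<Sum>a'<N. \<Sum>b'<N. of_bool (a = a' \<and> b = b') / N + \<kappa> * (1 / N + N * (H a b * H a' b * (H a b' * H a' b')))) =
      N + \<kappa> * (real N ^ 3 + real N ^ 2)"
  proof -
    have diag: "(\<Sum>a<N. \<Sum>b<N. \<Sum>a'<N. \<Sum>b'<N. of_bool (a = a' \<and> b = b') / real N) = N"
    proof -
      have "(\<Sum>a'<N. \<Sum>b'<N. of_bool (a = a' \<and> b = b') / real N) = 1 / N" if "a < N" "b < N" for a b
      proof -
        have "(\<Sum>b'<N. of_bool (a = a' \<and> b = b') / real N) = (if a = a' then 1 / N else 0)" for a'
          using that by (simp add: of_bool_def if_distrib[of "\<lambda>x. x / _"] cong: if_cong)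
        then show ?thesis using that by simp
      qed
      then show ?thesis using N by simp
    qed
    \<comment> \<open>Summing over \<open>b\<close> and \<open>b'\<close> yields two orthogonality
      relations. Over all \<open>a\<close> together this brings the sum down from its trivial bound
      N^2 to N.\<close>
    have "(\<Sum>b<N. \<Sum>a'<N. \<Sum>b'<N. H a b * H a' b * (H a b' * H a' b')) = 1" if "a < N" for a
    proof -
      have "(\<Sum>b<N. \<Sum>a'<N. \<Sum>b'<N. H a b * H a' b * (H a b' * H a' b')) =
          (\<Sum>a'<N. \<Sum>b<N. \<Sum>b'<N. H a b * H a' b * (H a b' * H a' b'))"
        by (rule sum.swap)
      also have "\<dots> = (\<Sum>a'<N. (\<Sum>b<N. H a b * H a' b) * (\<Sum>b'<N. H a b' * H a' b'))"
        by (simp only: sum_product)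
      also have "\<dots> = (\<Sum>a'<N. if a = a' then 1 else 0)"
        using that by (intro sum.cong refl) (simp add: row_orth)
      finally show ?thesis using that by simp
    qed
    then have quart: "(\<Sum>a<N. \<Sum>b<N. \<Sum>a'<N. \<Sum>b'<N. H a b * H a' b * (H a b' * H a' b')) = N"
      by simp
    have "(\<Sum>a<N. \<Sum>b<N. \<Sum>a'<N. \<Sum>b'<N. of_bool (a = a' \<and> b = b') / N + \<kappa> * (1 / N + N * (H a b * H a' b * (H a b' * H a' b')))) =
       (\<Sum>a<N. \<Sum>b<N. \<Sum>a'<N. \<Sum>b'<N. of_bool (a = a' \<and> b = b') / real N) +
       \<kappa> * ((\<Sum>a<N. \<Sum>b<N. \<Sum>a'<N. \<Sum>b'<N. 1 / real N) + N * (\<Sum>a<N. \<Sum>b<N. \<Sum>a'<N. \<Sum>b'<N. H a b * H a' b * (H a b' * H a' b')))"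
      by (simp only: distrib_left sum.distrib sum_distrib_left)
    also have "\<dots> = N + \<kappa> * (real N ^ 3 + real N ^ 2)"
      unfolding diag quart using N by (simp add: power2_eq_square power3_eq_cube)
    finally show ?thesis .
  qed
  also have "(N + \<kappa> * (real N ^ 3 + real N ^ 2)) / N\<^sup>2 = 1 / N + \<kappa> * (N + 1)"
    using N by (simp add: field_simps power2_eq_square power3_eq_cube)
  finally show ?thesis unfolding \<kappa>_def by simp
qed

text \<open>By sinh(2 \<beta>)^2 / 4 = sinh(\<beta>)^2 (1 + sinh(\<beta>)^2), the main part of the
  second moment is exactly m^2. What remains is 1/N plus terms of order \<alpha>^4 / N.\<close>

lemma variance_forrel:
  assumes "0 \<le> \<alpha>" "\<alpha> \<le> 1 / 2"
  defines "m \<equiv> sqrt N * exp (- \<alpha>\<^sup>2) * sinh (\<alpha>\<^sup>2 / sqrt N)"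
  shows "(\<Sum>w\<in>\<Omega>. dens \<alpha> w * (forrel w - m)\<^sup>2) \<le> 2 / N"
proof -
  define \<beta> where "\<beta> = \<alpha>\<^sup>2 / sqrt N"
  have N1: "real N \<ge> 1" using N by simp
  have a2: "\<alpha>\<^sup>2 \<le> 1 / 4" using power_mono[of \<alpha> "1 / 2" 2] assms by (simp add: power_divide)
  have a4: "(\<alpha>\<^sup>2)\<^sup>2 \<le> 1 / 16" using power_mono[OF a2, of 2] by (simp add: power_divide)
  have \<beta>2: "\<beta>\<^sup>2 = (\<alpha>\<^sup>2)\<^sup>2 / N" unfolding \<beta>_def power_divide by simp
  have "\<beta> \<le> \<alpha>\<^sup>2" unfolding \<beta>_def using N1 by (intro divide_le_eq[THEN iffD2]) (auto simp: mult_left_le mult_le_cancel_left1)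
  then have \<beta>: "0 \<le> \<beta>" "\<beta> \<le> 1" using a2 unfolding \<beta>_def by auto
  have s2: "(sinh \<beta>)\<^sup>2 \<le> 4 * (\<alpha>\<^sup>2)\<^sup>2 / N"
    using power_mono[OF sinh_le_double[OF \<beta>], of 2] \<beta> \<beta>2 by (simp add: power_mult_distrib)
  have m2: "m\<^sup>2 = N * (exp (- 2 * \<alpha>\<^sup>2) * (sinh \<beta>)\<^sup>2)"
    unfolding m_def \<beta>_def[symmetric] by (simp add: power_mult_distrib flip: exp_double)
  have \<kappa>: "(sinh (2 * \<beta>))\<^sup>2 / 4 = (sinh \<beta>)\<^sup>2 * (1 + (sinh \<beta>)\<^sup>2)"
    by (simp add: sinh_double power_mult_distrib cosh_square_eq)
  have "(\<Sum>w\<in>\<Omega>. dens \<alpha> w * (forrel w - m)\<^sup>2) =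
      (\<Sum>w\<in>\<Omega>. dens \<alpha> w * (forrel w)\<^sup>2) - 2 * m * (\<Sum>w\<in>\<Omega>. dens \<alpha> w * forrel w)
      + m\<^sup>2 * (\<Sum>w\<in>\<Omega>. dens \<alpha> w)"
    unfolding sum_distrib_left sum_subtractf[symmetric] sum.distrib[symmetric]
    by (intro sum.cong refl) (simp add: power2_eq_square algebra_simps)
  also have "\<dots> = (\<Sum>w\<in>\<Omega>. dens \<alpha> w * (forrel w)\<^sup>2) - m\<^sup>2"
    unfolding sum_dens mean_forrel m_def[symmetric] by (simp add: power2_eq_square)
  also have "\<dots> \<le> 1 / N + exp (- 2 * \<alpha>\<^sup>2) * ((sinh (2 * \<beta>))\<^sup>2 / 4) * (N + 1) - m\<^sup>2"
    using second_moment_forrel[of \<alpha>] unfolding \<beta>_def by simp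
  also have "\<dots> = 1 / N + exp (- 2 * \<alpha>\<^sup>2) * ((sinh \<beta>)\<^sup>2 * (N * (sinh \<beta>)\<^sup>2 + (1 + (sinh \<beta>)\<^sup>2)))"
    unfolding \<kappa> m2 by (simp add: algebra_simps)
  also have "\<dots> \<le> 1 / N + 1 * ((4 * (\<alpha>\<^sup>2)\<^sup>2 / N) * (4 * (\<alpha>\<^sup>2)\<^sup>2 + (1 + 4 * (\<alpha>\<^sup>2)\<^sup>2)))"
  proof -
    have 1: "N * (sinh \<beta>)\<^sup>2 \<le> 4 * (\<alpha>\<^sup>2)\<^sup>2" using s2 N by (simp add: field_simps)
    have "4 * (\<alpha>\<^sup>2)\<^sup>2 / N \<le> 4 * (\<alpha>\<^sup>2)\<^sup>2 / 1" using N1 by (intro divide_left_mono) auto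
    then have 2: "(sinh \<beta>)\<^sup>2 \<le> 4 * (\<alpha>\<^sup>2)\<^sup>2" using s2 by simp
    have "(sinh \<beta>)\<^sup>2 * (N * (sinh \<beta>)\<^sup>2 + (1 + (sinh \<beta>)\<^sup>2)) \<le> (4 * (\<alpha>\<^sup>2)\<^sup>2 / N) * (4 * (\<alpha>\<^sup>2)\<^sup>2 + (1 + 4 * (\<alpha>\<^sup>2)\<^sup>2))"
      using 1 2 by (intro mult_mono[OF s2]) auto
    then show ?thesis by (intro add_left_mono mult_mono[OF _ \<open>(sinh \<beta>)\<^sup>2 * _ \<le> _\<close>]) auto
  qed
  also have "\<dots> = (1 + 4 * (\<alpha>\<^sup>2)\<^sup>2 * (1 + 8 * (\<alpha>\<^sup>2)\<^sup>2)) / N"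
    by (simp add: add_divide_distrib algebra_simps)
  also have "\<dots> \<le> (1 + 4 * (1 / 16) * (1 + 8 * (1 / 16))) / N"
    using a4 by (intro divide_right_mono add_left_mono mult_mono) auto
  also have "\<dots> \<le> 2 / N" by (intro divide_right_mono) auto
  finally show ?thesis .
qed

text \<open>Chebyshev's inequality. At \<alpha> = 0 the mean is 0, so uniform signs are covered as
  well.\<close>

lemma dens_tail:
  fixes \<delta> :: real
  assumes "0 \<le> \<alpha>" "\<alpha> \<le> 1 / 2" "\<delta> > 0"
    and B: "B \<subseteq> \<Omega>" "\<And>w. w \<in> B \<Longrightarrow> \<bar>forrel w - sqrt N * exp (- \<alpha>\<^sup>2) * sinh (\<alpha>\<^sup>2 / sqrt N)\<bar> \<ge> \<delta>"
  shows "(\<Sum>w\<in>B. dens \<alpha> w) \<le> 2 / (N * \<delta>\<^sup>2)"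
proof -
  define m where "m = sqrt N * exp (- \<alpha>\<^sup>2) * sinh (\<alpha>\<^sup>2 / sqrt N)"
  have "\<delta>\<^sup>2 * (\<Sum>w\<in>B. dens \<alpha> w) = (\<Sum>w\<in>B. dens \<alpha> w * \<delta>\<^sup>2)" by (simp add: sum_distrib_left mult_ac)
  also have "\<dots> \<le> (\<Sum>w\<in>B. dens \<alpha> w * (forrel w - m)\<^sup>2)"
  proof (intro sum_mono mult_left_mono)
    fix w assume w: "w \<in> B"
    show "\<delta>\<^sup>2 \<le> (forrel w - m)\<^sup>2"
      using B(2)[OF w] assms(3) power_mono[of \<delta> "\<bar>forrel w - m\<bar>" 2] by (simp add: m_def)
    show "0 \<le> dens \<alpha> w" using w B dens_nonneg by blast
  qed
  also have "\<dots> \<le> (\<Sum>w\<in>\<Omega>. dens \<alpha> w * (forrel w - m)\<^sup>2)"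
    using B by (intro sum_mono2) (auto intro!: dens_nonneg mult_nonneg_nonneg)
  also have "\<dots> \<le> 2 / N" unfolding m_def using assms by (intro variance_forrel) auto
  finally show ?thesis using assms N by (simp add: field_simps)
qed

lemma mean_forrel_ge:
  assumes "0 \<le> \<alpha>" "\<alpha> \<le> 1 / 2"
  shows "\<alpha>\<^sup>2 / 2 \<le> sqrt N * exp (- \<alpha>\<^sup>2) * sinh (\<alpha>\<^sup>2 / sqrt N)"
proof -
  have a2: "\<alpha>\<^sup>2 \<le> 1 / 4" using power_mono[of \<alpha> "1 / 2" 2] assms by (simp add: power_divide)
  have "\<alpha>\<^sup>2 / 2 = (1 / 2) * (sqrt N * (\<alpha>\<^sup>2 / sqrt N))" using N by simp
  also have "\<dots> \<le> exp (- \<alpha>\<^sup>2) * (sqrt N * sinh (\<alpha>\<^sup>2 / sqrt N))"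
  proof (intro mult_mono sinh_ge_self)
    show "1 / 2 \<le> exp (- \<alpha>\<^sup>2)" using exp_ge_add_one_self[of "- \<alpha>\<^sup>2"] a2 by linarith
  qed auto
  finally show ?thesis by (simp add: mult_ac)
qed

lemma mom_singleton:
  assumes "i < 2 * N"
  shows "mom \<alpha> {i} = 0"
proof (cases "i < N")
  case True
  then have "\<bar>quad_avg \<alpha> ({i} \<union> {})\<bar> \<le> 0"
    using abs_quad_avg_le(1)[of "{i}" "{}" \<alpha>] by simp
  then show ?thesis using abs_mom[of "{i}" \<alpha>] by simp
next
  case False
  then have "\<bar>quad_avg \<alpha> ({} \<union> {i})\<bar> \<le> 0"
    using abs_quad_avg_le(2)[of "{}" "{i}" \<alpha>] assms by simp
  then show ?thesis using abs_mom[of "{i}" \<alpha>] by simp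
qed

lemma mom_0: "finite T \<Longrightarrow> mom 0 T = of_bool (T = {})"
  using mom_empty[of 0] by (cases "T = {}") (auto simp: mom_def prod_zero_iff)

end

section \<open>The Hadamard matrix\<close>

text \<open>Counterpart of \<open>sum_cube_prod\<close> for binary expansions; the induction splits
  off the top bit.\<close>

lemma sum_prod_bits:
  fixes f :: "nat \<Rightarrow> bool \<Rightarrow> real"
  shows "(\<Sum>a<2 ^ n. \<Prod>i<n. f i (bit (a::nat) i)) = (\<Prod>i<n. f i False + f i True)"
proof (induction n)
  case (Suc n)
  have low: "\<not> bit a n" if "a < 2 ^ n" for a :: nat
    using that by (simp add: bit_iff_odd)
  have high: "bit (2 ^ n + a) i \<longleftrightarrow> (if i = n then True else bit a i)" if "a < 2 ^ n" "i \<le> n" for a i :: nat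
  proof (cases "i = n")
    case True
    with that show ?thesis by (simp add: bit_iff_odd)
  next
    case False
    then have "(2 ^ n + a) div 2 ^ i = 2 ^ (n - i) + a div 2 ^ i"
      using that by (simp add: div_plus_div_distrib_dvd_left le_imp_power_dvd power_diff)
    then show ?thesis using False that by (simp add: bit_iff_odd)
  qed
  have "(\<Sum>a<2 ^ Suc n. \<Prod>i<Suc n. f i (bit (a::nat) i)) =
      (\<Sum>a<2 ^ n. \<Prod>i<Suc n. f i (bit (a::nat) i)) + (\<Sum>a<2 ^ n. \<Prod>i<Suc n. f i (bit (2 ^ n + a :: nat) i))"
  proof -
    have "{..<2 ^ Suc n :: nat} = {..<2 ^ n} \<union> {2 ^ n..<2 ^ n + 2 ^ n}" by auto
    moreover have "(\<Sum>a\<in>{2 ^ n..<2 ^ n + 2 ^ n :: nat}. g a) = (\<Sum>a<2 ^ n. g (2 ^ n + a))" for g :: "nat \<Rightarrow> real"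
      using sum.shift_bounds_nat_ivl[of g 0 "2 ^ n" "2 ^ n"] by (simp add: atLeast0LessThan add.commute)
    ultimately show ?thesis by (simp add: sum.union_disjoint[of "{..<2 ^ n}"] ivl_disj_int)
  qed
  also have "(\<Sum>a<2 ^ n. \<Prod>i<Suc n. f i (bit (a::nat) i)) = (\<Sum>a<2 ^ n. (\<Prod>i<n. f i (bit (a::nat) i)) * f n False)"
    using low by simp
  also have "(\<Sum>a<2 ^ n. \<Prod>i<Suc n. f i (bit (2 ^ n + a :: nat) i)) = (\<Sum>a<2 ^ n. (\<Prod>i<n. f i (bit (a::nat) i)) * f n True)"
    by (intro sum.cong refl) (simp add: high)
  finally show ?case by (simp add: Suc distrib_left flip: sum_distrib_right)
qed simp

lemma hadamard_entry:
  assumes "a < 2 ^ n" "b < 2 ^ n"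
  shows "hadamard n $$ (a, b) = (\<Prod>i<n. (- 1) ^ (of_bool (bit a i) * of_bool (bit b i))) / sqrt (2 ^ n)"
  unfolding hadamard_def using assms
  by (subst index_mat) (simp_all only: case_prod_conv power_sum)

text \<open>Two different indices below 2^n differ in some bit i < n, and the factor 1 + s i of that
  bit is 0.\<close>

lemma hadamard_orth:
  assumes "b < 2 ^ n" "b' < 2 ^ n"
  shows "(\<Sum>a<2 ^ n. hadamard n $$ (a, b) * hadamard n $$ (a, b')) = of_bool (b = b')"
proof -
  define s where "s i = ((- 1) ^ (of_bool (bit b i) + of_bool (bit b' i)) :: real)" for i
  have "hadamard n $$ (a, b) * hadamard n $$ (a, b') = (\<Prod>i<n. if bit a i then s i else 1) / 2 ^ n" if "a < 2 ^ n" for a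
  proof -
    have "hadamard n $$ (a, b) * hadamard n $$ (a, b') =
        (\<Prod>i<n. (- 1) ^ (of_bool (bit a i) * of_bool (bit b i)) * (- 1) ^ (of_bool (bit a i) * of_bool (bit b' i))) / 2 ^ n"
      using that assms by (simp add: hadamard_entry prod.distrib)
    also have "\<dots> = (\<Prod>i<n. if bit a i then s i else 1) / 2 ^ n"
      by (intro arg_cong2[where f = "(/)"] prod.cong refl) (simp add: s_def power_add)
    finally show ?thesis .
  qed
  then have "(\<Sum>a<2 ^ n. hadamard n $$ (a, b) * hadamard n $$ (a, b')) = (\<Sum>a<2 ^ n. \<Prod>i<n. if bit (a::nat) i then s i else 1) / 2 ^ n"
    by (simp add: sum_divide_distrib)
  also have "(\<Sum>a<2 ^ n. \<Prod>i<n. if bit (a::nat) i then s i else 1) = (\<Prod>i<n. 1 + s i)"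
    using sum_prod_bits[where f = "\<lambda>i c. if c then s i else 1"] by simp
  also have "(\<Prod>i<n. 1 + s i) / 2 ^ n = of_bool (b = b')"
  proof (cases "b = b'")
    case True
    then have "s i = 1" for i by (simp add: s_def)
    with True show ?thesis by simp
  next
    case False
    have hi: "\<not> bit c i" if "c < 2 ^ n" "n \<le> i" for c i :: nat
    proof -
      have "c < 2 ^ i" using that by (meson less_le_trans one_le_numeral power_increasing)
      then show ?thesis by (simp add: bit_iff_odd)
    qed
    from False obtain i where i: "bit b i \<noteq> bit b' i" by (auto simp: bit_eq_iff)
    then have "i < n" using hi assms by (metis not_le)
    moreover have "s i = - 1" using i by (auto simp: s_def)
    ultimately have "(\<Prod>i<n. 1 + s i) = 0" by (intro prod_zero) (auto intro!: bexI[of _ i])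
    with False show ?thesis by simp
  qed
  finally show ?thesis .
qed

lemma hadamard_sym: "a < 2 ^ n \<Longrightarrow> b < 2 ^ n \<Longrightarrow> hadamard n $$ (a, b) = hadamard n $$ (b, a)"
  by (simp add: hadamard_entry mult.commute)

lemma hadamard_abs: "a < 2 ^ n \<Longrightarrow> b < 2 ^ n \<Longrightarrow> \<bar>hadamard n $$ (a, b)\<bar> = 1 / sqrt (2 ^ n)"
  by (simp add: hadamard_entry abs_prod power_abs)

lemma forr_eq:
  assumes "dim_vec z = 2 * 2 ^ n"
  shows "forr n z = (\<Sum>a<2 ^ n. \<Sum>b<2 ^ n. hadamard n $$ (a, b) * z $ a * z $ (2 ^ n + b)) / 2 ^ n"
proof -
  have [simp]: "dim_row (hadamard n) = 2 ^ n" "dim_col (hadamard n) = 2 ^ n" by (simp_all add: hadamard_def)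
  show ?thesis
    using assms unfolding forr_def
    by (simp add: vec_first_def vec_last_def scalar_prod_def sum_distrib_left sum_divide_distrib mult_ac atLeast0LessThan)
qed

section \<open>The classical lower bound\<close>

definition to_vec :: "nat \<Rightarrow> nat \<Rightarrow> (nat \<times> nat \<Rightarrow> real) \<Rightarrow> real vec" where
  "to_vec n k x = vec (2 * k * 2 ^ n) (\<lambda>t. x (t div (2 * 2 ^ n), t mod (2 * 2 ^ n)))"

lemma div_mod_block:
  assumes "t < 2 * k * 2 ^ n"
  shows "(t div (2 * 2 ^ n), t mod (2 * 2 ^ n)) \<in> {..<k} \<times> {..<2 * 2 ^ n :: nat}"
proof -
  have "t < k * (2 * 2 ^ n)" using assms by (simp add: mult_ac)
  then have "t div (2 * 2 ^ n) < k" by (rule less_mult_imp_div_less)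
  then show ?thesis by simp
qed

lemma to_vec_in:
  assumes "x \<in> cube ({..<k} \<times> {..<2 * 2 ^ n})"
  shows "to_vec n k x \<in> comm_inputs n k"
  unfolding comm_inputs_def sign_cube_def to_vec_def
  using cube_val[OF assms div_mod_block] by auto

lemma coord_prod_to_vec:
  assumes "x \<in> cube ({..<k} \<times> {..<2 * 2 ^ n})"
  shows "coord_prod (to_vec n k x) (to_vec n k (cube_mult ({..<k} \<times> {..<2 * 2 ^ n}) x z)) = to_vec n k z"
proof (rule eq_vecI)
  fix t assume "t < dim_vec (to_vec n k z)"
  then have t: "t < 2 * k * 2 ^ n" by (simp add: to_vec_def)
  show "coord_prod (to_vec n k x) (to_vec n k (cube_mult ({..<k} \<times> {..<2 * 2 ^ n}) x z)) $ t = to_vec n k z $ t"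
    using t div_mod_block[OF t] cube_val[OF assms div_mod_block[OF t]]
    by (auto simp: coord_prod_def to_vec_def cube_mult_def)
qed (simp add: coord_prod_def to_vec_def)

lemma block_to_vec:
  assumes "j < k"
  shows "block (2 * 2 ^ n) (to_vec n k z) j = vec (2 * 2 ^ n) (block_of {..<2 * 2 ^ n} z j)"
proof (rule eq_vecI)
  fix i assume "i < dim_vec (vec (2 * 2 ^ n) (block_of {..<2 * 2 ^ n} z j))"
  then have i: "i < 2 * 2 ^ n" by simp
  have "j * (2 * 2 ^ n) + i < Suc j * (2 * 2 ^ n)" using i by simp
  also have "\<dots> \<le> k * (2 * 2 ^ n)" using assms by (intro mult_right_mono) auto
  finally have "j * (2 * 2 ^ n) + i < 2 * k * 2 ^ n" by (simp add: mult_ac)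
  moreover have "(j * (2 * 2 ^ n) + i) div (2 * 2 ^ n) = j" "(j * (2 * 2 ^ n) + i) mod (2 * 2 ^ n) = i"
    using i by (simp_all del: mult_Suc)
  ultimately show "block (2 * 2 ^ n) (to_vec n k z) j $ i = vec (2 * 2 ^ n) (block_of {..<2 * 2 ^ n} z j) $ i"
    using i by (simp add: block_def to_vec_def block_of_def)
qed (simp add: block_def)

interpretation had: hadamard_matrix "2 ^ n" "\<lambda>a b. hadamard n $$ (a, b)" for n
  by unfold_locales (auto simp: hadamard_orth hadamard_abs intro: hadamard_sym)

lemma forr_vec: "forr n (vec (2 * 2 ^ n) w) = had.forrel n w"
  by (subst forr_eq) (auto simp: had.forrel_def intro!: sum.cong)

text \<open>A protocol may output any integer; outputs other than 1 and -1 are always wrong on the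
  promise and get the neutral value 0.\<close>

definition decide :: "int \<Rightarrow> real" where
  "decide r = (if r = 1 then 1 else if r = - 1 then - 1 else 0)"

text \<open>
  The hard inputs give every block the weight \<open>u + v\<close>, where \<open>u\<close> lives on the inputs with value \<open>1\<close> and
  \<open>v\<close> on those with value \<open>- 1\<close>; neither is normalised, so that cutting off the rare inputs outside the
  promise does not disturb the Fourier coefficients.
\<close>

lemma success_le:
  fixes n k :: nat and u v :: "(nat \<Rightarrow> real) \<Rightarrow> real" and R :: "(real vec, real vec, int) protocol pmf"
  defines "V \<equiv> {..<2 * 2 ^ n :: nat}"
  assumes u: "\<And>w. u w \<ge> 0" "\<And>w. u w \<noteq> 0 \<Longrightarrow> forr_fun n k (vec (2 * 2 ^ n) w) = Some 1"
    and v: "\<And>w. v w \<ge> 0" "\<And>w. v w \<noteq> 0 \<Longrightarrow> forr_fun n k (vec (2 * 2 ^ n) w) = Some (- 1)"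
    and corr: "\<And>p. p \<in> set_pmf R \<Longrightarrow>
      block_corr V {..<k} (\<lambda>_ w. u w - v w) (\<lambda>x y. decide (run p (to_vec n k x) (to_vec n k y))) \<le> c"
  defines "W \<equiv> (\<Sum>w\<in>cube V. u w + v w) ^ k"
  shows "worst_case_success (comm_inputs n k) (comm_inputs n k) (forr_xor_comm n k) R * W \<le> W / 2 + c / 2"
proof -
  define I where "I = {..<k} \<times> V"
  define s where "s = worst_case_success (comm_inputs n k) (comm_inputs n k) (forr_xor_comm n k) R"
  define wt where "wt z = (\<Prod>j<k. u (block_of V z j) + v (block_of V z j))" for z :: "nat \<times> nat \<Rightarrow> real"
  define F where "F z = (\<Prod>j<k. the (forr_fun n k (vec (2 * 2 ^ n) (block_of V z j))))" for z :: "nat \<times> nat \<Rightarrow> real"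
  define X where "X x = to_vec n k x" for x
  define Y where "Y x z = to_vec n k (cube_mult I x z)" for x z
  have finI: "finite I" by (simp add: I_def V_def)
  have wt0: "wt z \<ge> 0" for z unfolding wt_def using u v by (intro prod_nonneg) auto
  have def: "forr_fun n k (vec (2 * 2 ^ n) w) \<noteq> None" if "u w + v w \<noteq> 0" for w
    using u(2)[of w] v(2)[of w] that by fastforce
  have f: "forr_xor_comm n k (X x) (Y x z) = Some (F z)" if "x \<in> cube I" "wt z \<noteq> 0" for x z
  proof -
    have "u (block_of V z j) + v (block_of V z j) \<noteq> 0" if "j < k" for j
      using \<open>wt z \<noteq> 0\<close> that unfolding wt_def by (subst (asm) prod_zero_iff) auto
    then show ?thesis
      using that def unfolding forr_xor_comm_def forr_xor_fun_def X_def Y_def I_def V_def F_def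
      by (auto simp: coord_prod_to_vec block_to_vec)
  qed
  \<comment> \<open>Since \<open>u\<close> lives on value 1 and \<open>v\<close> on value -1,
    multiplying by the target turns each factor u + v into u - v.\<close>
  have wtF: "wt z * F z = (\<Prod>j<k. u (block_of V z j) - v (block_of V z j))" for z
  proof -
    have "(u w + v w) * the (forr_fun n k (vec (2 * 2 ^ n) w)) = u w - v w" for w
      using u(2)[of w] v(2)[of w] by (cases "u w = 0"; cases "v w = 0") auto
    then show ?thesis unfolding wt_def F_def of_int_prod prod.distrib[symmetric] by simp
  qed
  have F1: "F z = 1 \<or> F z = - 1" if "wt z \<noteq> 0" for z
  proof -
    have F_unit: "a = 1 \<or> a = - 1" if "forr_fun n k w = Some a" for w a
      using that by (auto simp: forr_fun_def split: if_splits)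
    have "\<bar>the (forr_fun n k (vec (2 * 2 ^ n) (block_of V z j)))\<bar> = 1" if "j < k" for j
    proof -
      have "u (block_of V z j) + v (block_of V z j) \<noteq> 0"
        using \<open>wt z \<noteq> 0\<close> that unfolding wt_def by (subst (asm) prod_zero_iff) auto
      then obtain a where "forr_fun n k (vec (2 * 2 ^ n) (block_of V z j)) = Some a" using def by blast
      with F_unit[OF this] show ?thesis by auto
    qed
    then have "\<bar>F z\<bar> = 1" by (simp add: F_def abs_prod)
    then show ?thesis by linarith
  qed
  define S where "S x z = {p. forr_xor_comm n k (X x) (Y x z) = Some (run p (X x) (Y x z))}" for x z
  have s_le: "s \<le> measure_pmf.prob R (S x z)" if "x \<in> cube I" "z \<in> cube I" "wt z \<noteq> 0" for x z
  proof -
    have "(X x, Y x z) \<in> promise (comm_inputs n k) (comm_inputs n k) (forr_xor_comm n k)"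
      using that f[OF that(1,3)] to_vec_in cube_mult_in[OF that(1,2)]
      by (simp add: promise_def X_def Y_def I_def V_def)
    then have "s \<le> (\<lambda>(x, y). measure_pmf.prob R {p. forr_xor_comm n k x y = Some (run p x y)}) (X x, Y x z)"
      unfolding s_def worst_case_success_def
      by (intro cINF_lower) (auto intro!: bdd_belowI[of _ 0])
    then show ?thesis by (simp add: S_def)
  qed
  have int: "integrable (measure_pmf R) (\<lambda>p. indicator (S x z) p :: real)" for x z
    by (rule measure_pmf.integrable_const_bound[where B = 1]) auto
  have sumW: "(\<Sum>z\<in>cube I. wt z) = W"
    unfolding wt_def I_def W_def using sum_cube_block_prod[of "{..<k}" "\<lambda>_ w. u w + v w" V] by simp
  \<comment> \<open>Averaging over hard inputs: the worst case is at most the weighted mean success,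
    and the expectation over deterministic protocols then moves outside.\<close>
  have "s * W = (\<Sum>z\<in>cube I. wt z * cube_avg I (\<lambda>x. s))"
    using finI by (simp add: cube_avg_const sum_distrib_left mult_ac flip: sumW)
  also have "\<dots> \<le> (\<Sum>z\<in>cube I. wt z * cube_avg I (\<lambda>x. measure_pmf.prob R (S x z)))"
  proof (intro sum_mono)
    fix z assume z: "z \<in> cube I"
    show "wt z * cube_avg I (\<lambda>x. s) \<le> wt z * cube_avg I (\<lambda>x. measure_pmf.prob R (S x z))"
      using wt0[of z] s_le[OF _ z] by (cases "wt z = 0") (auto intro!: mult_left_mono cube_avg_mono)
  qed
  also have "\<dots> = measure_pmf.expectation R (\<lambda>p. \<Sum>z\<in>cube I. wt z * cube_avg I (\<lambda>x. indicator (S x z) p))"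
  proof -
    have "(\<Sum>z\<in>cube I. wt z * cube_avg I (\<lambda>x. measure_pmf.prob R (S x z))) =
        (\<Sum>z\<in>cube I. wt z * cube_avg I (\<lambda>x. measure_pmf.expectation R (\<lambda>p. indicator (S x z) p)))"
      by simp
    also have "\<dots> = measure_pmf.expectation R (\<lambda>p. \<Sum>z\<in>cube I. wt z * cube_avg I (\<lambda>x. indicator (S x z) p))"
      unfolding cube_avg_def
      by (simp add: Bochner_Integration.integral_sum int del: integral_indicator)
    finally show ?thesis .
  qed
  also have "\<dots> \<le> W / 2 + c / 2"
  proof (rule measure_pmf.integral_le_const)
    show "integrable (measure_pmf R) (\<lambda>p. \<Sum>z\<in>cube I. wt z * cube_avg I (\<lambda>x. indicator (S x z) p))"
      unfolding cube_avg_def by (intro Bochner_Integration.integrable_sum integrable_mult_right integrable_divide int)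
    have "(\<Sum>z\<in>cube I. wt z * cube_avg I (\<lambda>x. indicator (S x z) p)) \<le> W / 2 + c / 2" if p: "p \<in> set_pmf R" for p
    proof -
      have "(\<Sum>z\<in>cube I. wt z * cube_avg I (\<lambda>x. indicator (S x z) p)) \<le>
          (\<Sum>z\<in>cube I. wt z * cube_avg I (\<lambda>x. 1 / 2 + F z / 2 * decide (run p (X x) (Y x z))))"
      proof (intro sum_mono)
        fix z assume z: "z \<in> cube I"
        \<comment> \<open>A correct output gives 1 on the right, the wrong sign gives 0, and any
          other output gives 1/2.\<close>
        have "indicator (S x z) p \<le> 1 / 2 + F z / 2 * decide (run p (X x) (Y x z))" if "x \<in> cube I" "wt z \<noteq> 0" for x
          using f[OF that] F1[OF that(2)] by (auto simp: S_def decide_def indicator_def)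
        then show "wt z * cube_avg I (\<lambda>x. indicator (S x z) p) \<le> wt z * cube_avg I (\<lambda>x. 1 / 2 + F z / 2 * decide (run p (X x) (Y x z)))"
          using wt0[of z] by (cases "wt z = 0") (auto intro!: mult_left_mono cube_avg_mono)
      qed
      also have "\<dots> = (\<Sum>z\<in>cube I. wt z / 2 + (wt z * F z) / 2 * cube_avg I (\<lambda>x. decide (run p (X x) (Y x z))))"
      proof -
        have "cube_avg I (\<lambda>x. 1 / 2 + F z / 2 * decide (run p (X x) (Y x z))) =
            1 / 2 + F z / 2 * cube_avg I (\<lambda>x. decide (run p (X x) (Y x z)))" for z
          by (simp only: cube_avg_add cube_avg_cmult cube_avg_const[OF finI])
        then show ?thesis by (simp add: distrib_left mult_ac)
      qed
      also have "\<dots> = W / 2 + block_corr V {..<k} (\<lambda>_ w. u w - v w) (\<lambda>x y. decide (run p (to_vec n k x) (to_vec n k y))) / 2"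
        unfolding block_corr_def wtF sum.distrib sumW[symmetric] sum_divide_distrib X_def Y_def I_def by (simp add: mult_ac)
      also have "\<dots> \<le> W / 2 + c / 2" using corr[OF p] by simp
      finally show ?thesis .
    qed
    then show "AE p in measure_pmf R. (\<Sum>z\<in>cube I. wt z * cube_avg I (\<lambda>x. indicator (S x z) p)) \<le> W / 2 + c / 2"
      by (simp add: AE_measure_pmf_iff)
  qed
  finally show ?thesis unfolding s_def .
qed

lemma decide_abs: "\<bar>decide r\<bar> \<le> 1"
  by (simp add: decide_def)

text \<open>The condition on 2 \<epsilon> is the smallness of \<alpha> asked for by
  \<open>block_corr_le_1\<close>, 2^n \<epsilon>^2 \<ge> 256 makes both tails at most 1/8, and the
  condition on the depth is t \<le> N^(1/4).\<close>

lemma classical_bound: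
  fixes n k :: nat and R :: "(real vec, real vec, int) protocol pmf"
  defines "\<epsilon> \<equiv> forr_eps n k"
  assumes \<epsilon>: "\<epsilon> > 0" "2 * \<epsilon> \<le> (1 / 108)\<^sup>2" "2 ^ n * \<epsilon>\<^sup>2 \<ge> 256"
    and R: "\<And>p. p \<in> set_pmf R \<Longrightarrow> (real (depth p))\<^sup>2 \<le> sqrt (2 ^ n)"
  shows "worst_case_success (comm_inputs n k) (comm_inputs n k) (forr_xor_comm n k) R
    \<le> 1 / 2 + exp (- (1 / 4) * real k)"
proof -
  define V where "V = {..<2 * 2 ^ n :: nat}"
  \<comment> \<open>With this choice \<open>mean_forrel_ge\<close> bounds the Gaussian mean below by
    \<alpha>^2 / 2 = \<epsilon>.\<close>
  define \<alpha> where "\<alpha> = sqrt (2 * \<epsilon>)"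
  have \<alpha>2: "\<alpha>\<^sup>2 = 2 * \<epsilon>" using \<epsilon> by (simp add: \<alpha>_def)
  have \<alpha>: "0 \<le> \<alpha>" "\<alpha> \<le> 1 / 108"
    using \<epsilon> real_sqrt_le_mono[OF \<epsilon>(2)] by (simp_all add: \<alpha>_def)
  define U D where "U = had.dens n 0" and "D = had.dens n \<alpha>"
  define fr where "fr = had.forrel n"
  define u where "u w = (if fr w \<le> \<epsilon> / 4 \<and> w \<in> cube V then U w else 0)" for w
  define v where "v w = (if fr w \<ge> \<epsilon> / 2 \<and> w \<in> cube V then D w else 0)" for w
  have U0: "U w \<ge> 0" and D0: "D w \<ge> 0" if "w \<in> cube V" for w
    using that had.dens_nonneg[of w n] by (simp_all add: U_def D_def V_def)
  have finV: "finite V" by (simp add: V_def)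
  have sumU: "(\<Sum>w\<in>cube V. U w) = 1" and sumD: "(\<Sum>w\<in>cube V. D w) = 1"
    using had.sum_dens[of n] by (simp_all add: U_def D_def V_def)
  have tU: "(\<Sum>w | w \<in> cube V \<and> \<not> fr w \<le> \<epsilon> / 4. U w) \<le> 1 / 8"
  proof -
    have "(\<Sum>w | w \<in> cube V \<and> \<not> fr w \<le> \<epsilon> / 4. U w) \<le> 2 / (real (2 ^ n) * (\<epsilon> / 4)\<^sup>2)"
      unfolding U_def using \<epsilon>
      by (intro had.dens_tail) (auto simp: V_def fr_def)
    also have "\<dots> = 32 / (2 ^ n * \<epsilon>\<^sup>2)" by (simp add: power_divide)
    also have "\<dots> \<le> 32 / 256" using \<epsilon> by (intro divide_left_mono mult_pos_pos) auto
    finally show ?thesis by simp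
  qed
  have tD: "(\<Sum>w | w \<in> cube V \<and> \<not> \<epsilon> / 2 \<le> fr w. D w) \<le> 1 / 8"
  proof -
    have m: "\<epsilon> \<le> sqrt (real (2 ^ n)) * exp (- \<alpha>\<^sup>2) * sinh (\<alpha>\<^sup>2 / sqrt (real (2 ^ n)))"
      using had.mean_forrel_ge[of \<alpha> n] \<alpha> \<alpha>2 by simp
    have "(\<Sum>w | w \<in> cube V \<and> \<not> \<epsilon> / 2 \<le> fr w. D w) \<le> 2 / (real (2 ^ n) * (\<epsilon> / 2)\<^sup>2)"
      unfolding D_def
    proof (rule had.dens_tail)
      fix w assume "w \<in> {w \<in> cube V. \<not> \<epsilon> / 2 \<le> fr w}"
      then have "fr w < \<epsilon> / 2" by simp
      then show "\<epsilon> / 2 \<le> \<bar>had.forrel n w - sqrt (real (2 ^ n)) * exp (- \<alpha>\<^sup>2) * sinh (\<alpha>\<^sup>2 / sqrt (real (2 ^ n)))\<bar>"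
        using m unfolding fr_def by linarith
    qed (use \<alpha> \<epsilon> in \<open>auto simp: V_def\<close>)
    also have "\<dots> = 8 / (2 ^ n * \<epsilon>\<^sup>2)" by (simp add: power_divide)
    also have "\<dots> \<le> 8 / 256" using \<epsilon> by (intro divide_left_mono mult_pos_pos) auto
    finally show ?thesis by simp
  qed
  have split: "(\<Sum>w\<in>cube V. f w) = (\<Sum>w\<in>cube V. if P w then f w else 0) + (\<Sum>w | w \<in> cube V \<and> \<not> P w. f w)"
    for f :: "(nat \<Rightarrow> real) \<Rightarrow> real" and P
    unfolding sum.inter_filter[OF finite_cube[OF finV]] sum.distrib[symmetric]
    by (intro sum.cong) auto
  have su: "(\<Sum>w\<in>cube V. u w) = 1 - (\<Sum>w | w \<in> cube V \<and> \<not> fr w \<le> \<epsilon> / 4. U w)"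
    using split[of U "\<lambda>w. fr w \<le> \<epsilon> / 4"] unfolding sumU u_def by simp
  have sv: "(\<Sum>w\<in>cube V. v w) = 1 - (\<Sum>w | w \<in> cube V \<and> \<not> \<epsilon> / 2 \<le> fr w. D w)"
    using split[of D "\<lambda>w. \<epsilon> / 2 \<le> fr w"] unfolding sumD v_def by simp
  have err: "(\<Sum>w\<in>cube V. \<bar>(u w - v w) - (U w - D w)\<bar>) \<le> 1 / 4"
  proof -
    have "(\<Sum>w\<in>cube V. \<bar>(u w - v w) - (U w - D w)\<bar>) \<le> (\<Sum>w\<in>cube V. (U w - u w) + (D w - v w))"
    proof (rule sum_mono)
      fix w assume w: "w \<in> cube V"
      show "\<bar>(u w - v w) - (U w - D w)\<bar> \<le> (U w - u w) + (D w - v w)"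
        using U0[OF w] D0[OF w] w by (auto simp: u_def v_def abs_if)
    qed
    also have "\<dots> = (1 - (\<Sum>w\<in>cube V. u w)) + (1 - (\<Sum>w\<in>cube V. v w))"
      by (simp add: sum.distrib sum_subtractf sumU sumD)
    also have "\<dots> \<le> 1 / 4" unfolding su sv using tU tD by simp
    finally show ?thesis .
  qed
  have base: "\<bar>block_corr V J (\<lambda>_ w. U w - D w) K\<bar> \<le> 1"
    if J: "finite J" and K: "rect_kernel M K" "M \<le> 2 ^ t" and t: "(real t)\<^sup>2 \<le> sqrt (2 ^ n)" for J :: "nat set" and K M t
  proof (rule block_corr_le_1[OF finV J K])
    \<comment> \<open>The uniform measure has only the coefficient at the empty set, and there it
      cancels against that of the Gaussian measure.\<close>
    have dh: "(\<Sum>w\<in>cube V. (U w - D w) * (\<Prod>i\<in>T. w i)) = (if T = {} then 0 else - had.mom n \<alpha> T)" if "T \<subseteq> V" for T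
    proof -
      have "finite T" using that finV finite_subset by blast
      then show ?thesis
        using that had.dens_fourier[of T n 0] had.dens_fourier[of T n \<alpha>]
        by (simp add: U_def D_def V_def left_diff_distrib sum_subtractf had.mom_0)
    qed
    show "(\<Sum>w\<in>cube V. (U w - D w) * (\<Prod>i\<in>T. w i)) = 0" if "T \<subseteq> V" "card T < 2" for T
    proof (cases "T = {}")
      case False
      have "finite T" using that finV finite_subset by blast
      then have "card T = 1" using that False by (simp add: card_gt_0_iff le_antisym less_2_cases_iff)
      then obtain i where "T = {i}" by (auto simp: card_1_singleton_iff)
      then show ?thesis using dh[OF that(1)] that had.mom_singleton[of i n \<alpha>] by (simp add: V_def)
    qed (use dh[OF that(1)] in simp)
    show "(\<Sum>w\<in>cube V. (U w - D w) * (\<Prod>i\<in>T. w i))\<^sup>2 \<le> (\<alpha>\<^sup>2 / sqrt (2 ^ n) * card T) ^ card T"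
      if "T \<subseteq> V" "\<alpha>\<^sup>2 / sqrt (2 ^ n) * card T \<le> 1" for T
      using dh[OF that(1)] that had.mom_sq_le_low[of T n \<alpha>] by (simp add: V_def)
    show "(\<Sum>w\<in>cube V. (U w - D w) * (\<Prod>i\<in>T. w i))\<^sup>2 \<le> \<alpha> ^ card T" if "T \<subseteq> V" for T
      using dh[OF that(1)] that had.mom_sq_le_high[of T n \<alpha>] \<alpha> by (simp add: V_def)
    show "\<alpha>\<^sup>2 / sqrt (2 ^ n) * sqrt (2 ^ n) \<le> \<alpha>\<^sup>2" by simp
    show "real t \<le> sqrt (2 ^ n)"
    proof -
      have "t \<le> t * t" by (cases t) auto
      then have "real t \<le> (real t)\<^sup>2" unfolding power2_eq_square by (metis of_nat_le_iff of_nat_mult)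
      then show ?thesis using t by linarith
    qed
  qed (use \<alpha> t in auto)
  have corr: "block_corr V {..<k} (\<lambda>_ w. u w - v w) (\<lambda>x y. decide (run p (to_vec n k x) (to_vec n k y))) \<le> (5 / 4) ^ k"
    if p: "p \<in> set_pmf R" for p
  proof -
    obtain M where M: "M \<le> 2 ^ depth p" "rect_kernel M (\<lambda>x y. decide (run p x y))"
      using protocol_rect_kernel[of decide p, OF decide_abs] by blast
    \<comment> \<open>With \<open>J1\<close> empty all \<open>k\<close> blocks carry the restricted
      weights, each at the cost of a factor 1 + 1/4.\<close>
    have "\<bar>block_corr V ({} \<union> {..<k}) (\<lambda>j. if j \<in> {..<k} then (\<lambda>w. u w - v w) else (\<lambda>w. U w - D w))
        (\<lambda>x y. decide (run p (to_vec n k x) (to_vec n k y)))\<bar> \<le> (1 + 1 / 4) ^ card {..<k}"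
    proof (rule block_corr_perturb[OF finV _ err])
      show "\<bar>block_corr V J (\<lambda>_ w. U w - D w) K\<bar> \<le> 1" if "finite J" "rect_kernel M K" for J :: "nat set" and K
        using base[OF that M(1) R[OF p]] .
      show "rect_kernel M (\<lambda>x y. decide (run p (to_vec n k x) (to_vec n k y)))"
        by (rule rect_kernel_comp[OF M(2)])
    qed auto
    also have "block_corr V ({} \<union> {..<k}) (\<lambda>j. if j \<in> {..<k} then (\<lambda>w. u w - v w) else (\<lambda>w. U w - D w))
        (\<lambda>x y. decide (run p (to_vec n k x) (to_vec n k y))) =
      block_corr V {..<k} (\<lambda>_ w. u w - v w) (\<lambda>x y. decide (run p (to_vec n k x) (to_vec n k y)))"
      unfolding Un_empty_left by (rule block_corr_cong) simp
    finally show ?thesis by simp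
  qed
  define W where "W = (\<Sum>w\<in>cube V. u w + v w)"
  have W: "W \<ge> 7 / 4" unfolding W_def sum.distrib su sv using tU tD by linarith
  define s where "s = worst_case_success (comm_inputs n k) (comm_inputs n k) (forr_xor_comm n k) R"
  have "s * W ^ k \<le> W ^ k / 2 + (5 / 4) ^ k / 2"
    unfolding s_def W_def V_def
  proof (rule success_le)
    show "u w \<ge> 0" "v w \<ge> 0" for w using U0 D0 by (auto simp: u_def v_def)
    show "forr_fun n k (vec (2 * 2 ^ n) w) = Some 1" if "u w \<noteq> 0" for w
      using that \<epsilon> by (auto simp: u_def forr_fun_def forr_vec fr_def \<epsilon>_def split: if_splits)
    show "forr_fun n k (vec (2 * 2 ^ n) w) = Some (- 1)" if "v w \<noteq> 0" for w
      using that \<epsilon> by (auto simp: v_def forr_fun_def forr_vec fr_def \<epsilon>_def split: if_splits)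
  qed (use corr in \<open>simp add: V_def\<close>)
  \<comment> \<open>Correlation (5/4)^k against mass (7/4)^k; the rate comes from 5/7 \<le> 3/4
    \<le> exp(-1/4).\<close>
  then have "s \<le> 1 / 2 + ((5 / 4) ^ k / W ^ k) / 2"
    using W by (simp add: field_simps)
  also have "(5 / 4) ^ k / W ^ k \<le> (5 / 4) ^ k / (7 / 4) ^ k"
    using W by (intro divide_left_mono power_mono mult_pos_pos) auto
  also have "\<dots> = (5 / 7) ^ k" by (simp flip: power_divide)
  also have "\<dots> \<le> exp (- (1 / 4)) ^ k"
    using exp_ge_add_one_self[of "- (1 / 4) :: real"] by (intro power_mono) auto
  also have "\<dots> = exp (- (1 / 4) * real k)" by (simp add: exp_of_nat_mult[symmetric] mult.commute)
  finally have "s \<le> 1 / 2 + exp (- (1 / 4) * real k) / 2" by simp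
  also have "\<dots> \<le> 1 / 2 + exp (- (1 / 4) * real k)" by simp
  finally show ?thesis unfolding s_def .
qed

section \<open>The quantum protocol\<close>

text \<open>An index below q^L stands for a basis vector of the L-fold tensor power of a
  q-dimensional space, and its base-q digits for the tensor factors.\<close>

definition digit :: "nat \<Rightarrow> nat \<Rightarrow> nat \<Rightarrow> nat" where
  "digit q a c = a div q ^ c mod q"

lemma digit_less: "q > 0 \<Longrightarrow> digit q a c < q"
  by (simp add: digit_def)

lemma sum_blocks:
  fixes f :: "nat \<Rightarrow> 'a :: comm_monoid_add"
  assumes "B > 0"
  shows "(\<Sum>a<q * B. f a) = (\<Sum>i<q. \<Sum>b<B. f (i * B + b))"
proof -
  have "(\<Sum>a<q * B. f a) = (\<Sum>p\<in>{..<q} \<times> {..<B}. f (fst p * B + snd p))"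
  proof (rule sum.reindex_bij_witness[where j = "\<lambda>a. (a div B, a mod B)" and i = "\<lambda>p. fst p * B + snd p"])
    show "fst p * B + snd p \<in> {..<q * B}" if "p \<in> {..<q} \<times> {..<B}" for p
    proof -
      have "fst p * B + snd p < Suc (fst p) * B" using that by auto
      also have "\<dots> \<le> q * B" using that by (intro mult_right_mono) auto
      finally show ?thesis by simp
    qed
  qed (use assms in \<open>auto simp: less_mult_imp_div_less\<close>)
  then show ?thesis by (simp add: sum.cartesian_product case_prod_unfold)
qed

lemma digit_block:
  assumes "b < q ^ L" "i < q"
  shows "c < L \<Longrightarrow> digit q (i * q ^ L + b) c = digit q b c" and "digit q (i * q ^ L + b) L = i"
proof -
  have q: "q > 0" using assms by simp
  show "digit q (i * q ^ L + b) c = digit q b c" if "c < L"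
  proof -
    have "i * q ^ L = q ^ c * (i * q ^ (L - c - 1) * q)"
      using that power_add[of q c "Suc (L - c - 1)"] by (simp add: mult_ac)
    then have "(i * q ^ L + b) div q ^ c = (b + q ^ c * (i * q ^ (L - c - 1) * q)) div q ^ c"
      by (simp only: add.commute)
    also have "\<dots> = i * q ^ (L - c - 1) * q + b div q ^ c"
      using q by (subst div_mult_self2) auto
    finally show ?thesis by (simp add: digit_def)
  qed
  show "digit q (i * q ^ L + b) L = i" using assms q by (simp add: digit_def)
qed

lemma sum_prod_digits:
  fixes f :: "nat \<Rightarrow> nat \<Rightarrow> real"
  assumes "q > 0"
  shows "(\<Sum>a<q ^ L. \<Prod>c<L. f c (digit q a c)) = (\<Prod>c<L. \<Sum>i<q. f c i)"
proof (induction L)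
  case (Suc L)
  have "(\<Sum>a<q ^ Suc L. \<Prod>c<Suc L. f c (digit q a c)) =
      (\<Sum>i<q. \<Sum>b<q ^ L. \<Prod>c<Suc L. f c (digit q (i * q ^ L + b) c))"
    using assms by (simp only: power_Suc sum_blocks[where B = "q ^ L" and q = q] zero_less_power)
  also have "\<dots> = (\<Sum>i<q. \<Sum>b<q ^ L. (\<Prod>c<L. f c (digit q b c)) * f L i)"
    by (intro sum.cong refl) (simp add: digit_block)
  also have "\<dots> = (\<Prod>c<L. \<Sum>i<q. f c i) * (\<Sum>i<q. f L i)"
    by (simp add: Suc sum_distrib_left flip: sum_distrib_right)
  finally show ?case by simp
qed simp

lemma sum_prod_digits2:
  fixes f :: "nat \<Rightarrow> nat \<Rightarrow> nat \<Rightarrow> real"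
  assumes "q > 0"
  shows "(\<Sum>a<q ^ L. \<Sum>b<q ^ L. \<Prod>c<L. f c (digit q a c) (digit q b c)) = (\<Prod>c<L. \<Sum>i<q. \<Sum>j<q. f c i j)"
proof -
  have "(\<Sum>b<q ^ L. \<Prod>c<L. f c (digit q a c) (digit q b c)) = (\<Prod>c<L. \<Sum>j<q. f c (digit q a c) j)" for a
    by (rule sum_prod_digits[OF assms])
  then show ?thesis using sum_prod_digits[OF assms, where f = "\<lambda>c i. \<Sum>j<q. f c i j"] by simp
qed

lemma prod_digits_eq:
  assumes "a < q ^ L" "b < q ^ L"
  shows "(\<Prod>c<L. of_bool (digit q a c = digit q b c)) = (of_bool (a = b) :: real)"
  using assms
proof (induction L arbitrary: a b)
  case (Suc L)
  have q: "q > 0" using Suc.prems by (cases q) auto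
  define a1 a0 b1 b0 where "a1 = a div q ^ L" and "a0 = a mod q ^ L" and "b1 = b div q ^ L" and "b0 = b mod q ^ L"
  have ab: "a = a1 * q ^ L + a0" "b = b1 * q ^ L + b0" by (simp_all only: a1_def a0_def b1_def b0_def div_mult_mod_eq)
  have lt: "a1 < q" "b1 < q" "a0 < q ^ L" "b0 < q ^ L"
    using Suc.prems q by (auto simp: a1_def a0_def b1_def b0_def less_mult_imp_div_less)
  have "(\<Prod>c<Suc L. of_bool (digit q a c = digit q b c)) = (of_bool (a0 = b0) * of_bool (a1 = b1) :: real)"
    unfolding ab using lt by (simp add: digit_block Suc.IH)
  also have "\<dots> = of_bool (a = b)"
  proof -
    have "a = b \<longleftrightarrow> a0 = b0 \<and> a1 = b1"
      using ab by (auto simp: a1_def a0_def b1_def b0_def)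
    then show ?thesis by simp
  qed
  finally show ?case .
qed simp

section \<open>Positive matrices and the Forrelation observable\<close>

lemma quad_form:
  fixes E :: "complex mat"
  assumes "E \<in> carrier_mat d d" "v \<in> carrier_vec d"
  shows "(E *\<^sub>v v) \<bullet>c v = (\<Sum>i<d. \<Sum>j<d. E $$ (i, j) * v $ j * cnj (v $ i))"
  using assms by (auto simp: scalar_prod_def sum_distrib_right atLeast0LessThan intro!: sum.cong)

lemma mat_adjoint_index:
  fixes A :: "complex mat"
  shows "i < dim_col A \<Longrightarrow> j < dim_row A \<Longrightarrow> mat_adjoint A $$ (i, j) = cnj (A $$ (j, i))"
  unfolding mat_adjoint_def by (subst mat_of_rows_index) auto

lemma mat_adjoint_dim [simp]:
  fixes A :: "complex mat"
  shows "dim_row (mat_adjoint A) = dim_col A" "dim_col (mat_adjoint A) = dim_row A"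
  unfolding mat_adjoint_def by auto

text \<open>The quadratic form of a Gram matrix is a sum of squared moduli; the referee's operators
  are brought into this form.\<close>

lemma psd_gram:
  fixes g :: "'l \<Rightarrow> nat \<Rightarrow> real"
  assumes "finite \<Lambda>"
  shows "psd d (mat d d (\<lambda>(i, j). complex_of_real (\<Sum>l\<in>\<Lambda>. g l i * g l j)))"
  unfolding psd_def
proof (intro conjI ballI)
  let ?E = "mat d d (\<lambda>(i, j). complex_of_real (\<Sum>l\<in>\<Lambda>. g l i * g l j))"
  show "?E \<in> carrier_mat d d" by simp
  show "mat_adjoint ?E = ?E"
    by (rule eq_matI) (auto simp: mat_adjoint_index mult.commute)
  fix v :: "complex vec" assume v: "v \<in> carrier_vec d"
  have "(?E *\<^sub>v v) \<bullet>c v = (\<Sum>i<d. \<Sum>j<d. (\<Sum>l\<in>\<Lambda>. complex_of_real (g l i) * complex_of_real (g l j)) * v $ j * cnj (v $ i))"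
    by (subst quad_form[OF _ v]) auto
  also have "\<dots> = (\<Sum>i<d. \<Sum>j<d. \<Sum>l\<in>\<Lambda>. (g l j * v $ j) * cnj (g l i * v $ i))"
    by (simp add: sum_distrib_left sum_distrib_right mult_ac)
  also have "\<dots> = (\<Sum>i<d. \<Sum>l\<in>\<Lambda>. \<Sum>j<d. (g l j * v $ j) * cnj (g l i * v $ i))"
    by (intro sum.cong refl sum.swap)
  also have "\<dots> = (\<Sum>l\<in>\<Lambda>. \<Sum>i<d. \<Sum>j<d. (g l j * v $ j) * cnj (g l i * v $ i))"
    by (rule sum.swap)
  also have "\<dots> = (\<Sum>l\<in>\<Lambda>. (\<Sum>j<d. g l j * v $ j) * cnj (\<Sum>i<d. g l i * v $ i))"
    unfolding cnj_sum sum_distrib_left sum_distrib_right ..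
  also have "\<dots> = complex_of_real (\<Sum>l\<in>\<Lambda>. (cmod (\<Sum>j<d. g l j * v $ j))\<^sup>2)"
    by (simp only: complex_norm_square[symmetric] of_real_sum)
  finally show "0 \<le> Re ((?E *\<^sub>v v) \<bullet>c v)" by (simp add: sum_nonneg)
qed

text \<open>The reflection with zero diagonal blocks and off-diagonal blocks \<open>H\<close> and
  its transpose. It squares to the identity, so \<open>forr_proj\<close> with \<sigma> = 1 or -1
  projects onto the \<sigma>-eigenspace.\<close>

definition forr_obs :: "nat \<Rightarrow> nat \<Rightarrow> nat \<Rightarrow> real" where
  "forr_obs n i j =
     (if i < 2 ^ n \<and> 2 ^ n \<le> j then hadamard n $$ (i, j - 2 ^ n)
      else if 2 ^ n \<le> i \<and> j < 2 ^ n then hadamard n $$ (j, i - 2 ^ n) else 0)"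

definition forr_proj :: "nat \<Rightarrow> real \<Rightarrow> nat \<Rightarrow> nat \<Rightarrow> real" where
  "forr_proj n \<sigma> i j = (of_bool (i = j) + \<sigma> * forr_obs n i j) / 2"

lemma sum_two_halves:
  fixes f :: "nat \<Rightarrow> real"
  shows "(\<Sum>i<2 * B. f i) = (\<Sum>i<B. f i) + (\<Sum>i<B. f (B + i))"
proof -
  have "{..<2 * B} = {..<B} \<union> {B..<B + B}" by auto
  moreover have "(\<Sum>i\<in>{B..<B + B}. f i) = (\<Sum>i<B. f (B + i))"
    using sum.shift_bounds_nat_ivl[of f 0 B B] by (simp add: atLeast0LessThan add.commute)
  ultimately show ?thesis by (simp add: sum.union_disjoint[of "{..<B}"] ivl_disj_int)
qed

lemma forr_obs_sym: "forr_obs n i j = forr_obs n j i"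
  by (auto simp: forr_obs_def)

lemma forr_obs_square:
  assumes "i < 2 * 2 ^ n" "l < 2 * 2 ^ n"
  shows "(\<Sum>j<2 * 2 ^ n. forr_obs n j i * forr_obs n j l) = of_bool (i = l)"
proof (cases "i < 2 ^ n"; cases "l < 2 ^ n")
  assume "i < 2 ^ n" "l < 2 ^ n"
  then show ?thesis using had.row_orth[of i n l] unfolding sum_two_halves by (simp add: forr_obs_def)
next
  assume *: "\<not> i < 2 ^ n" "\<not> l < 2 ^ n"
  then have "i - 2 ^ n < 2 ^ n" "l - 2 ^ n < 2 ^ n" using assms by auto
  from hadamard_orth[OF this] show ?thesis
    using * unfolding sum_two_halves by (auto simp: forr_obs_def)
qed (auto simp: sum_two_halves forr_obs_def)

text \<open>Written as transpose times itself, so that it yields Gram representations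
  directly.\<close>

lemma forr_proj_idem:
  assumes "i < 2 * 2 ^ n" "l < 2 * 2 ^ n" "\<sigma> = 1 \<or> \<sigma> = - 1"
  shows "(\<Sum>j<2 * 2 ^ n. forr_proj n \<sigma> j i * forr_proj n \<sigma> j l) = forr_proj n \<sigma> i l"
proof -
  have d: "(\<Sum>j<2 * 2 ^ n. of_bool (j = a) * f j) = f a" if "a < 2 * 2 ^ n" for a and f :: "nat \<Rightarrow> real"
    using that by (simp add: of_bool_def if_distrib[of "\<lambda>x. x * _"] cong: if_cong)
  have \<sigma>: "\<sigma> * \<sigma> = 1" using assms by auto
  have "(\<Sum>j<2 * 2 ^ n. forr_proj n \<sigma> j i * forr_proj n \<sigma> j l) =
      ((\<Sum>j<2 * 2 ^ n. of_bool (j = i) * of_bool (j = l)) + \<sigma> * (\<Sum>j<2 * 2 ^ n. of_bool (j = i) * forr_obs n j l)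
      + \<sigma> * (\<Sum>j<2 * 2 ^ n. of_bool (j = l) * forr_obs n j i) + \<sigma> * \<sigma> * (\<Sum>j<2 * 2 ^ n. forr_obs n j i * forr_obs n j l)) / 4"
    unfolding sum_distrib_left sum.distrib[symmetric] sum_divide_distrib
    by (intro sum.cong refl) (simp add: forr_proj_def field_simps)
  also have "\<dots> = (of_bool (i = l) + \<sigma> * forr_obs n i l + \<sigma> * forr_obs n l i + \<sigma> * \<sigma> * of_bool (i = l)) / 4"
    unfolding d[OF assms(1)] d[OF assms(2)] forr_obs_square[OF assms(1,2)] ..
  also have "\<dots> = forr_proj n \<sigma> i l"
    unfolding \<sigma> by (simp add: forr_proj_def forr_obs_sym[of n l i])
  finally show ?thesis .
qed

text \<open>The normalised state z / sqrt(2N) meets two off-diagonal blocks, each contributing N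
  forr before division by 2N. Hence outcome \<sigma> has probability (1 + \<sigma> forr)/2.\<close>

lemma forr_proj_expect:
  assumes "dim_vec z = 2 * 2 ^ n" "\<And>i. i < 2 * 2 ^ n \<Longrightarrow> z $ i = 1 \<or> z $ i = - 1"
  shows "(\<Sum>i<2 * 2 ^ n. \<Sum>j<2 * 2 ^ n. forr_proj n \<sigma> i j * (z $ i * z $ j)) / (2 * 2 ^ n) = (1 + \<sigma> * forr n z) / 2"
proof -
  have "(\<Sum>j<2 * 2 ^ n. of_bool (i = j) * (z $ i * z $ j)) = 1" if "i < 2 * 2 ^ n" for i
  proof -
    have "(\<Sum>j<2 * 2 ^ n. of_bool (i = j) * (z $ i * z $ j)) = z $ i * z $ i"
      using that by (simp add: of_bool_def if_distrib[of "\<lambda>x. x * _"] cong: if_cong)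
    then show ?thesis using assms(2)[OF that] by auto
  qed
  then have diag: "(\<Sum>i<2 * 2 ^ n. \<Sum>j<2 * 2 ^ n. of_bool (i = j) * (z $ i * z $ j)) = 2 * 2 ^ n"
    by simp
  have obs: "(\<Sum>i<2 * 2 ^ n. \<Sum>j<2 * 2 ^ n. forr_obs n i j * (z $ i * z $ j)) = 2 * (2 ^ n * forr n z)"
  proof -
    let ?S = "\<Sum>i<2 ^ n. \<Sum>j<2 ^ n. hadamard n $$ (i, j) * z $ i * z $ (2 ^ n + j)"
    have "(\<Sum>i<2 * 2 ^ n. \<Sum>j<2 * 2 ^ n. forr_obs n i j * (z $ i * z $ j)) =
        ?S + (\<Sum>i<2 ^ n. \<Sum>j<2 ^ n. hadamard n $$ (j, i) * z $ j * z $ (2 ^ n + i))"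
      unfolding sum_two_halves by (simp add: forr_obs_def mult_ac)
    also have "\<dots> = 2 * ?S" by (subst (2) sum.swap) simp
    also have "?S = 2 ^ n * forr n z" unfolding forr_eq[OF assms(1)] by simp
    finally show ?thesis .
  qed
  have "(\<Sum>i<2 * 2 ^ n. \<Sum>j<2 * 2 ^ n. forr_proj n \<sigma> i j * (z $ i * z $ j)) =
      ((\<Sum>i<2 * 2 ^ n. \<Sum>j<2 * 2 ^ n. of_bool (i = j) * (z $ i * z $ j)) +
       \<sigma> * (\<Sum>i<2 * 2 ^ n. \<Sum>j<2 * 2 ^ n. forr_obs n i j * (z $ i * z $ j))) / 2"
    unfolding sum_distrib_left sum.distrib[symmetric] sum_divide_distrib
    by (intro sum.cong refl) (simp add: forr_proj_def field_simps)
  then show ?thesis unfolding diag obs by (simp add: field_simps)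
qed

text \<open>Both outcome probabilities (1 + forr)/2 and (1 - forr)/2 are squared norms of projected
  vectors.\<close>

lemma forr_abs_le:
  assumes "dim_vec z = 2 * 2 ^ n" "\<And>i. i < 2 * 2 ^ n \<Longrightarrow> z $ i = 1 \<or> z $ i = - 1"
  shows "\<bar>forr n z\<bar> \<le> 1"
proof -
  have "0 \<le> (1 + \<sigma> * forr n z) / 2" if "\<sigma> = 1 \<or> \<sigma> = - 1" for \<sigma>
  proof -
    have "(\<Sum>i<2 * 2 ^ n. \<Sum>j<2 * 2 ^ n. forr_proj n \<sigma> i j * (z $ i * z $ j)) =
        (\<Sum>i<2 * 2 ^ n. \<Sum>j<2 * 2 ^ n. \<Sum>l<2 * 2 ^ n. (forr_proj n \<sigma> l i * z $ i) * (forr_proj n \<sigma> l j * z $ j))"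
    proof (intro sum.cong refl)
      fix i j :: nat assume "i \<in> {..<2 * 2 ^ n}" "j \<in> {..<2 * 2 ^ n :: nat}"
      then have "forr_proj n \<sigma> i j * (z $ i * z $ j) =
          (\<Sum>l<2 * 2 ^ n. forr_proj n \<sigma> l i * forr_proj n \<sigma> l j) * (z $ i * z $ j)"
        using that by (simp only: forr_proj_idem lessThan_iff)
      also have "\<dots> =
          (\<Sum>l<2 * 2 ^ n. (forr_proj n \<sigma> l i * z $ i) * (forr_proj n \<sigma> l j * z $ j))"
        by (simp add: sum_distrib_left sum_distrib_right mult_ac)
      finally show "forr_proj n \<sigma> i j * (z $ i * z $ j) =
          (\<Sum>l<2 * 2 ^ n. (forr_proj n \<sigma> l i * z $ i) * (forr_proj n \<sigma> l j * z $ j))" .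
    qed
    also have "\<dots> = (\<Sum>i<2 * 2 ^ n. \<Sum>l<2 * 2 ^ n. \<Sum>j<2 * 2 ^ n. (forr_proj n \<sigma> l i * z $ i) * (forr_proj n \<sigma> l j * z $ j))"
      by (intro sum.cong refl sum.swap)
    also have "\<dots> = (\<Sum>l<2 * 2 ^ n. \<Sum>i<2 * 2 ^ n. \<Sum>j<2 * 2 ^ n. (forr_proj n \<sigma> l i * z $ i) * (forr_proj n \<sigma> l j * z $ j))"
      by (rule sum.swap)
    also have "\<dots> = (\<Sum>l<2 * 2 ^ n. (\<Sum>i<2 * 2 ^ n. forr_proj n \<sigma> l i * z $ i)\<^sup>2)"
      by (simp add: power2_eq_square sum_product)
    also have "\<dots> \<ge> 0" by (intro sum_nonneg) auto
    finally have "0 \<le> (\<Sum>i<2 * 2 ^ n. \<Sum>j<2 * 2 ^ n. forr_proj n \<sigma> i j * (z $ i * z $ j)) / (2 * 2 ^ n)"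
      by simp
    then show ?thesis using forr_proj_expect[where \<sigma> = \<sigma>, OF assms] by simp
  qed
  from this[of 1] this[of "- 1"] show ?thesis by simp
qed

section \<open>Concentration of independent biased signs\<close>

lemma exp_le_quadratic:
  fixes u :: real
  assumes "u \<le> 1"
  shows "exp u \<le> 1 + u + u\<^sup>2"
proof (cases "u \<ge> 0")
  case True
  then show ?thesis using assms by (intro exp_bound) auto
next
  case False
  then have "exp u \<le> 1 + u + u\<^sup>2 / 2" using exp_minus_le[of "- u"] by simp
  also have "\<dots> \<le> 1 + u + u\<^sup>2" by simp
  finally show ?thesis .
qed

text \<open>For a sign with mean \<open>f\<close> the centred variable has variance 1 - f^2 \<le> 1
  and modulus at most 2. The condition \<theta> \<le> 1/2 keeps the exponent at most 1, where exp u
  \<le> 1 + u + u^2.\<close>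

lemma sign_mgf_le:
  fixes f \<theta> \<tau> :: real
  assumes "\<bar>f\<bar> \<le> 1" "0 \<le> \<theta>" "\<theta> \<le> 1 / 2" "\<tau> = 1 \<or> \<tau> = - 1"
  shows "(1 + f) / 2 * exp (\<theta> * (\<tau> * (1 - f))) + (1 - f) / 2 * exp (\<theta> * (\<tau> * (- 1 - f))) \<le> exp (\<theta>\<^sup>2)"
proof -
  define u1 u2 where "u1 = \<theta> * (\<tau> * (1 - f))" and "u2 = \<theta> * (\<tau> * (- 1 - f))"
  have b: "\<theta> * (\<tau> * a) \<le> 1" if "\<bar>a\<bar> \<le> 2" for a
  proof -
    have "\<tau> * a \<le> 2" using that assms(4) by auto
    then have "\<theta> * (\<tau> * a) \<le> \<theta> * 2" using assms by (intro mult_left_mono) auto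
    then show ?thesis using assms by linarith
  qed
  have "(1 + f) / 2 * exp u1 + (1 - f) / 2 * exp u2 \<le> (1 + f) / 2 * (1 + u1 + u1\<^sup>2) + (1 - f) / 2 * (1 + u2 + u2\<^sup>2)"
    using assms(1) unfolding u1_def u2_def
    by (intro add_mono mult_left_mono exp_le_quadratic b) auto
  also have "\<dots> = 1 + (\<tau> * \<tau>) * \<theta>\<^sup>2 * (1 - f\<^sup>2)"
    unfolding u1_def u2_def by (simp add: field_simps power2_eq_square)
  also have "\<dots> \<le> 1 + \<theta>\<^sup>2"
  proof -
    have "\<tau> * \<tau> = 1" using assms by auto
    moreover have "\<theta>\<^sup>2 * (1 - f\<^sup>2) \<le> \<theta>\<^sup>2 * 1" by (intro mult_left_mono) auto
    ultimately show ?thesis by simp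
  qed
  also have "\<dots> \<le> exp (\<theta>\<^sup>2)" by (rule exp_ge_add_one_self)
  finally show ?thesis unfolding u1_def u2_def .
qed

text \<open>Chernoff's method on the signs in \<open>B\<close>, while the remaining signs sum out to
  1; \<tau> selects the tail.\<close>

lemma sign_product_tail:
  fixes f :: "nat \<Rightarrow> real" and \<delta> \<tau> :: real
  assumes f: "\<And>c. c < L \<Longrightarrow> \<bar>f c\<bar> \<le> 1" and \<delta>: "0 \<le> \<delta>" "\<delta> \<le> 1" and \<tau>: "\<tau> = 1 \<or> \<tau> = - 1" and B: "B \<subseteq> {..<L}"
  shows "(\<Sum>s | s \<in> cube {..<L} \<and> card B * \<delta> \<le> (\<Sum>c\<in>B. \<tau> * (s c - f c)). \<Prod>c<L. (1 + s c * f c) / 2)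
    \<le> exp (- real (card B) * \<delta>\<^sup>2 / 4)"
proof -
  define \<mu> where "\<mu> s = (\<Prod>c<L. (1 + s c * f c) / 2)" for s
  \<comment> \<open>Minimises \<theta>^2 - \<theta> \<delta>, with value -\<delta>^2 / 4.\<close>
  define \<theta> where "\<theta> = \<delta> / 2"
  have finB: "finite B" using B finite_subset by blast
  have \<mu>0: "\<mu> s \<ge> 0" if "s \<in> cube {..<L}" for s
    unfolding \<mu>_def
  proof (rule prod_nonneg)
    fix c assume "c \<in> {..<L}"
    then show "0 \<le> (1 + s c * f c) / 2" using cube_val[OF that, of c] f[of c] by auto
  qed
  have "(\<Sum>s | s \<in> cube {..<L} \<and> card B * \<delta> \<le> (\<Sum>c\<in>B. \<tau> * (s c - f c)). \<mu> s) \<le>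
      (\<Sum>s | s \<in> cube {..<L} \<and> card B * \<delta> \<le> (\<Sum>c\<in>B. \<tau> * (s c - f c)). \<mu> s * exp (\<theta> * ((\<Sum>c\<in>B. \<tau> * (s c - f c)) - card B * \<delta>)))"
  proof (rule sum_mono)
    fix s assume s: "s \<in> {s. s \<in> cube {..<L} \<and> card B * \<delta> \<le> (\<Sum>c\<in>B. \<tau> * (s c - f c))}"
    then have "1 \<le> exp (\<theta> * ((\<Sum>c\<in>B. \<tau> * (s c - f c)) - card B * \<delta>))"
      using \<delta> by (simp add: \<theta>_def)
    then have "\<mu> s * 1 \<le> \<mu> s * exp (\<theta> * ((\<Sum>c\<in>B. \<tau> * (s c - f c)) - card B * \<delta>))"
      using \<mu>0 s by (intro mult_left_mono) auto
    then show "\<mu> s \<le> \<mu> s * exp (\<theta> * ((\<Sum>c\<in>B. \<tau> * (s c - f c)) - card B * \<delta>))" by simp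
  qed
  also have "\<dots> \<le> (\<Sum>s\<in>cube {..<L}. \<mu> s * exp (\<theta> * ((\<Sum>c\<in>B. \<tau> * (s c - f c)) - card B * \<delta>)))"
    using \<mu>0 by (intro sum_mono2) auto
  also have "\<dots> = exp (- \<theta> * (card B * \<delta>)) * (\<Sum>s\<in>cube {..<L}. \<Prod>c<L. (1 + s c * f c) / 2 * (if c \<in> B then exp (\<theta> * (\<tau> * (s c - f c))) else 1))"
  proof -
    have "exp (\<theta> * ((\<Sum>c\<in>B. \<tau> * (s c - f c)) - card B * \<delta>)) = exp (- \<theta> * (card B * \<delta>)) * (\<Prod>c<L. if c \<in> B then exp (\<theta> * (\<tau> * (s c - f c))) else 1)" for s
    proof -
      have "(\<Prod>c<L. if c \<in> B then exp (\<theta> * (\<tau> * (s c - f c))) else 1) = (\<Prod>c\<in>B. exp (\<theta> * (\<tau> * (s c - f c))))"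
        using B by (intro prod.mono_neutral_cong_right) auto
      also have "\<dots> = exp (\<theta> * (\<Sum>c\<in>B. \<tau> * (s c - f c)))"
        using finB by (simp add: exp_sum sum_distrib_left)
      finally show ?thesis by (simp add: algebra_simps flip: exp_add)
    qed
    then show ?thesis unfolding \<mu>_def prod.distrib sum_distrib_left by (simp add: mult_ac)
  qed
  also have "(\<Sum>s\<in>cube {..<L}. \<Prod>c<L. (1 + s c * f c) / 2 * (if c \<in> B then exp (\<theta> * (\<tau> * (s c - f c))) else 1)) =
      (\<Prod>c<L. (1 + 1 * f c) / 2 * (if c \<in> B then exp (\<theta> * (\<tau> * (1 - f c))) else 1) +
        (1 + (- 1) * f c) / 2 * (if c \<in> B then exp (\<theta> * (\<tau> * (- 1 - f c))) else 1))"
    by (rule sum_cube_prod[where f = "\<lambda>c v. (1 + v * f c) / 2 * (if c \<in> B then exp (\<theta> * (\<tau> * (v - f c))) else 1)"]) simp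
  also have "\<dots> \<le> (\<Prod>c<L. if c \<in> B then exp (\<theta>\<^sup>2) else 1)"
  proof (rule prod_mono, rule conjI)
    fix c assume c: "c \<in> {..<L}"
    have fc: "0 \<le> 1 + f c" "0 \<le> 1 - f c" using f[of c] c by auto
    then show "0 \<le> (1 + 1 * f c) / 2 * (if c \<in> B then exp (\<theta> * (\<tau> * (1 - f c))) else 1) +
        (1 + (- 1) * f c) / 2 * (if c \<in> B then exp (\<theta> * (\<tau> * (- 1 - f c))) else 1)" by simp
    show "(1 + 1 * f c) / 2 * (if c \<in> B then exp (\<theta> * (\<tau> * (1 - f c))) else 1) +
        (1 + (- 1) * f c) / 2 * (if c \<in> B then exp (\<theta> * (\<tau> * (- 1 - f c))) else 1) \<le> (if c \<in> B then exp (\<theta>\<^sup>2) else 1)"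
      using sign_mgf_le[of "f c" \<theta> \<tau>] f[of c] c \<delta> \<tau> by (auto simp: \<theta>_def field_simps)
  qed
  also have "(\<Prod>c<L. if c \<in> B then exp (\<theta>\<^sup>2) else 1) = (\<Prod>c\<in>B. exp (\<theta>\<^sup>2))"
    using B by (intro prod.mono_neutral_cong_right) auto
  also have "exp (- \<theta> * (card B * \<delta>)) * \<dots> = exp (- real (card B) * \<delta>\<^sup>2 / 4)"
    by (simp add: \<theta>_def exp_of_nat_mult[symmetric] power2_eq_square flip: exp_add)
  finally show ?thesis unfolding \<mu>_def by simp
qed

section \<open>The referee's joint measurement\<close>

definition qdim :: "nat \<Rightarrow> nat \<Rightarrow> nat" where
  "qdim n L = (2 * 2 ^ n) ^ L"

lemma qdim_pos [simp]: "qdim n L > 0"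
  by (simp add: qdim_def)

lemma two_power_qdim: "2 ^ ((n + 1) * L) = qdim n L"
  unfolding qdim_def by (simp only: power_mult) simp

definition tensor_proj :: "nat \<Rightarrow> nat \<Rightarrow> (nat \<Rightarrow> real) \<Rightarrow> nat \<Rightarrow> nat \<Rightarrow> real" where
  "tensor_proj n L s a b = (\<Prod>c<L. forr_proj n (s c) (digit (2 * 2 ^ n) a c) (digit (2 * 2 ^ n) b c))"

lemma tensor_proj_idem:
  assumes "s \<in> cube {..<L}"
  shows "(\<Sum>l<qdim n L. tensor_proj n L s l a * tensor_proj n L s l b) = tensor_proj n L s a b"
proof -
  have "(\<Sum>l<qdim n L. tensor_proj n L s l a * tensor_proj n L s l b) =
      (\<Prod>c<L. \<Sum>i<2 * 2 ^ n. forr_proj n (s c) i (digit (2 * 2 ^ n) a c) * forr_proj n (s c) i (digit (2 * 2 ^ n) b c))"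
    unfolding tensor_proj_def prod.distrib[symmetric] qdim_def
    by (rule sum_prod_digits[where f = "\<lambda>c i. forr_proj n (s c) i (digit (2 * 2 ^ n) a c) * forr_proj n (s c) i (digit (2 * 2 ^ n) b c)"]) simp
  also have "\<dots> = tensor_proj n L s a b"
    unfolding tensor_proj_def
  proof (rule prod.cong[OF refl])
    fix c assume "c \<in> {..<L}"
    then have "s c = 1 \<or> s c = - 1" using cube_val[OF assms, of c] by auto
    then show "(\<Sum>i<2 * 2 ^ n. forr_proj n (s c) i (digit (2 * 2 ^ n) a c) * forr_proj n (s c) i (digit (2 * 2 ^ n) b c)) =
        forr_proj n (s c) (digit (2 * 2 ^ n) a c) (digit (2 * 2 ^ n) b c)"
      by (intro forr_proj_idem digit_less) auto
  qed
  finally show ?thesis .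
qed

lemma sum_tensor_proj:
  assumes "a < qdim n L" "b < qdim n L"
  shows "(\<Sum>s\<in>cube {..<L}. tensor_proj n L s a b) = of_bool (a = b)"
proof -
  have "(\<Sum>s\<in>cube {..<L}. tensor_proj n L s a b) =
      (\<Prod>c<L. forr_proj n 1 (digit (2 * 2 ^ n) a c) (digit (2 * 2 ^ n) b c) + forr_proj n (- 1) (digit (2 * 2 ^ n) a c) (digit (2 * 2 ^ n) b c))"
    unfolding tensor_proj_def
    by (rule sum_cube_prod[where f = "\<lambda>c \<sigma>. forr_proj n \<sigma> (digit (2 * 2 ^ n) a c) (digit (2 * 2 ^ n) b c)"]) simp
  also have "\<dots> = (\<Prod>c<L. of_bool (digit (2 * 2 ^ n) a c = digit (2 * 2 ^ n) b c))"
    by (intro prod.cong refl) (simp add: forr_proj_def add_divide_distrib[symmetric])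
  also have "\<dots> = of_bool (a = b)" by (rule prod_digits_eq[OF assms[unfolded qdim_def]])
  finally show ?thesis .
qed

text \<open>
  The basis vector \<open>|a\<rangle>|b\<rangle>\<close> has index \<open>a * D + b\<close>. The players' messages are supported on \<open>a = b\<close>,
  where the referee measures the tensor power of the observable; \<open>e\<close> says whether the outcome also
  receives the orthogonal complement of that subspace.
\<close>

definition referee_mat :: "nat \<Rightarrow> nat \<Rightarrow> (nat \<Rightarrow> real) set \<Rightarrow> bool \<Rightarrow> complex mat" where
  "referee_mat n L S e = mat (qdim n L * qdim n L) (qdim n L * qdim n L) (\<lambda>(i, j).
     complex_of_real (if i div qdim n L = i mod qdim n L \<and> j div qdim n L = j mod qdim n L
       then \<Sum>s\<in>S. tensor_proj n L s (i div qdim n L) (j div qdim n L) else of_bool (e \<and> i = j)))"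

lemma referee_mat_index:
  "i < qdim n L * qdim n L \<Longrightarrow> j < qdim n L * qdim n L \<Longrightarrow> referee_mat n L S e $$ (i, j) =
     complex_of_real (if i div qdim n L = i mod qdim n L \<and> j div qdim n L = j mod qdim n L
       then \<Sum>s\<in>S. tensor_proj n L s (i div qdim n L) (j div qdim n L) else of_bool (e \<and> i = j))"
  unfolding referee_mat_def by (subst index_mat) (simp_all only: case_prod_conv)

lemma referee_mat_dim [simp]:
  "dim_row (referee_mat n L S e) = qdim n L * qdim n L" "dim_col (referee_mat n L S e) = qdim n L * qdim n L"
  by (simp_all add: referee_mat_def)

text \<open>A Gram representation over a disjoint union: the left summand holds the rows of the
  projections, supported on a = b, and the right one the basis vectors off that subspace.\<close>

lemma psd_referee_mat:
  assumes "S \<subseteq> cube {..<L}"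
  shows "psd (qdim n L * qdim n L) (referee_mat n L S e)"
proof -
  define D where "D = (qdim n L :: nat)"
  define diag where "diag i \<longleftrightarrow> i div D = i mod D" for i
  define \<Lambda> where "\<Lambda> = (S \<times> {..<D}) <+> (if e then {..<D * D} else {})"
  define g where "g l i = (case l of Inl p \<Rightarrow> if diag i then tensor_proj n L (fst p) (snd p) (i div D) else 0
      | Inr h \<Rightarrow> of_bool (h = i \<and> \<not> diag i))" for l :: "((nat \<Rightarrow> real) \<times> nat) + nat" and i
  have finS: "finite S" using finite_subset[OF assms] by simp
  have "referee_mat n L S e = mat (D * D) (D * D) (\<lambda>(i, j). complex_of_real (\<Sum>l\<in>\<Lambda>. g l i * g l j))"
  proof (rule eq_matI)
    fix i j assume "i < dim_row (mat (D * D) (D * D) (\<lambda>(i, j). complex_of_real (\<Sum>l\<in>\<Lambda>. g l i * g l j)))"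
      "j < dim_col (mat (D * D) (D * D) (\<lambda>(i, j). complex_of_real (\<Sum>l\<in>\<Lambda>. g l i * g l j)))"
    then have ij: "i < D * D" "j < D * D" by auto
    have "(\<Sum>l\<in>\<Lambda>. g l i * g l j) = (\<Sum>p\<in>S \<times> {..<D}. g (Inl p) i * g (Inl p) j) + (\<Sum>h\<in>(if e then {..<D * D} else {}). g (Inr h) i * g (Inr h) j)"
      unfolding \<Lambda>_def using finS by (subst sum.Plus) auto
    also have "(\<Sum>p\<in>S \<times> {..<D}. g (Inl p) i * g (Inl p) j) =
        (if diag i \<and> diag j then \<Sum>s\<in>S. tensor_proj n L s (i div D) (j div D) else 0)"
    proof -
      have "(\<Sum>p\<in>S \<times> {..<D}. tensor_proj n L (fst p) (snd p) (i div D) * tensor_proj n L (fst p) (snd p) (j div D)) =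
          (\<Sum>s\<in>S. \<Sum>l<D. tensor_proj n L s l (i div D) * tensor_proj n L s l (j div D))"
        by (simp add: sum.cartesian_product case_prod_unfold)
      also have "\<dots> = (\<Sum>s\<in>S. tensor_proj n L s (i div D) (j div D))"
        using assms unfolding D_def by (intro sum.cong refl tensor_proj_idem) auto
      finally show ?thesis by (auto simp: g_def)
    qed
    also have "(\<Sum>h\<in>(if e then {..<D * D} else {}). g (Inr h) i * g (Inr h) j) = of_bool (e \<and> i = j \<and> \<not> diag i)"
    proof -
      have "(\<Sum>h<D * D. of_bool (h = i \<and> \<not> diag i) * of_bool (h = j \<and> \<not> diag j)) = (\<Sum>h<D * D. if h = i then of_bool (i = j \<and> \<not> diag i) else 0 :: real)"
        by (intro sum.cong refl) auto
      then show ?thesis using ij by (auto simp: g_def)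
    qed
    also have "(if diag i \<and> diag j then \<Sum>s\<in>S. tensor_proj n L s (i div D) (j div D) else 0) + of_bool (e \<and> i = j \<and> \<not> diag i) =
        (if diag i \<and> diag j then \<Sum>s\<in>S. tensor_proj n L s (i div D) (j div D) else of_bool (e \<and> i = j))"
      by auto
    finally show "referee_mat n L S e $$ (i, j) = mat (D * D) (D * D) (\<lambda>(i, j). complex_of_real (\<Sum>l\<in>\<Lambda>. g l i * g l j)) $$ (i, j)"
      using ij by (simp only: index_mat case_prod_conv referee_mat_index D_def diag_def)
  qed (simp_all add: D_def)
  moreover have "finite \<Lambda>" using finS by (simp add: \<Lambda>_def)
  ultimately show ?thesis unfolding D_def[symmetric] by (simp only: psd_gram)
qed

lemma referee_mat_add:
  assumes "S \<subseteq> cube {..<L}"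
  shows "referee_mat n L S False + referee_mat n L (cube {..<L} - S) True = 1\<^sub>m (qdim n L * qdim n L)"
proof (rule eq_matI)
  let ?D = "qdim n L :: nat"
  fix i j assume "i < dim_row (1\<^sub>m (?D * ?D))" "j < dim_col (1\<^sub>m (?D * ?D))"
  then have ij: "i < ?D * ?D" "j < ?D * ?D" by auto
  have "(\<Sum>s\<in>S. tensor_proj n L s a b) + (\<Sum>s\<in>cube {..<L} - S. tensor_proj n L s a b) = of_bool (a = b)" if "a < ?D" "b < ?D" for a b
    using sum_tensor_proj[OF that] assms by (simp add: sum.subset_diff[OF assms] add.commute)
  moreover have "i div ?D < ?D" "j div ?D < ?D" using ij by (auto simp: less_mult_imp_div_less)
  moreover have "i = j \<longleftrightarrow> i div ?D = j div ?D" if "i div ?D = i mod ?D" "j div ?D = j mod ?D"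
    using that by (metis div_mult_mod_eq)
  ultimately show "(referee_mat n L S False + referee_mat n L (cube {..<L} - S) True) $$ (i, j) = 1\<^sub>m (?D * ?D) $$ (i, j)"
    using ij by (auto simp: referee_mat_index simp flip: of_real_add of_real_sum)
qed auto

section \<open>The players' messages and the distribution of outcomes\<close>

definition phase :: "nat \<Rightarrow> nat \<Rightarrow> nat \<Rightarrow> real vec \<Rightarrow> nat \<Rightarrow> real" where
  "phase n r L x a = (\<Prod>c<L. x $ (c div r * (2 * 2 ^ n) + digit (2 * 2 ^ n) a c))"

text \<open>A diagonal sign unitary. The \<open>L\<close> copies come in groups of \<open>r\<close>,
  copy \<open>c\<close> serving block c div r, so \<open>phase\<close> reads that block of the input
  at the digit of copy \<open>c\<close>.\<close>

definition phase_mat :: "nat \<Rightarrow> nat \<Rightarrow> nat \<Rightarrow> real vec \<Rightarrow> complex mat" where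
  "phase_mat n r L x = mat (qdim n L) (qdim n L)
     (\<lambda>(i, j). if i = j then complex_of_real (phase n r L x i) else 0)"

lemma block_index:
  fixes c i k r n :: nat
  assumes "c < k * r" "i < 2 * 2 ^ n"
  shows "c div r < k" "c div r * (2 * 2 ^ n) + i < 2 * k * 2 ^ n"
proof -
  show *: "c div r < k" using assms(1) by (rule less_mult_imp_div_less)
  have "c div r * (2 * 2 ^ n) + i < Suc (c div r) * (2 * 2 ^ n)" using assms by simp
  also have "\<dots> \<le> k * (2 * 2 ^ n)" using * by (intro mult_right_mono) auto
  finally show "c div r * (2 * 2 ^ n) + i < 2 * k * 2 ^ n" by (simp add: mult_ac)
qed

lemma comm_inputs_val:
  assumes "x \<in> comm_inputs n k" "t < 2 * k * 2 ^ n"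
  shows "x $ t = 1 \<or> x $ t = - 1"
  using assms by (auto simp: comm_inputs_def sign_cube_def)

lemma phase_square:
  assumes "x \<in> comm_inputs n k"
  shows "phase n r (k * r) x a * phase n r (k * r) x a = 1"
  unfolding phase_def prod.distrib[symmetric]
proof (rule prod.neutral, rule ballI)
  fix c assume "c \<in> {..<k * r}"
  then have "c div r * (2 * 2 ^ n) + digit (2 * 2 ^ n) a c < 2 * k * 2 ^ n"
    by (intro block_index digit_less) auto
  from comm_inputs_val[OF assms this]
  show "x $ (c div r * (2 * 2 ^ n) + digit (2 * 2 ^ n) a c) * x $ (c div r * (2 * 2 ^ n) + digit (2 * 2 ^ n) a c) = 1" by auto
qed

lemma kraus_phase_mat:
  assumes "x \<in> comm_inputs n k"
  shows "kraus_ops ((n + 1) * (k * r)) ((n + 1) * (k * r)) [phase_mat n r (k * r) x]"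
proof -
  have D: "(2::nat) ^ ((n + 1) * (k * r)) = qdim n (k * r)" by (rule two_power_qdim)
  let ?D = "qdim n (k * r) :: nat"
  have "mat_adjoint (phase_mat n r (k * r) x) * phase_mat n r (k * r) x = 1\<^sub>m ?D"
  proof (rule eq_matI)
    fix i j assume "i < dim_row (1\<^sub>m ?D)" "j < dim_col (1\<^sub>m ?D)"
    then have ij: "i < ?D" "j < ?D" by auto
    have "(mat_adjoint (phase_mat n r (k * r) x) * phase_mat n r (k * r) x) $$ (i, j) =
        (\<Sum>l<?D. if l = i then (if i = j then complex_of_real (phase n r (k * r) x i * phase n r (k * r) x i) else 0) else 0)"
      using ij by (auto simp: scalar_prod_def phase_mat_def mat_adjoint_index atLeast0LessThan intro!: sum.neutral)
        (auto intro!: trans[OF sum.cong[OF refl] sum.delta[THEN trans]] simp: if_distrib)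
    also have "\<dots> = 1\<^sub>m ?D $$ (i, j)" using ij unfolding phase_square[OF assms] by simp
    finally show "(mat_adjoint (phase_mat n r (k * r) x) * phase_mat n r (k * r) x) $$ (i, j) = 1\<^sub>m ?D $$ (i, j)" .
  qed (auto simp: phase_mat_def)
  then show ?thesis unfolding kraus_ops_def D by (simp add: phase_mat_def)
qed

text \<open>EPR pairs are supported on a = b, where the two phases multiply to the phase of the
  coordinatewise product: the state carries the XOR although neither player knows it.\<close>

lemma kron_phase_epr:
  fixes n L :: nat
  defines "D \<equiv> qdim n L"
  shows "kron (phase_mat n r L x) (phase_mat n r L y) *\<^sub>v epr_state ((n + 1) * L) =
    vec (D * D) (\<lambda>i. complex_of_real (if i div D = i mod D then phase n r L x (i div D) * phase n r L y (i div D) / sqrt D else 0))"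
proof (rule eq_vecI)
  have D: "(2::nat) ^ ((n + 1) * L) = D" unfolding D_def by (rule two_power_qdim)
  have Dr: "(2::real) ^ ((n + 1) * L) = real D" unfolding D[symmetric] by simp
  have epr: "epr_state ((n + 1) * L) = vec (D * D) (\<lambda>i. if i div D = i mod D then complex_of_real (1 / sqrt D) else 0)"
    unfolding epr_state_def D Dr ..
  have D0: "D > 0" by (simp add: D_def)
  let ?\<phi> = "vec (D * D) (\<lambda>i. complex_of_real (if i div D = i mod D then phase n r L x (i div D) * phase n r L y (i div D) / sqrt D else 0))"
  fix i assume "i < dim_vec ?\<phi>"
  then have i: "i < D * D" by simp
  have dm: "t div D < D" "t mod D < D" if "t < D * D" for t using that D0 by (auto simp: less_mult_imp_div_less)
  have eq: "i = j \<longleftrightarrow> i div D = j div D \<and> i mod D = j mod D" for j by (metis div_mult_mod_eq)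
  have "(kron (phase_mat n r L x) (phase_mat n r L y) *\<^sub>v epr_state ((n + 1) * L)) $ i =
      (\<Sum>j<D * D. kron (phase_mat n r L x) (phase_mat n r L y) $$ (i, j) * epr_state ((n + 1) * L) $ j)"
    using i unfolding epr by (simp add: scalar_prod_def kron_def phase_mat_def D_def[symmetric] atLeast0LessThan)
  also have "\<dots> = (\<Sum>j<D * D. if j = i then complex_of_real (phase n r L x (i div D) * phase n r L y (i mod D)) * epr_state ((n + 1) * L) $ i else 0)"
  proof (intro sum.cong refl)
    fix j assume "j \<in> {..<D * D}"
    then have j: "j < D * D" by simp
    show "kron (phase_mat n r L x) (phase_mat n r L y) $$ (i, j) * epr_state ((n + 1) * L) $ j =
        (if j = i then complex_of_real (phase n r L x (i div D) * phase n r L y (i mod D)) * epr_state ((n + 1) * L) $ i else 0)"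
      using i j dm[OF i] dm[OF j] eq[of j] by (auto simp: kron_def phase_mat_def D_def[symmetric])
  qed
  also have "\<dots> = ?\<phi> $ i"
    using i unfolding epr by auto
  finally show "(kron (phase_mat n r L x) (phase_mat n r L y) *\<^sub>v epr_state ((n + 1) * L)) $ i = ?\<phi> $ i" .
qed (simp_all add: kron_def phase_mat_def D_def)

text \<open>The state lives on the basis vectors with a = b, so the double sum runs over D indices
  and the complement of that subspace has probability 0.\<close>

lemma referee_prob:
  fixes n L :: nat and \<psi> :: "nat \<Rightarrow> real"
  defines "D \<equiv> qdim n L"
  defines "\<phi> \<equiv> vec (D * D) (\<lambda>i. complex_of_real (if i div D = i mod D then \<psi> (i div D) else 0))"
  shows "Re ((referee_mat n L S e *\<^sub>v \<phi>) \<bullet>c \<phi>) = (\<Sum>s\<in>S. \<Sum>a<D. \<Sum>b<D. tensor_proj n L s a b * (\<psi> a * \<psi> b))"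
proof -
  have D0: "D > 0" by (simp add: D_def)
  let ?T = "\<lambda>a b. \<Sum>s\<in>S. tensor_proj n L s a b"
  have sum_diag: "(\<Sum>i<D * D. if i div D = i mod D then f (i div D) else 0) = (\<Sum>a<D. f a)" for f :: "nat \<Rightarrow> complex"
  proof -
    have "(\<Sum>b<D. if (a * D + b) div D = (a * D + b) mod D then f ((a * D + b) div D) else 0) = f a" if "a < D" for a
    proof -
      have "(\<Sum>b<D. if (a * D + b) div D = (a * D + b) mod D then f ((a * D + b) div D) else 0) = (\<Sum>b<D. if a = b then f a else 0)"
        by (intro sum.cong refl) auto
      then show ?thesis using that by simp
    qed
    then show ?thesis unfolding sum_blocks[OF D0] by simp
  qed
  have "(referee_mat n L S e *\<^sub>v \<phi>) \<bullet>c \<phi> = (\<Sum>i<D * D. \<Sum>j<D * D. referee_mat n L S e $$ (i, j) * \<phi> $ j * cnj (\<phi> $ i))"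
    by (rule quad_form) (auto simp: \<phi>_def D_def)
  also have "\<dots> = (\<Sum>i<D * D. if i div D = i mod D then (\<Sum>j<D * D. if j div D = j mod D then
      complex_of_real (?T (i div D) (j div D) * (\<psi> (i div D) * \<psi> (j div D))) else 0) else 0)"
  proof (intro sum.cong refl)
    fix i assume "i \<in> {..<D * D}"
    then have i: "i < D * D" by simp
    have "referee_mat n L S e $$ (i, j) * \<phi> $ j * cnj (\<phi> $ i) = (if i div D = i mod D then (if j div D = j mod D then
      complex_of_real (?T (i div D) (j div D) * (\<psi> (i div D) * \<psi> (j div D))) else 0) else 0)" if "j < D * D" for j
      using i that referee_mat_index[OF i[unfolded D_def] that[unfolded D_def], folded D_def, of S e]
      by (simp add: \<phi>_def mult_ac del: of_real_sum)
    then show "(\<Sum>j<D * D. referee_mat n L S e $$ (i, j) * \<phi> $ j * cnj (\<phi> $ i)) =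
        (if i div D = i mod D then (\<Sum>j<D * D. if j div D = j mod D then
      complex_of_real (?T (i div D) (j div D) * (\<psi> (i div D) * \<psi> (j div D))) else 0) else 0)"
      by simp
  qed
  also have "\<dots> = (\<Sum>a<D. \<Sum>b<D. complex_of_real (?T a b * (\<psi> a * \<psi> b)))"
    unfolding sum_diag[where f = "\<lambda>b. complex_of_real (?T _ b * (\<psi> _ * \<psi> b))"]
    by (rule sum_diag[where f = "\<lambda>a. \<Sum>b<D. complex_of_real (?T a b * (\<psi> a * \<psi> b))"])
  also have "\<dots> = complex_of_real (\<Sum>a<D. \<Sum>b<D. \<Sum>s\<in>S. tensor_proj n L s a b * (\<psi> a * \<psi> b))"
    by (simp add: sum_distrib_right)
  also have "(\<Sum>a<D. \<Sum>b<D. \<Sum>s\<in>S. tensor_proj n L s a b * (\<psi> a * \<psi> b)) = (\<Sum>a<D. \<Sum>s\<in>S. \<Sum>b<D. tensor_proj n L s a b * (\<psi> a * \<psi> b))"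
    by (intro sum.cong refl sum.swap)
  also have "\<dots> = (\<Sum>s\<in>S. \<Sum>a<D. \<Sum>b<D. tensor_proj n L s a b * (\<psi> a * \<psi> b))"
    by (rule sum.swap)
  finally show ?thesis by simp
qed

lemma coord_prod_val:
  assumes "x \<in> comm_inputs n k" "y \<in> comm_inputs n k" "t < 2 * k * 2 ^ n"
  shows "coord_prod x y $ t = x $ t * y $ t" "coord_prod x y $ t = 1 \<or> coord_prod x y $ t = - 1"
proof -
  have "x \<in> carrier_vec (2 * k * 2 ^ n)" using assms(1) unfolding comm_inputs_def sign_cube_def by blast
  then have "dim_vec x = 2 * k * 2 ^ n" by (rule carrier_vecD)
  then show *: "coord_prod x y $ t = x $ t * y $ t"
    using assms(3) by (simp add: coord_prod_def)
  show "coord_prod x y $ t = 1 \<or> coord_prod x y $ t = - 1"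
    unfolding * using comm_inputs_val[OF assms(1,3)] comm_inputs_val[OF assms(2,3)] by auto
qed

lemma block_coord_prod_val:
  assumes "x \<in> comm_inputs n k" "y \<in> comm_inputs n k" "c < k * r" "i < 2 * 2 ^ n"
  shows "block (2 * 2 ^ n) (coord_prod x y) (c div r) $ i = 1 \<or> block (2 * 2 ^ n) (coord_prod x y) (c div r) $ i = - 1"
  using coord_prod_val(2)[OF assms(1,2) block_index(2)[OF assms(3,4)]] assms(4) by (simp add: block_def)

text \<open>State and projections are tensor products over the copies, so the outcomes are
  independent signs whose means are the Forrelations of their blocks.\<close>

lemma measurement_prob:
  fixes n k r :: nat
  defines "L \<equiv> k * r"
  defines "D \<equiv> qdim n L"
  assumes x: "x \<in> comm_inputs n k" and y: "y \<in> comm_inputs n k"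
  shows "(\<Sum>a<D. \<Sum>b<D. tensor_proj n L s a b *
      ((phase n r L x a * phase n r L y a / sqrt D) * (phase n r L x b * phase n r L y b / sqrt D))) =
    (\<Prod>c<L. (1 + s c * forr n (block (2 * 2 ^ n) (coord_prod x y) (c div r))) / 2)"
proof -
  let ?Q = "2 * 2 ^ n :: nat"
  define z where "z c = block ?Q (coord_prod x y) (c div r)" for c
  have Q0: "?Q > 0" by simp
  have ph: "phase n r L x a * phase n r L y a = (\<Prod>c<L. z c $ digit ?Q a c)" for a
    unfolding phase_def prod.distrib[symmetric]
  proof (rule prod.cong[OF refl])
    fix c assume "c \<in> {..<L}"
    then have c: "c < k * r" by (simp add: L_def)
    have d: "digit ?Q a c < ?Q" by (rule digit_less) simp
    show "x $ (c div r * ?Q + digit ?Q a c) * y $ (c div r * ?Q + digit ?Q a c) = z c $ digit ?Q a c"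
      using coord_prod_val(1)[OF x y block_index(2)[OF c d]] d by (simp add: z_def block_def)
  qed
  have "tensor_proj n L s a b * ((phase n r L x a * phase n r L y a / sqrt D) * (phase n r L x b * phase n r L y b / sqrt D)) =
      (\<Prod>c<L. forr_proj n (s c) (digit ?Q a c) (digit ?Q b c) * (z c $ digit ?Q a c * z c $ digit ?Q b c)) / D" for a b
    unfolding ph tensor_proj_def by (simp add: prod.distrib)
  then have "(\<Sum>a<D. \<Sum>b<D. tensor_proj n L s a b *
      ((phase n r L x a * phase n r L y a / sqrt D) * (phase n r L x b * phase n r L y b / sqrt D))) =
      (\<Sum>a<D. \<Sum>b<D. \<Prod>c<L. forr_proj n (s c) (digit ?Q a c) (digit ?Q b c) * (z c $ digit ?Q a c * z c $ digit ?Q b c)) / D"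
    by (simp only: sum_divide_distrib)
  also have "(\<Sum>a<D. \<Sum>b<D. \<Prod>c<L. forr_proj n (s c) (digit ?Q a c) (digit ?Q b c) * (z c $ digit ?Q a c * z c $ digit ?Q b c)) =
      (\<Prod>c<L. \<Sum>i<?Q. \<Sum>j<?Q. forr_proj n (s c) i j * (z c $ i * z c $ j))"
    unfolding D_def qdim_def
    by (rule sum_prod_digits2[OF Q0, where f = "\<lambda>c i j. forr_proj n (s c) i j * (z c $ i * z c $ j)"])
  also have "\<dots> / D = (\<Prod>c<L. (\<Sum>i<?Q. \<Sum>j<?Q. forr_proj n (s c) i j * (z c $ i * z c $ j)) / (2 * 2 ^ n))"
    unfolding D_def qdim_def by (simp add: prod_dividef)
  also have "\<dots> = (\<Prod>c<L. (1 + s c * forr n (z c)) / 2)"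
  proof (rule prod.cong[OF refl])
    fix c assume "c \<in> {..<L}"
    then have c: "c < k * r" by (simp add: L_def)
    show "(\<Sum>i<?Q. \<Sum>j<?Q. forr_proj n (s c) i j * (z c $ i * z c $ j)) / (2 * 2 ^ n) = (1 + s c * forr n (z c)) / 2"
      by (rule forr_proj_expect) (use block_coord_prod_val[OF x y c] in \<open>auto simp: z_def block_def\<close>)
  qed
  finally show ?thesis unfolding z_def .
qed

text \<open>3 \<epsilon> / 8 is the midpoint of the promise thresholds \<epsilon>/4 and
  \<epsilon>/2, which leaves a margin of \<epsilon>/8 on either side.\<close>

definition block_decision :: "real \<Rightarrow> nat \<Rightarrow> (nat \<Rightarrow> real) \<Rightarrow> nat \<Rightarrow> int" where
  "block_decision \<epsilon> r s j = (if 3 * \<epsilon> / 8 * real r \<le> (\<Sum>c\<in>{j * r..<j * r + r}. s c) then - 1 else 1)"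

lemma wrong_decision_prob:
  fixes f :: "nat \<Rightarrow> real"
  assumes f: "\<And>c. c < k * r \<Longrightarrow> \<bar>f c\<bar> \<le> 1" and j: "j < k" and \<epsilon>: "0 < \<epsilon>" "\<epsilon> \<le> 8"
    and fj: "\<And>c. c \<in> {j * r..<j * r + r} \<Longrightarrow> f c = g"
    and F: "F = - 1 \<and> g \<ge> \<epsilon> / 2 \<or> F = 1 \<and> g \<le> \<epsilon> / 4"
  shows "(\<Sum>s | s \<in> cube {..<k * r} \<and> block_decision \<epsilon> r s j \<noteq> F. \<Prod>c<k * r. (1 + s c * f c) / 2)
    \<le> exp (- real r * (\<epsilon> / 8)\<^sup>2 / 4)"
proof -
  let ?B = "{j * r..<j * r + r}"
  have "j * r + r \<le> k * r" using j mult_le_mono1[of "Suc j" k r] by simp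
  then have B: "?B \<subseteq> {..<k * r}" by auto
  \<comment> \<open>A block of value 1 is misread when its sum is too large, one of value -1 when it
    is too small.\<close>
  define \<tau> where "\<tau> = (if F = 1 then 1 else - 1 :: real)"
  have sub: "{s. s \<in> cube {..<k * r} \<and> block_decision \<epsilon> r s j \<noteq> F} \<subseteq>
      {s. s \<in> cube {..<k * r} \<and> card ?B * (\<epsilon> / 8) \<le> (\<Sum>c\<in>?B. \<tau> * (s c - f c))}"
  proof
    fix s assume s: "s \<in> {s. s \<in> cube {..<k * r} \<and> block_decision \<epsilon> r s j \<noteq> F}"
    have "(\<Sum>c\<in>?B. \<tau> * (s c - f c)) = (\<Sum>c\<in>?B. \<tau> * (s c - g))"
      using fj by (intro sum.cong refl) simp
    also have "\<dots> = \<tau> * ((\<Sum>c\<in>?B. s c) - real r * g)"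
      by (simp add: sum_subtractf flip: sum_distrib_left)
    also have "\<dots> \<ge> real r * (\<epsilon> / 8)"
    proof (cases "F = 1")
      case True
      then have "real r * g \<le> real r * (\<epsilon> / 4)" using F by (intro mult_left_mono) auto
      moreover have "3 * \<epsilon> / 8 * real r \<le> (\<Sum>c\<in>?B. s c)"
        using s True by (auto simp: block_decision_def split: if_splits)
      ultimately show ?thesis using True by (simp add: \<tau>_def algebra_simps)
    next
      case False
      then have "real r * g \<ge> real r * (\<epsilon> / 2)" using F by (intro mult_left_mono) auto
      moreover have "(\<Sum>c\<in>?B. s c) \<le> 3 * \<epsilon> / 8 * real r"
        using s False F by (auto simp: block_decision_def split: if_splits)
      ultimately show ?thesis using False by (simp add: \<tau>_def algebra_simps)
    qed
    finally show "s \<in> {s. s \<in> cube {..<k * r} \<and> card ?B * (\<epsilon> / 8) \<le> (\<Sum>c\<in>?B. \<tau> * (s c - f c))}"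
      using s by simp
  qed
  have "(\<Sum>s | s \<in> cube {..<k * r} \<and> block_decision \<epsilon> r s j \<noteq> F. \<Prod>c<k * r. (1 + s c * f c) / 2) \<le>
      (\<Sum>s | s \<in> cube {..<k * r} \<and> card ?B * (\<epsilon> / 8) \<le> (\<Sum>c\<in>?B. \<tau> * (s c - f c)). \<Prod>c<k * r. (1 + s c * f c) / 2)"
  proof (rule sum_mono2[OF _ sub])
    fix s assume "s \<in> {s. s \<in> cube {..<k * r} \<and> card ?B * (\<epsilon> / 8) \<le> (\<Sum>c\<in>?B. \<tau> * (s c - f c))} - {s. s \<in> cube {..<k * r} \<and> block_decision \<epsilon> r s j \<noteq> F}"
    then have s: "s \<in> cube {..<k * r}" by simp
    show "0 \<le> (\<Prod>c<k * r. (1 + s c * f c) / 2)"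
    proof (rule prod_nonneg)
      fix c assume "c \<in> {..<k * r}"
      then show "0 \<le> (1 + s c * f c) / 2" using cube_val[OF s, of c] f[of c] by auto
    qed
  qed simp
  also have "\<dots> \<le> exp (- real (card ?B) * (\<epsilon> / 8)\<^sup>2 / 4)"
    by (rule sign_product_tail[where \<delta> = "\<epsilon> / 8" and f = f and \<tau> = \<tau> and B = ?B and L = "k * r"])
      (use \<epsilon> B f in \<open>auto simp: \<tau>_def\<close>)
  finally show ?thesis by simp
qed

text \<open>The union bound, for weights known to be nonnegative only on the sets involved.\<close>

lemma sum_UN_le:
  fixes \<mu> :: "'a \<Rightarrow> real"
  assumes "finite J" "\<And>j. j \<in> J \<Longrightarrow> finite (A j)" "\<And>j s. j \<in> J \<Longrightarrow> s \<in> A j \<Longrightarrow> \<mu> s \<ge> 0"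
  shows "(\<Sum>s\<in>(\<Union>j\<in>J. A j). \<mu> s) \<le> (\<Sum>j\<in>J. \<Sum>s\<in>A j. \<mu> s)"
  using assms
proof (induction J rule: finite_induct)
  case (insert j J)
  let ?U = "\<Union>j\<in>J. A j"
  have "(\<Sum>s\<in>A j \<union> ?U. \<mu> s) + (\<Sum>s\<in>A j \<inter> ?U. \<mu> s) = (\<Sum>s\<in>A j. \<mu> s) + (\<Sum>s\<in>?U. \<mu> s)"
    using insert by (intro sum.union_inter) auto
  moreover have "(\<Sum>s\<in>A j \<inter> ?U. \<mu> s) \<ge> 0" using insert.prems by (intro sum_nonneg) auto
  moreover have "(\<Sum>s\<in>?U. \<mu> s) \<le> (\<Sum>j\<in>J. \<Sum>s\<in>A j. \<mu> s)" using insert.prems by (intro insert.IH) auto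
  ultimately show ?case using insert.hyps by simp
qed simp

text \<open>There are \<open>r\<close> copies for each block, and the second condition on
  \<open>r\<close> is the union bound over the \<open>k\<close> blocks.\<close>

lemma quantum_protocol:
  fixes n k r :: nat
  defines "\<epsilon> \<equiv> forr_eps n k"
  assumes \<epsilon>: "0 < \<epsilon>" "\<epsilon> \<le> 8" and r: "r > 0" "real k * exp (- real r * (\<epsilon> / 8)\<^sup>2 / 4) \<le> 1 / 3"
  shows "\<exists>P. qsmp_solves (comm_inputs n k) (comm_inputs n k) (forr_xor_comm n k) P \<and>
    qsmp_cost P = 2 * ((n + 1) * (k * r)) \<and> epr_pairs P = (n + 1) * (k * r)"
proof -
  define L where "L = k * r"
  define m where "m = (n + 1) * L"
  define D where "D = qdim n L"
  \<comment> \<open>The outcome strings decoded to -1. The classical postprocessing is folded into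
    the measurement: each referee operator collects all strings with its answer.\<close>
  define S where "S = {s \<in> cube {..<L}. (\<Prod>j<k. block_decision \<epsilon> r s j) = - 1}"
  define P where "P = \<lparr>epr_pairs = m, alice_qubits = m, bob_qubits = m,
    alice_channel = (\<lambda>x. [phase_mat n r L x]), bob_channel = (\<lambda>y. [phase_mat n r L y]),
    referee = (\<lambda>a. if a = - 1 then referee_mat n L S False else referee_mat n L (cube {..<L} - S) True)\<rparr>"
  have S: "S \<subseteq> cube {..<L}" by (auto simp: S_def)
  have dim: "(2::nat) ^ (m + m) = D * D" unfolding power_add m_def two_power_qdim D_def ..
  have valid: "qsmp_valid (comm_inputs n k) (comm_inputs n k) P"
  proof -
    have "kraus_ops m m [phase_mat n r L x]" if "x \<in> comm_inputs n k" for x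
      unfolding m_def L_def by (rule kraus_phase_mat[OF that])
    moreover note psd_referee_mat[OF S, of n False, folded D_def]
      psd_referee_mat[of "cube {..<L} - S" L n True, OF Diff_subset, folded D_def]
      referee_mat_add[OF S, of n, folded D_def]
    ultimately show ?thesis
      unfolding qsmp_valid_def P_def by (simp add: dim)
  qed
  have prob: "qsmp_prob P x y (the (forr_xor_comm n k x y)) \<ge> 2 / 3"
    if xy: "(x, y) \<in> promise (comm_inputs n k) (comm_inputs n k) (forr_xor_comm n k)" for x y
  proof -
    have x: "x \<in> comm_inputs n k" and y: "y \<in> comm_inputs n k" and dom: "forr_xor_comm n k x y \<noteq> None"
      using xy by (auto simp: promise_def)
    define z where "z j = block (2 * 2 ^ n) (coord_prod x y) j" for j
    define f where "f c = forr n (z (c div r))" for c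
    define F where "F j = the (forr_fun n k (z j))" for j
    define \<mu> where "\<mu> s = (\<Prod>c<L. (1 + s c * f c) / 2)" for s
    have Fdef: "forr_fun n k (z j) \<noteq> None" if "j < k" for j
      using dom that by (auto simp: forr_xor_comm_def forr_xor_fun_def z_def split: if_splits)
    have Fval: "F j = - 1 \<and> forr n (z j) \<ge> \<epsilon> / 2 \<or> F j = 1 \<and> forr n (z j) \<le> \<epsilon> / 4" if "j < k" for j
      using Fdef[OF that] by (auto simp: F_def forr_fun_def \<epsilon>_def split: if_splits)
    have val: "the (forr_xor_comm n k x y) = (\<Prod>j<k. F j)"
      using Fdef by (simp add: forr_xor_comm_def forr_xor_fun_def F_def z_def)
    have f1: "\<bar>f c\<bar> \<le> 1" if "c < k * r" for c
      unfolding f_def by (rule forr_abs_le) (use block_coord_prod_val[OF x y that] in \<open>auto simp: z_def block_def\<close>)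
    have \<mu>0: "\<mu> s \<ge> 0" if s: "s \<in> cube {..<L}" for s
      unfolding \<mu>_def
    proof (rule prod_nonneg)
      fix c assume "c \<in> {..<L}"
      then show "0 \<le> (1 + s c * f c) / 2" using cube_val[OF s, of c] f1[of c] by (auto simp: L_def)
    qed
    have \<mu>1: "(\<Sum>s\<in>cube {..<L}. \<mu> s) = 1"
    proof -
      have "(\<Sum>s\<in>cube {..<L}. \<mu> s) = (\<Prod>c<L. (1 + 1 * f c) / 2 + (1 + (- 1) * f c) / 2)"
        unfolding \<mu>_def by (rule sum_cube_prod[where f = "\<lambda>c v. (1 + v * f c) / 2"]) simp
      also have "\<dots> = 1" by (intro prod.neutral) (simp add: field_simps)
      finally show ?thesis .
    qed
    have outcome: "qsmp_prob P x y a = (\<Sum>s\<in>(if a = - 1 then S else cube {..<L} - S). \<mu> s)" for a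
    proof -
      have "qsmp_prob P x y a = Re ((referee P a *\<^sub>v (kron (phase_mat n r L x) (phase_mat n r L y) *\<^sub>v epr_state m)) \<bullet>c
          (kron (phase_mat n r L x) (phase_mat n r L y) *\<^sub>v epr_state m))"
        by (simp add: qsmp_prob_def P_def Let_def)
      also have "\<dots> = (\<Sum>s\<in>(if a = - 1 then S else cube {..<L} - S). \<Sum>a<D. \<Sum>b<D. tensor_proj n L s a b *
          ((phase n r L x a * phase n r L y a / sqrt D) * (phase n r L x b * phase n r L y b / sqrt D)))"
      proof -
        define \<psi> where "\<psi> a = phase n r L x a * phase n r L y a / sqrt D" for a
        have state: "kron (phase_mat n r L x) (phase_mat n r L y) *\<^sub>v epr_state m =
            vec (D * D) (\<lambda>i. complex_of_real (if i div D = i mod D then \<psi> (i div D) else 0))"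
          unfolding m_def kron_phase_epr D_def \<psi>_def ..
        have "referee P a = referee_mat n L (if a = - 1 then S else cube {..<L} - S) (a \<noteq> - 1)"
          by (simp add: P_def)
        then show ?thesis
          unfolding state using referee_prob[of n L "if a = - 1 then S else cube {..<L} - S" "a \<noteq> - 1" \<psi>, folded D_def]
          by (simp only: \<psi>_def)
      qed
      also have "\<dots> = (\<Sum>s\<in>(if a = - 1 then S else cube {..<L} - S). \<mu> s)"
        using measurement_prob[OF x y, of r] by (simp add: \<mu>_def f_def z_def L_def D_def)
      finally show ?thesis .
    qed
    define bad where "bad j = {s. s \<in> cube {..<L} \<and> block_decision \<epsilon> r s j \<noteq> F j}" for j
    define good where "good = cube {..<L} - (\<Union>j<k. bad j)"
    have "(\<Sum>s\<in>(\<Union>j<k. bad j). \<mu> s) \<le> (\<Sum>j<k. \<Sum>s\<in>bad j. \<mu> s)"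
      by (rule sum_UN_le) (auto simp: bad_def intro: \<mu>0)
    also have "\<dots> \<le> (\<Sum>j<k. exp (- real r * (\<epsilon> / 8)\<^sup>2 / 4))"
    proof (rule sum_mono)
      fix j assume "j \<in> {..<k}"
      then have j: "j < k" by simp
      have "f c = forr n (z j)" if "c \<in> {j * r..<j * r + r}" for c
      proof -
        have "c div r = j" using that r by (simp add: div_nat_eqI mult.commute)
        then show ?thesis by (simp add: f_def)
      qed
      then show "(\<Sum>s\<in>bad j. \<mu> s) \<le> exp (- real r * (\<epsilon> / 8)\<^sup>2 / 4)"
        unfolding bad_def \<mu>_def L_def by (intro wrong_decision_prob[OF f1 j \<epsilon> _ Fval[OF j]]) auto
    qed
    also have "\<dots> \<le> 1 / 3" using r by simp
    finally have badp: "(\<Sum>s\<in>(\<Union>j<k. bad j). \<mu> s) \<le> 1 / 3" .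
    have "(\<Sum>s\<in>good. \<mu> s) = 1 - (\<Sum>s\<in>(\<Union>j<k. bad j). \<mu> s)"
      unfolding good_def \<mu>1[symmetric] by (rule sum_diff) (auto simp: bad_def)
    then have goodp: "(\<Sum>s\<in>good. \<mu> s) \<ge> 2 / 3" using badp by simp
    have dec: "(\<Prod>j<k. block_decision \<epsilon> r s j) = (\<Prod>j<k. F j)" if "s \<in> good" for s
      using that by (intro prod.cong refl) (auto simp: good_def bad_def)
    have "good \<subseteq> (if (\<Prod>j<k. F j) = - 1 then S else cube {..<L} - S)"
      using dec by (auto simp: S_def good_def)
    then have "(\<Sum>s\<in>good. \<mu> s) \<le> (\<Sum>s\<in>(if (\<Prod>j<k. F j) = - 1 then S else cube {..<L} - S). \<mu> s)"
      using S by (intro sum_mono2) (auto intro: \<mu>0 finite_subset split: if_splits)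
    then show ?thesis unfolding val outcome using goodp by linarith
  qed
  have "qsmp_solves (comm_inputs n k) (comm_inputs n k) (forr_xor_comm n k) P"
    unfolding qsmp_solves_def using valid prob by auto
  moreover have "qsmp_cost P = 2 * ((n + 1) * (k * r))" "epr_pairs P = (n + 1) * (k * r)"
    by (simp_all add: qsmp_cost_def P_def m_def L_def)
  ultimately show ?thesis by blast
qed

section \<open>Asymptotics\<close>

lemma forr_eps_pos:
  assumes "n \<ge> 1" "k \<ge> 1"
  shows "forr_eps n k > 0"
  using assms by (auto simp: forr_eps_def intro!: divide_pos_pos mult_pos_pos)

lemma ln_two_power_bounds:
  assumes "n \<ge> 1"
  shows "real n / 2 \<le> ln (2 ^ n)" "ln (2 ^ n) \<le> real n"
proof -
  have "ln (1 / 2 :: real) \<le> 1 / 2 - 1" by (rule ln_le_minus_one) simp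
  then have "1 / 2 \<le> ln (2 :: real)" by (simp add: ln_div)
  then have "real n * (1 / 2) \<le> real n * ln 2" by (intro mult_left_mono) auto
  then show "real n / 2 \<le> ln (2 ^ n)" by (simp add: ln_realpow)
  have "ln (2 :: real) \<le> 2 - 1" by (rule ln_le_minus_one) simp
  then have "real n * ln 2 \<le> real n * 1" by (intro mult_left_mono) auto
  then show "ln (2 ^ n) \<le> real n" by (simp add: ln_realpow)
qed

lemma forr_eps_le:
  assumes "n \<ge> 1" "k \<ge> 1"
  shows "forr_eps n k \<le> 1 / (30 * real n)"
  unfolding forr_eps_def
proof (intro divide_left_mono)
  have "1 * (real n / 2) \<le> real k ^ 2 * ln (2 ^ n)"
    using ln_two_power_bounds(1)[OF assms(1)] assms(2) by (intro mult_mono) auto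
  then show "30 * real n \<le> 60 * real k ^ 2 * ln (2 ^ n)" by simp
  show "0 < 60 * real k ^ 2 * ln (2 ^ n) * (30 * real n)"
    using assms by (intro mult_pos_pos) auto
qed simp

lemma inverse_forr_eps_square_le:
  assumes "n \<ge> 1"
  shows "1 / (forr_eps n k)\<^sup>2 \<le> 3600 * real k ^ 4 * real n ^ 2"
proof -
  have "1 / (forr_eps n k)\<^sup>2 = 3600 * real k ^ 4 * (ln (2 ^ n))\<^sup>2"
    unfolding forr_eps_def by (simp add: power_divide power_mult_distrib flip: power_mult)
  also have "\<dots> \<le> 3600 * real k ^ 4 * real n ^ 2"
    using ln_two_power_bounds[OF assms] by (intro mult_left_mono power_mono) auto
  finally show ?thesis .
qed

text \<open>Each of the k r copies takes n + 1 qubits from each player, and r is of order ln(3k) /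
  \<epsilon>^2, where 1 / \<epsilon>^2 is of order k^4 n^2.\<close>

lemma quantum_upper_bound:
  assumes n: "n \<ge> 1" and k: "k \<ge> 1"
  shows "\<exists>P. qsmp_solves (comm_inputs n k) (comm_inputs n k) (forr_xor_comm n k) P \<and>
    real (qsmp_cost P) \<le> 12000000 * qsmp_bound n k \<and> real (epr_pairs P) \<le> 12000000 * qsmp_bound n k"
proof -
  define \<epsilon> where "\<epsilon> = forr_eps n k"
  define mx where "mx = max 1 (log 2 (real k))"
  \<comment> \<open>256 = 4 * 8^2 undoes the exponent r (\<epsilon>/8)^2 / 4, and ln(3k) turns the
    union bound into 1/3.\<close>
  define r where "r = nat \<lceil>256 * ln (3 * real k) / \<epsilon>\<^sup>2\<rceil>"
  have \<epsilon>0: "\<epsilon> > 0" using forr_eps_pos[OF n k] by (simp add: \<epsilon>_def)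
  have "\<epsilon> \<le> 1 / (30 * real n)" using forr_eps_le[OF n k] by (simp add: \<epsilon>_def)
  also have "\<dots> \<le> 8" using n by (simp add: field_simps)
  finally have \<epsilon>8: "\<epsilon> \<le> 8" .
  have ln0: "ln (3 * real k) > 0" using k by (intro ln_gt_zero) auto
  have r_ge: "256 * ln (3 * real k) / \<epsilon>\<^sup>2 \<le> real r" unfolding r_def by (rule real_nat_ceiling_ge)
  moreover have "256 * ln (3 * real k) / \<epsilon>\<^sup>2 > 0" using ln0 \<epsilon>0 by simp
  ultimately have r0: "r > 0" by (metis less_le_trans of_nat_0_less_iff)
  have "ln (3 * real k) \<le> real r * (\<epsilon> / 8)\<^sup>2 / 4"
    using r_ge \<epsilon>0 by (simp add: divide_le_eq power_divide)
  then have "exp (- real r * (\<epsilon> / 8)\<^sup>2 / 4) \<le> exp (- ln (3 * real k))" by simp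
  also have "\<dots> = 1 / (3 * real k)" using k by (simp add: exp_minus inverse_eq_divide)
  finally have "real k * exp (- real r * (\<epsilon> / 8)\<^sup>2 / 4) \<le> real k * (1 / (3 * real k))"
    by (intro mult_left_mono) auto
  also have "\<dots> = 1 / 3" using k by simp
  finally have err: "real k * exp (- real r * (\<epsilon> / 8)\<^sup>2 / 4) \<le> 1 / 3" .
  obtain P where P: "qsmp_solves (comm_inputs n k) (comm_inputs n k) (forr_xor_comm n k) P"
    "qsmp_cost P = 2 * ((n + 1) * (k * r))" "epr_pairs P = (n + 1) * (k * r)"
    using quantum_protocol[of n k r, folded \<epsilon>_def, OF \<epsilon>0 \<epsilon>8 r0 err] by blast
  have mx1: "mx \<ge> 1" by (simp add: mx_def)
  have k1: "real k \<ge> 1" and n1: "real n \<ge> 1" using n k by auto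
  have "ln (3 * real k) = ln 3 + ln (real k)" using k by (simp add: ln_mult)
  \<comment> \<open>\<open>mx\<close> is at least 1, so it absorbs this constant even for k =
    1.\<close>
  also have "ln (3 :: real) \<le> 2" using ln_le_minus_one[of "3 :: real"] by simp
  also have "ln (real k) \<le> mx"
  proof -
    have "ln (real k) = log 2 (real k) * ln 2" by (simp add: log_def)
    also have "\<dots> \<le> log 2 (real k) * 1"
      using ln_le_minus_one[of "2 :: real"] k1 by (intro mult_left_mono) auto
    finally show ?thesis by (simp add: mx_def)
  qed
  finally have ln3: "ln (3 * real k) \<le> 3 * mx" using mx1 by simp
  have X1: "1 \<le> real k ^ 4 * real n ^ 2 * mx"
    using mx1 k1 n1 mult_mono[of 1 "real k ^ 4 * real n ^ 2" 1 mx] mult_mono[of 1 "real k ^ 4" 1 "real n ^ 2"] by simp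
  have "real r \<le> 256 * ln (3 * real k) / \<epsilon>\<^sup>2 + 1"
  proof -
    have "0 \<le> 256 * ln (3 * real k) / \<epsilon>\<^sup>2" using ln0 by simp
    then have "real r = of_int \<lceil>256 * ln (3 * real k) / \<epsilon>\<^sup>2\<rceil>" unfolding r_def by simp
    then show ?thesis by linarith
  qed
  also have "256 * ln (3 * real k) / \<epsilon>\<^sup>2 = 256 * (ln (3 * real k) * (1 / \<epsilon>\<^sup>2))" by simp
  also have "\<dots> \<le> 256 * ((3 * mx) * (3600 * real k ^ 4 * real n ^ 2))"
    using ln3 ln0 inverse_forr_eps_square_le[OF n, of k] \<epsilon>0 mx1 unfolding \<epsilon>_def
    by (intro mult_left_mono mult_mono) auto
  \<comment> \<open>2764801 = 256 * 3 * 3600 + 1, the last 1 coming from rounding up. The factor 4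
    that follows is due to n + 1 \<le> 2 n and to the two messages.\<close>
  also have "\<dots> + 1 \<le> 2764801 * (real k ^ 4 * real n ^ 2 * mx)" using X1 by (simp add: mult_ac)
  finally have r_le: "real r \<le> 2764801 * (real k ^ 4 * real n ^ 2 * mx)" by simp
  have "real (2 * ((n + 1) * (k * r))) = 2 * ((real n + 1) * (real k * real r))" by (simp add: algebra_simps)
  also have "\<dots> \<le> 2 * ((2 * real n) * (real k * (2764801 * (real k ^ 4 * real n ^ 2 * mx))))"
    using r_le n1 by (intro mult_left_mono mult_mono) auto
  also have "\<dots> = 11059204 * (real k ^ 5 * real n ^ 3 * mx)"
    by (simp add: eval_nat_numeral mult_ac)
  also have "\<dots> \<le> 12000000 * (real k ^ 5 * real n ^ 3 * mx)"
    using mx1 by (intro mult_right_mono) auto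
  also have "real k ^ 5 * real n ^ 3 * mx = qsmp_bound n k"
    by (simp add: qsmp_bound_def mx_def log_nat_power)
  finally have "real (2 * ((n + 1) * (k * r))) \<le> 12000000 * qsmp_bound n k" .
  moreover have "real ((n + 1) * (k * r)) \<le> real (2 * ((n + 1) * (k * r)))"
    by (simp only: of_nat_le_iff)
  ultimately have "real (qsmp_cost P) \<le> 12000000 * qsmp_bound n k" "real (epr_pairs P) \<le> 12000000 * qsmp_bound n k"
    unfolding P(2,3) by linarith+
  with P(1) show ?thesis by blast
qed

text \<open>The conditions of \<open>classical_bound\<close> hold eventually with ample room: 1 /
  \<epsilon>^2 is at most 3600 k^4 n^2, that is N^(4/50) up to a power of log N, where a constant
  fraction of N would do.\<close>

lemma classical_lower_bound:
  assumes k: "\<And>n. k n \<ge> 1" "(\<lambda>n. real (k n)) \<in> o(\<lambda>n. (2 ^ n) powr (1 / 50))"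
    and t: "t \<in> o(\<lambda>n. (2 ^ n) powr (1 / 4))"
  shows "\<forall>\<^sub>F n in sequentially. \<forall>R. rand_cost_le R (t n) \<longrightarrow>
    worst_case_success (comm_inputs n (k n)) (comm_inputs n (k n)) (forr_xor_comm n (k n)) R
      \<le> 1 / 2 + exp (- (1 / 4) * real (k n))"
proof -
  have ev_k: "\<forall>\<^sub>F n in sequentially. real (k n) \<le> (2 ^ n) powr (1 / 50)"
    using landau_o.smallD[OF k(2), of 1] by simp
  have ev_t: "\<forall>\<^sub>F n in sequentially. \<bar>t n\<bar> \<le> (2 ^ n) powr (1 / 4)"
    using landau_o.smallD[OF t, of 1] by simp
  have ev_N: "\<forall>\<^sub>F n :: nat in sequentially. 256 * (3600 * ((2 ^ n) powr (4 / 50)) * real n ^ 2) \<le> 2 ^ n"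
    by real_asymp
  \<comment> \<open>n \<ge> 1000 gives \<epsilon> \<le> 1/30000, below 1/(2 * 108^2) =
    1/23328.\<close>
  from ev_k ev_t ev_N eventually_ge_at_top[of 1000] show ?thesis
  proof eventually_elim
    case (elim n)
    define \<epsilon> where "\<epsilon> = forr_eps n (k n)"
    have n: "n \<ge> 1" using elim by simp
    have \<epsilon>0: "\<epsilon> > 0" using forr_eps_pos[OF n k(1)] by (simp add: \<epsilon>_def)
    have "\<epsilon> \<le> 1 / (30 * real n)" using forr_eps_le[OF n k(1)] by (simp add: \<epsilon>_def)
    also have "\<dots> \<le> 1 / 30000" using elim by (simp add: field_simps)
    finally have \<epsilon>1: "2 * \<epsilon> \<le> (1 / 108)\<^sup>2" by (simp add: power2_eq_square)
    have "real (k n) ^ 4 \<le> ((2 ^ n) powr (1 / 50)) ^ 4" using elim by (intro power_mono) auto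
    also have "\<dots> = ((2 ^ n) powr (1 / 50)) powr (real 4)" by (subst powr_realpow) auto
    also have "\<dots> = (2 ^ n) powr (4 / 50)" by (subst powr_powr) simp
    finally have k4: "real (k n) ^ 4 \<le> (2 ^ n) powr (4 / 50)" .
    have "256 * (1 / \<epsilon>\<^sup>2) \<le> 256 * (3600 * real (k n) ^ 4 * real n ^ 2)"
      using inverse_forr_eps_square_le[OF n, of "k n"] by (simp add: \<epsilon>_def)
    also have "\<dots> \<le> 256 * (3600 * ((2 ^ n) powr (4 / 50)) * real n ^ 2)"
      using k4 by (intro mult_left_mono mult_right_mono) auto
    also have "\<dots> \<le> 2 ^ n" using elim by simp
    finally have \<epsilon>2: "256 \<le> 2 ^ n * \<epsilon>\<^sup>2" using \<epsilon>0 by (simp add: divide_le_eq)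
    show ?case
    proof (intro allI impI)
      fix R :: "(real Matrix.vec, real Matrix.vec, int) protocol pmf"
      assume R: "rand_cost_le R (t n)"
      have "(real (depth p))\<^sup>2 \<le> sqrt (2 ^ n)" if "p \<in> set_pmf R" for p
      proof -
        have "real (depth p) \<le> (2 ^ n) powr (1 / 4)" using R that elim unfolding rand_cost_le_def by force
        then have "(real (depth p))\<^sup>2 \<le> ((2 ^ n) powr (1 / 4))\<^sup>2" by (intro power_mono) auto
        also have "\<dots> = sqrt (2 ^ n)" by (simp add: powr_half_sqrt[symmetric] powr_powr flip: powr_realpow)
        finally show ?thesis .
      qed
      then show "worst_case_success (comm_inputs n (k n)) (comm_inputs n (k n)) (forr_xor_comm n (k n)) R
          \<le> 1 / 2 + exp (- (1 / 4) * real (k n))"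
        using \<epsilon>0 \<epsilon>1 \<epsilon>2 unfolding \<epsilon>_def by (intro classical_bound) auto
    qed
  qed
qed

theorem theorem3p8:
  shows "\<exists>C>0. \<exists>c>0. \<exists>d::nat. \<forall>k :: nat \<Rightarrow> nat.
    (\<forall>n. k n \<ge> 1) \<longrightarrow>
    (\<lambda>n. real (k n)) \<in> o(\<lambda>n. (2 ^ n) powr (1 / 50)) \<longrightarrow>
      (\<forall>\<^sub>F n in sequentially. \<exists>P.
         qsmp_solves (comm_inputs n (k n)) (comm_inputs n (k n)) (forr_xor_comm n (k n)) P \<and>
         real (qsmp_cost P) \<le> C * qsmp_bound n (k n) \<and>
         real (epr_pairs P) \<le> C * qsmp_bound n (k n))
      \<and>
      (\<forall>t :: nat \<Rightarrow> real.
         t \<in> o(\<lambda>n. (2 ^ n) powr (1 / 4) / log 2 (2 ^ n) ^ d) \<longrightarrow>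
         (\<forall>\<^sub>F n in sequentially. \<forall>R.
            rand_cost_le R (t n) \<longrightarrow>
            worst_case_success (comm_inputs n (k n)) (comm_inputs n (k n))
              (forr_xor_comm n (k n)) R \<le> 1 / 2 + exp (- c * real (k n))))"
proof (rule exI[of _ "12000000 :: real"], rule conjI, simp, rule exI[of _ "1 / 4 :: real"], rule conjI, simp,
    rule exI[of _ "0 :: nat"], intro allI impI conjI)
  fix k :: "nat \<Rightarrow> nat"
  assume k: "\<forall>n. k n \<ge> 1" "(\<lambda>n. real (k n)) \<in> o(\<lambda>n. (2 ^ n) powr (1 / 50))"
  show "\<forall>\<^sub>F n in sequentially. \<exists>P.
      qsmp_solves (comm_inputs n (k n)) (comm_inputs n (k n)) (forr_xor_comm n (k n)) P \<and>
      real (qsmp_cost P) \<le> 12000000 * qsmp_bound n (k n) \<and>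
      real (epr_pairs P) \<le> 12000000 * qsmp_bound n (k n)"
    using eventually_ge_at_top[of 1]
    by eventually_elim (rule quantum_upper_bound, use k in auto)
  fix t :: "nat \<Rightarrow> real"
  \<comment> \<open>With \<open>d\<close> = 0 the divisor is 1: the correlation bound loses no
    logarithm, so cost o(N^(1/4)) is enough.\<close>
  assume "t \<in> o(\<lambda>n. (2 ^ n) powr (1 / 4) / log 2 (2 ^ n) ^ 0)"
  then show "\<forall>\<^sub>F n in sequentially. \<forall>R. rand_cost_le R (t n) \<longrightarrow>
      worst_case_success (comm_inputs n (k n)) (comm_inputs n (k n)) (forr_xor_comm n (k n)) R
        \<le> 1 / 2 + exp (- (1 / 4) * real (k n))"
    using k by (intro classical_lower_bound) auto
qed

end
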